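(* Let $X_i=g(\varepsilon_{i-s};\,s\in\mathbb{Z}^d)$, $i\in\mathbb{Z}^d$, be a stationary random field with $X_0\in\mathbb{L}^4$ (not necessarily centered), and assume $\Delta_4=\sum_{i\in\mathbb{Z}^d}\delta_{i,4}<\infty$. Fix $k\in\mathbb{Z}^d$ and let $Y_i=X_iX_{i+k}$, $i\in\mathbb{Z}^d$. Then $\sum_{i\in\mathbb{Z}^d}\delta_{i,2}(Y)<\infty$. Moreover, let $(\Gamma_n)_{n\ge1}$ be a sequence of finite subsets of $\mathbb{Z}^d$ and let $\Xi_n=\{i\in\Gamma_n:\,i+k\in\Gamma_n\}$. If $|\Xi_n|\to\infty$, then the central limit theorem holds for the sample averages $|\Xi_n|^{-1}\sum_{i\in\Xi_n}X_iX_{i+k}$, in the sense that, with $T_n=\sum_{i\in\Xi_n}\left(X_iX_{i+k}-\mathbb{E}(X_0X_k)\right)$, $$L\left[\frac{T_n}{\sqrt{|\Xi_n|}},\;N\left(0,\frac{\mathbb{E}(T_n^2)}{|\Xi_n|}\right)\right]\to0\quad\text{as } n\to\infty,$$ where $L[\cdot,\cdot]$ denotes the Lévy distance between probability distributions on $\mathbb{R}$.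
   Context: $d\ge1$ is an integer, $(\varepsilon_j)_{j\in\mathbb{Z}^d}$ are i.i.d. random variables and $g$ is a measurable function. Let $(\varepsilon'_j)$ be an i.i.d. copy of $(\varepsilon_j)$ (independent of it), $\varepsilon^*_j=\varepsilon_j$ if $j\ne0$, $\varepsilon^*_0=\varepsilon'_0$, and $X_i^*=g(\varepsilon^*_{i-s};\,s\in\mathbb{Z}^d)$. Define $\delta_{i,p}=\|X_i-X_i^*\|_p$ and, for $Y_i=X_iX_{i+k}$, $\delta_{i,p}(Y)=\|X_iX_{i+k}-X_i^*X_{i+k}^*\|_p$. $|\Xi|$ is the cardinality of $\Xi$. In $L[Z,N(0,v)]$ the random variable $Z$ stands for its law, and $N(0,v)$ is the centered Gaussian law with variance $v$ (Dirac mass at $0$ if $v=0$). *)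

theory Defs
  imports "HOL-Probability.Probability"
begin

definition iid_family :: "'a measure \<Rightarrow> 'b measure \<Rightarrow> ('i \<Rightarrow> 'a \<Rightarrow> 'b) \<Rightarrow> bool" where
  "iid_family M N \<epsilon> \<longleftrightarrow>
     prob_space.indep_vars M (\<lambda>_. N) \<epsilon> UNIV \<and>
     (\<forall>i j. distr M N (\<epsilon> i) = distr M N (\<epsilon> j))"

definition indep_iid_copy ::
  "'a measure \<Rightarrow> 'b measure \<Rightarrow> ('i \<Rightarrow> 'a \<Rightarrow> 'b) \<Rightarrow> ('i \<Rightarrow> 'a \<Rightarrow> 'b) \<Rightarrow> bool" where
  "indep_iid_copy M N \<epsilon> \<epsilon>' \<longleftrightarrow>
     iid_family M N \<epsilon>' \<and>
     (\<forall>j. distr M N (\<epsilon>' j) = distr M N (\<epsilon> j)) \<and>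
     prob_space.indep_var M
       (Pi\<^sub>M UNIV (\<lambda>_. N)) (\<lambda>\<omega> j. \<epsilon> j \<omega>)
       (Pi\<^sub>M UNIV (\<lambda>_. N)) (\<lambda>\<omega> j. \<epsilon>' j \<omega>)"

text \<open>The index set \<open>\<int>\<^sup>d\<close> is rendered as \<^typ>\<open>int ^ 'd\<close> with \<open>d = CARD('d) \<ge> 1\<close>.\<close>

definition bernoulli_field ::
  "((int ^ 'd \<Rightarrow> 'b) \<Rightarrow> real) \<Rightarrow> (int ^ 'd \<Rightarrow> 'a \<Rightarrow> 'b) \<Rightarrow> int ^ 'd \<Rightarrow> 'a \<Rightarrow> real" where
  "bernoulli_field g \<epsilon> i \<omega> = g (\<lambda>s. \<epsilon> (i - s) \<omega>)"

definition couple_at_0 ::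
  "(int ^ 'd \<Rightarrow> 'a \<Rightarrow> 'b) \<Rightarrow> (int ^ 'd \<Rightarrow> 'a \<Rightarrow> 'b) \<Rightarrow> int ^ 'd \<Rightarrow> 'a \<Rightarrow> 'b" where
  "couple_at_0 \<epsilon> \<epsilon>' j = (if j = 0 then \<epsilon>' 0 else \<epsilon> j)"

text \<open>The \<open>L\<^sup>p\<close> norm is extended-valued, so that finiteness of a norm, or of a sum of
  norms, really asserts integrability (the Bochner integral would return \<open>0\<close> instead).\<close>

definition Lp_norm :: "'a measure \<Rightarrow> real \<Rightarrow> ('a \<Rightarrow> real) \<Rightarrow> ennreal" where
  "Lp_norm M p Z =
     (let I = \<integral>\<^sup>+ \<omega>. ennreal (\<bar>Z \<omega>\<bar> powr p) \<partial>M
      in if I = \<infinity> then \<infinity> else ennreal (enn2real I powr (1 / p)))"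

definition levy_dist :: "real measure \<Rightarrow> real measure \<Rightarrow> real" where
  "levy_dist \<mu> \<nu> = Inf {r. r > 0 \<and>
     (\<forall>x. cdf \<mu> (x - r) - r \<le> cdf \<nu> x \<and> cdf \<nu> x \<le> cdf \<mu> (x + r) + r)}"

text \<open>The argument is the variance, whereas \<^const>\<open>normal_density\<close> takes the
  standard deviation.\<close>

definition centered_gaussian :: "real \<Rightarrow> real measure" where
  "centered_gaussian v =
     (if v = 0 then return borel 0
      else density lborel (\<lambda>x. ennreal (normal_density 0 (sqrt v) x)))"

end

(*
  Work on the product space carrying the innovations together with an independent copy.
  Replacing the coordinates by their copies one after another, and exchanging the two copies of
  each coordinate, gives |Cov(F, H)| <= sum_j delta_j(F) delta_j(H), where delta_j is the L2 effect of
  resampling coordinate j.  Hence Var(sum over G of V_i) <= |G| (sum_j delta_j(V))^2 for every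
  finite index set G, whatever its shape.

  The products Y_i inherit summable L2 effects from the L4 effects of X by Cauchy-Schwarz.
  Conditioning the truncated Y_0 on finitely many coordinates does not increase any delta_j and
  converges in L2, so by dominated convergence the sum of the delta_j of the error is small.
  By the variance bound this reduces the claim to bounded functions of finitely many
  coordinates.

  For these, let z_i be the normalized summands, S their sum and s_i the part of S correlated with
  z_i.  As E[z_i exp(iu(S - s_i))] = 0, expanding exp(-iu s_i) gives
  phi'(u) = -u Var(S) phi(u) + O(|G|^(-1/2)) for the characteristic function phi of S, and so
  phi is close to the Gaussian one without any assumption on the limit of the variances.  Along
  subsequences the (bounded) variances converge, and Levy's continuity theorem concludes.
*)
theory Submission
  imports Defs
begin

subsection \<open>Square-integrable functions\<close>

text \<open>Neither \<open>int ^ 'd\<close> nor the sets over which one sums come with a useful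
  order or shape, so filtrations and blocks are avoided: coordinates are resampled in an arbitrary
  order, which works because resampling j costs the same whatever has been resampled before. A
  family and its copy form one i.i.d. family indexed by \<open>'i + 'i\<close>; reading a copy,
  exchanging copies and translating are then reindexings along injective maps, so a single
  invariance lemma covers them all. Only finitely many coordinates can be resampled one by one,
  hence L2 functions are first shown to be nearly insensitive to all but finitely many coordinates.
  Until the final statement, summability is expressed as a bound D on all finite partial sums. The
  variances may tend to 0, so one never divides by them: v is the exact variance of the finite-range
  sum and enters through the integrating factor exp(v s^2/2). Truncation precedes conditioning so
  that the approximating function is bounded at every point, and clamping, being 1-Lipschitz, cannot
  increase an influence.\<close>

definition square_integrable :: "'a measure \<Rightarrow> ('a \<Rightarrow> real) \<Rightarrow> bool" where
  "square_integrable M f \<longleftrightarrow> f \<in> borel_measurable M \<and> integrable M (\<lambda>x. (f x)\<^sup>2)"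

definition l2norm :: "'a measure \<Rightarrow> ('a \<Rightarrow> real) \<Rightarrow> real" where
  "l2norm M f = sqrt (LINT x|M. (f x)\<^sup>2)"

lemma square_integrable_measurable[measurable_dest]:
  "square_integrable M f \<Longrightarrow> f \<in> borel_measurable M"
  by (simp add: square_integrable_def)

lemma square_integrable_power2: "square_integrable M f \<Longrightarrow> integrable M (\<lambda>x. (f x)\<^sup>2)"
  by (simp add: square_integrable_def)

lemma l2norm_nonneg[simp]: "0 \<le> l2norm M f"
  by (simp add: l2norm_def)

lemma l2norm_power2: "(l2norm M f)\<^sup>2 = (LINT x|M. (f x)\<^sup>2)"
  by (simp add: l2norm_def)

lemma abs_mult_le_half_squares: "\<bar>a * b\<bar> \<le> (a\<^sup>2 + b\<^sup>2) / (2::real)"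
  using sum_squares_bound[of "\<bar>a\<bar>" "\<bar>b\<bar>"] by (simp add: abs_mult)

lemma power2_add_le: "(a + b)\<^sup>2 \<le> 2 * (a\<^sup>2 + b\<^sup>2)" for a b :: real
  using sum_squares_bound[of a b] by (simp add: power2_sum)

lemma power2_diff_le: "(a - b)\<^sup>2 \<le> 2 * (a\<^sup>2 + b\<^sup>2)" for a b :: real
  using power2_add_le[of a "-b"] by simp

lemma square_integrable_mult:
  assumes "square_integrable M f" "square_integrable M g"
  shows "integrable M (\<lambda>x. f x * g x)"
proof (rule Bochner_Integration.integrable_bound)
  show "integrable M (\<lambda>x. ((f x)\<^sup>2 + (g x)\<^sup>2) / 2)"
    using assms by (auto simp: square_integrable_def)
  show "AE x in M. norm (f x * g x) \<le> norm (((f x)\<^sup>2 + (g x)\<^sup>2) / 2)"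
    by (intro AE_I2) (use abs_mult_le_half_squares in simp)
qed (use assms in measurable)

lemma square_integrable_add:
  assumes "square_integrable M f" "square_integrable M g"
  shows "square_integrable M (\<lambda>x. f x + g x)"
  using assms square_integrable_mult[OF assms]
  by (auto simp: square_integrable_def power2_sum mult.assoc)

lemma square_integrable_cmult:
  "square_integrable M f \<Longrightarrow> square_integrable M (\<lambda>x. c * f x)"
  by (auto simp: square_integrable_def power_mult_distrib)

lemma square_integrable_diff:
  assumes "square_integrable M f" "square_integrable M g"
  shows "square_integrable M (\<lambda>x. f x - g x)"
  using square_integrable_add[OF assms(1) square_integrable_cmult[OF assms(2), of "-1"]] by simp

lemma square_integrable_sum:
  "(\<And>i. i \<in> I \<Longrightarrow> square_integrable M (f i)) \<Longrightarrow> square_integrable M (\<lambda>x. \<Sum>i\<in>I. f i x)"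
proof (induction I rule: infinite_finite_induct)
  case (insert i I)
  then show ?case using square_integrable_add[of M "f i" "\<lambda>x. \<Sum>i\<in>I. f i x"] by auto
qed (auto simp: square_integrable_def)

lemma square_integrable_mono:
  assumes "square_integrable M f" "g \<in> borel_measurable M" "\<And>x. \<bar>g x\<bar> \<le> \<bar>f x\<bar>"
  shows "square_integrable M g"
  unfolding square_integrable_def
proof (intro conjI Bochner_Integration.integrable_bound[OF square_integrable_power2[OF assms(1)]])
  show "AE x in M. norm ((g x)\<^sup>2) \<le> norm ((f x)\<^sup>2)"
    using assms(3) by (intro AE_I2) (simp add: abs_le_square_iff)
qed (use assms in measurable)

lemma (in prob_space) square_integrable_bounded:
  assumes "f \<in> borel_measurable M" "\<And>x. \<bar>f x\<bar> \<le> c"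
  shows "square_integrable M f"
  using square_integrable_mono[of M "\<lambda>_. c" f] assms
  by (simp add: square_integrable_def order.trans[OF assms(2) abs_ge_self])

lemma (in prob_space) square_integrable_const: "square_integrable M (\<lambda>_. c)"
  by (simp add: square_integrable_def)

lemma (in prob_space) square_integrable_integrable:
  "square_integrable M f \<Longrightarrow> integrable M f"
  using square_integrable_mult[OF _ square_integrable_const[of 1]] by simp

lemma Cauchy_Schwarz_l2norm:
  assumes f: "square_integrable M f" and g: "square_integrable M g"
  shows "\<bar>LINT x|M. f x * g x\<bar> \<le> l2norm M f * l2norm M g"
proof -
  let ?A = "LINT x|M. (f x)\<^sup>2" and ?B = "LINT x|M. (g x)\<^sup>2" and ?C = "LINT x|M. f x * g x"
  have "0 \<le> (LINT x|M. (a * f x + b * g x)\<^sup>2)" for a b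
    by simp
  also have "(LINT x|M. (a * f x + b * g x)\<^sup>2) = a\<^sup>2 * ?A + 2 * a * b * ?C + b\<^sup>2 * ?B" for a b
  proof -
    have "(LINT x|M. (a * f x + b * g x)\<^sup>2) =
      (LINT x|M. a\<^sup>2 * (f x)\<^sup>2 + (2 * a * b) * (f x * g x) + b\<^sup>2 * (g x)\<^sup>2)"
      by (intro Bochner_Integration.integral_cong) (auto simp: power2_eq_square algebra_simps)
    then show ?thesis
      using square_integrable_mult[OF f g] f g by (simp add: square_integrable_power2)
  qed
  finally have quad: "0 \<le> a\<^sup>2 * ?A + 2 * a * b * ?C + b\<^sup>2 * ?B" for a b .
  have A: "0 \<le> ?A" and B: "0 \<le> ?B" by simp_all
  have "?C\<^sup>2 \<le> ?A * ?B"
  proof (cases "?B = 0")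
    case True
    have "0 \<le> ?A - 2 * s * ?C" for s using quad[of 1 "-s"] True by simp
    \<comment> \<open>With B = 0 the quadratic is affine in s; this value of s makes it -1 unless C
      = 0.\<close>
    from this[of "(?A + 1) / (2 * ?C)"] have "?C = 0" using A
      by (cases "?C = 0") (auto simp: field_simps)
    then show ?thesis using True by simp
  next
    case False
    then have "0 < ?B" using B by linarith
    \<comment> \<open>a = B and b = -C is the minimising direction; the quadratic becomes B times
      the quantity whose sign is wanted.\<close>
    moreover have "0 \<le> ?B * (?A * ?B - ?C\<^sup>2)"
      using quad[of ?B "- ?C"] by (simp add: power2_eq_square algebra_simps)
    ultimately show ?thesis by (simp add: zero_le_mult_iff)
  qed
  then have "sqrt (?C\<^sup>2) \<le> sqrt (?A * ?B)" by (rule real_sqrt_le_mono)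
  then show ?thesis by (simp add: l2norm_def real_sqrt_mult)
qed

lemma (in prob_space) expectation_abs_le_l2norm:
  assumes "square_integrable M f"
  shows "expectation (\<lambda>x. \<bar>f x\<bar>) \<le> l2norm M f"
proof -
  have "square_integrable M (\<lambda>x. \<bar>f x\<bar>)"
    using assms by (auto simp: square_integrable_def)
  from Cauchy_Schwarz_l2norm[OF this square_integrable_const[of 1]]
  show ?thesis by (simp add: l2norm_def prob_space)
qed

lemma (in prob_space) power2_expectation_le:
  assumes "square_integrable M f"
  shows "(expectation f)\<^sup>2 \<le> expectation (\<lambda>x. (f x)\<^sup>2)"
proof -
  have "\<bar>expectation f\<bar> \<le> expectation (\<lambda>x. \<bar>f x\<bar>)" by (rule integral_abs_bound)
  also have "\<dots> \<le> l2norm M f" by (rule expectation_abs_le_l2norm[OF assms])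
  finally have "\<bar>expectation f\<bar>\<^sup>2 \<le> (l2norm M f)\<^sup>2" by (intro power_mono) auto
  then show ?thesis by (simp add: l2norm_power2)
qed

subsection \<open>Product measures of identical factors\<close>

text \<open>The index set is the whole index type, so that one notation serves a family, a family
  with its copy and further disjoint sums.\<close>

definition iid_measure :: "'b measure \<Rightarrow> ('i \<Rightarrow> 'b) measure" where
  "iid_measure N = Pi\<^sub>M UNIV (\<lambda>_. N)"

lemma sets_iid_measure[measurable_cong]: "sets (iid_measure N) = sets (Pi\<^sub>M UNIV (\<lambda>_. N))"
  by (simp add: iid_measure_def)

lemma prob_space_iid_measure: "prob_space N \<Longrightarrow> prob_space (iid_measure N)"
  unfolding iid_measure_def by (intro prob_space_PiM)

lemma reindex_measurable:
  "(\<lambda>\<omega> i. \<omega> (t i)) \<in> measurable (iid_measure N) (iid_measure N)"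
proof -
  have "(\<lambda>\<omega> i. \<omega> (t i)) \<in> measurable (Pi\<^sub>M UNIV (\<lambda>_. N)) (Pi\<^sub>M UNIV (\<lambda>_. N))"
    by (intro measurable_PiM_single') (auto simp: space_PiM PiE_def Pi_def)
  then show ?thesis by (simp add: iid_measure_def)
qed

text \<open>For injective \<open>t\<close> the coordinates \<open>\<omega> (t i)\<close> are
  distinct, hence again i.i.d. with law N. The index types on the two sides may differ, so this
  covers choosing copies (\<open>mix\<close>), exchanging them (\<open>flip\<close>) and translating
  (\<open>shift\<close>).\<close>

lemma distr_iid_measure_reindex:
  assumes "prob_space N" "inj t"
  shows "distr (iid_measure N) (iid_measure N) (\<lambda>\<omega> i. \<omega> (t i)) = iid_measure N"
  using distr_PiM_reindex[of UNIV "\<lambda>_. N" t UNIV] assms by (simp add: iid_measure_def restrict_def)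

lemma integral_iid_measure_reindex:
  fixes f :: "('i \<Rightarrow> 'b) \<Rightarrow> real"
  assumes "prob_space N" "inj t" "f \<in> borel_measurable (iid_measure N)"
  shows "(LINT \<omega>|iid_measure N. f (\<lambda>i. \<omega> (t i))) = (LINT x|iid_measure N. f x)"
  using integral_distr[OF reindex_measurable, of f N t] assms
  by (simp add: distr_iid_measure_reindex)

lemma square_integrable_reindex:
  assumes "prob_space N" "inj t" "square_integrable (iid_measure N) f"
  shows "square_integrable (iid_measure N) (\<lambda>\<omega>. f (\<lambda>i. \<omega> (t i)))"
proof -
  have [measurable]: "f \<in> borel_measurable (iid_measure N)" by (rule square_integrable_measurable[OF assms(3)])
  have "integrable (distr (iid_measure N) (iid_measure N) (\<lambda>\<omega> i. \<omega> (t i))) (\<lambda>x. (f x)\<^sup>2)"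
    using assms by (simp add: distr_iid_measure_reindex square_integrable_power2)
  then show ?thesis
    unfolding square_integrable_def by (subst (asm) integrable_distr_eq) (auto intro: measurable_compose[OF reindex_measurable] reindex_measurable)
qed

lemma case_sum_measurable:
  "(\<lambda>(x, y). case_sum x y) \<in> measurable (iid_measure N \<Otimes>\<^sub>M iid_measure N) (iid_measure N)"
proof -
  have comp: "(\<lambda>\<omega>. case_sum (fst \<omega>) (snd \<omega>) i) \<in> measurable (iid_measure N \<Otimes>\<^sub>M iid_measure N) N"
    for i :: "'a + 'c"
    by (cases i) simp_all
  have "(\<lambda>\<omega> i. case_sum (fst \<omega>) (snd \<omega>) i) \<in>
    measurable (iid_measure N \<Otimes>\<^sub>M iid_measure N) (Pi\<^sub>M (UNIV :: ('a + 'c) set) (\<lambda>_. N))"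
    using comp
    by (intro measurable_PiM_single')
      (auto simp: space_pair_measure iid_measure_def space_PiM PiE_iff split: sum.split)
  then show ?thesis by (simp add: case_prod_beta' iid_measure_def)
qed

text \<open>Finite-dimensional cylinders determine the product measure, and one over
  \<open>'a + 'c\<close> is a rectangle with sides a cylinder over the left and one over the right
  indices. This makes Fubini available for a family and its copy.\<close>

lemma distr_case_sum_iid_measure:
  fixes N :: "'b measure"
  assumes "prob_space N"
  shows "distr ((iid_measure N :: ('a \<Rightarrow> 'b) measure) \<Otimes>\<^sub>M (iid_measure N :: ('c \<Rightarrow> 'b) measure))
    (iid_measure N) (\<lambda>(x, y). case_sum x y) = iid_measure N"
proof -
  interpret N: prob_space N by fact
  interpret P1: prob_space "iid_measure N :: ('a \<Rightarrow> 'b) measure" by (rule prob_space_iid_measure[OF assms])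
  interpret P2: prob_space "iid_measure N :: ('c \<Rightarrow> 'b) measure" by (rule prob_space_iid_measure[OF assms])
  interpret PP: pair_prob_space "iid_measure N :: ('a \<Rightarrow> 'b) measure" "iid_measure N :: ('c \<Rightarrow> 'b) measure" ..
  have m: "(\<lambda>(x, y). case_sum x y) \<in> measurable ((iid_measure N :: ('a \<Rightarrow> 'b) measure) \<Otimes>\<^sub>M
      (iid_measure N :: ('c \<Rightarrow> 'b) measure)) (Pi\<^sub>M UNIV (\<lambda>_. N))"
    unfolding iid_measure_def[where 'b = 'b and 'i = "'a + 'c", symmetric] by (rule case_sum_measurable)
  show ?thesis
    unfolding iid_measure_def[where 'b = 'b and 'i = "'a + 'c"]
  proof (rule measure_eqI_PiM_infinite[symmetric])
    show "finite_measure (Pi\<^sub>M UNIV (\<lambda>_::'a + 'c. N))"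
      by (intro prob_space.finite_measure prob_space_PiM assms)
    fix A :: "'a + 'c \<Rightarrow> 'b set" and J :: "('a + 'c) set"
    assume J: "finite J" "J \<subseteq> UNIV" and A: "\<And>i. i \<in> J \<Longrightarrow> A i \<in> sets N"
    let ?E = "prod_emb UNIV (\<lambda>_. N) J (Pi\<^sub>E J A)"
    let ?E1 = "prod_emb UNIV (\<lambda>_. N) (Inl -` J) (\<Pi>\<^sub>E i\<in>Inl -` J. A (Inl i))"
    let ?E2 = "prod_emb UNIV (\<lambda>_. N) (Inr -` J) (\<Pi>\<^sub>E i\<in>Inr -` J. A (Inr i))"
    have fin: "finite (Inl -` J)" "finite (Inr -` J)"
      using J by (auto intro: finite_vimageI)
    have E: "?E \<in> sets (Pi\<^sub>M UNIV (\<lambda>_. N))"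
      using J A by (intro sets_PiM_I) auto
    have E12: "?E1 \<in> sets (iid_measure N)" "?E2 \<in> sets (iid_measure N)"
      using fin A by (auto simp: iid_measure_def intro!: sets_PiM_I)
    have J_eq: "J = Inl ` (Inl -` J) \<union> Inr ` (Inr -` J)"
      by (auto simp: image_iff) (metis sum.exhaust)
    have vim: "(\<lambda>(x, y). case_sum x y) -` ?E \<inter> space (iid_measure N \<Otimes>\<^sub>M iid_measure N) = ?E1 \<times> ?E2"
      using A[THEN sets.sets_into_space]
      by (subst (1) J_eq)
        (auto simp: prod_emb_def iid_measure_def space_pair_measure space_PiM PiE_iff extensional_def split: sum.splits)
    have "distr (iid_measure N \<Otimes>\<^sub>M iid_measure N) (Pi\<^sub>M UNIV (\<lambda>_. N)) (\<lambda>(x, y). case_sum x y) ?E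
        = emeasure (iid_measure N \<Otimes>\<^sub>M iid_measure N) (?E1 \<times> ?E2)"
      by (simp only: emeasure_distr[OF m E] vim)
    also have "\<dots> = emeasure (iid_measure N) ?E1 * emeasure (iid_measure N) ?E2"
      using E12 by (rule P2.emeasure_pair_measure_Times)
    also have "\<dots> = (\<Prod>i\<in>Inl -` J. emeasure N (A (Inl i))) * (\<Prod>i\<in>Inr -` J. emeasure N (A (Inr i)))"
      unfolding iid_measure_def using fin A assms
      by (intro arg_cong2[where f="(*)"] emeasure_PiM_emb) auto
    also have "\<dots> = (\<Prod>i\<in>Inl ` (Inl -` J) \<union> Inr ` (Inr -` J). emeasure N (A i))"
      using fin by (subst prod.union_disjoint) (auto simp: prod.reindex simp del: image_vimage_eq)
    also have "\<dots> = (\<Prod>i\<in>J. emeasure N (A i))"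
      by (simp only: J_eq[symmetric])
    also have "\<dots> = emeasure (Pi\<^sub>M UNIV (\<lambda>_. N)) ?E"
      using J A assms by (intro emeasure_PiM_emb[symmetric]) auto
    finally show "emeasure (Pi\<^sub>M UNIV (\<lambda>_. N)) ?E =
      distr (iid_measure N \<Otimes>\<^sub>M iid_measure N) (Pi\<^sub>M UNIV (\<lambda>_. N)) (\<lambda>(x, y). case_sum x y) ?E" by simp
  qed simp_all
qed

subsection \<open>Mixing a family with an independent copy\<close>

text \<open>A point of \<open>'i + 'i \<Rightarrow> 'b\<close> encodes a family (left summand) together with an independent copy.\<close>

definition mix :: "'i set \<Rightarrow> ('i + 'i \<Rightarrow> 'b) \<Rightarrow> 'i \<Rightarrow> 'b" where
  "mix S \<omega> i = \<omega> (if i \<in> S then Inr i else Inl i)"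

text \<open>A law-preserving involution; by \<open>mix_flip\<close> it toggles, for each coordinate
  in S, which copy \<open>mix\<close> reads.\<close>

definition flip :: "'i set \<Rightarrow> ('i + 'i \<Rightarrow> 'b) \<Rightarrow> 'i + 'i \<Rightarrow> 'b" where
  "flip S \<omega> k = \<omega> (case k of Inl i \<Rightarrow> if i \<in> S then Inr i else Inl i
                           | Inr i \<Rightarrow> if i \<in> S then Inl i else Inr i)"

text \<open>The dependence coefficient seen from the other side: the function is fixed and the
  resampled coordinate moves, whereas \<delta> resamples coordinate 0 and moves the site.
  \<open>influence_shift\<close> links the two.\<close>

definition influence :: "'b measure \<Rightarrow> (('i \<Rightarrow> 'b) \<Rightarrow> real) \<Rightarrow> 'i \<Rightarrow> real" where
  "influence N f j = l2norm (iid_measure N) (\<lambda>\<omega>. f (mix {} \<omega>) - f (mix {j} \<omega>))"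

lemma mix_flip: "mix S (flip J \<omega>) = mix (sym_diff S J) \<omega>"
  by (auto simp: mix_def flip_def fun_eq_iff)

lemma mix_empty_case_sum: "mix {} (case_sum x y) = x"
  by (auto simp: mix_def fun_eq_iff)

lemma mix_UNIV_case_sum: "mix UNIV (case_sum x y) = y"
  by (auto simp: mix_def fun_eq_iff)

lemma mix_eq_reindex: "mix S = (\<lambda>\<omega> i. \<omega> (if i \<in> S then Inr i else Inl i))"
  by (auto simp: mix_def fun_eq_iff)

lemma flip_eq_reindex: "flip S = (\<lambda>\<omega> k. \<omega> (case k of Inl i \<Rightarrow> if i \<in> S then Inr i else Inl i
                           | Inr i \<Rightarrow> if i \<in> S then Inl i else Inr i))"
  by (auto simp: flip_def fun_eq_iff)

lemma mix_measurable[measurable]: "mix S \<in> measurable (iid_measure N) (iid_measure N)"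
  unfolding mix_eq_reindex by (rule reindex_measurable)

lemma flip_measurable[measurable]: "flip S \<in> measurable (iid_measure N) (iid_measure N)"
  unfolding flip_eq_reindex by (rule reindex_measurable)

lemma inj_mix_index: "inj (\<lambda>i. if i \<in> S then Inr i else Inl i)"
  by (rule inj_on_inverseI[where g = "case_sum id id"]) simp

lemma inj_flip_index: "inj (\<lambda>k. case k of Inl i \<Rightarrow> if i \<in> S then Inr i else Inl i
                           | Inr i \<Rightarrow> if i \<in> S then Inl i else Inr i)"
proof (rule inj_on_inverseI)
  fix k :: "'a + 'a"
  let ?f = "\<lambda>k. case k of Inl i \<Rightarrow> if i \<in> S then Inr i else Inl i | Inr i \<Rightarrow> if i \<in> S then Inl i else Inr i"
  show "?f (?f k) = k" by (cases k) simp_all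
qed

lemma influence_nonneg[simp]: "0 \<le> influence N f j"
  by (simp add: influence_def)

locale iid_factor =
  fixes N :: "'b measure"
  assumes N: "prob_space N"
begin

lemma integral_mix:
  fixes f :: "('i \<Rightarrow> 'b) \<Rightarrow> real"
  assumes "f \<in> borel_measurable (iid_measure N)"
  shows "(LINT \<omega>|iid_measure N. f (mix S \<omega>)) = (LINT x|iid_measure N. f x)"
  unfolding mix_eq_reindex by (rule integral_iid_measure_reindex[OF N inj_mix_index assms])

lemma square_integrable_mix:
  fixes f :: "('i \<Rightarrow> 'b) \<Rightarrow> real"
  assumes "square_integrable (iid_measure N) f"
  shows "square_integrable (iid_measure N) (\<lambda>\<omega>. f (mix S \<omega>))"
  unfolding mix_eq_reindex by (rule square_integrable_reindex[OF N inj_mix_index assms])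

lemma l2norm_mix:
  fixes f :: "('i \<Rightarrow> 'b) \<Rightarrow> real"
  assumes [measurable]: "f \<in> borel_measurable (iid_measure N)"
  shows "l2norm (iid_measure N) (\<lambda>\<omega>. f (mix S \<omega>)) = l2norm (iid_measure N) f"
proof -
  have "(\<lambda>x. (f x)\<^sup>2) \<in> borel_measurable (iid_measure N)" by measurable
  from integral_mix[OF this, of S] show ?thesis by (simp add: l2norm_def)
qed

lemma integral_flip:
  fixes f :: "('i + 'i \<Rightarrow> 'b) \<Rightarrow> real"
  assumes "f \<in> borel_measurable (iid_measure N)"
  shows "(LINT \<omega>|iid_measure N. f (flip S \<omega>)) = (LINT x|iid_measure N. f x)"
  unfolding flip_eq_reindex by (rule integral_iid_measure_reindex[OF N inj_flip_index assms])

lemma square_integrable_mix_diff: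
  fixes f :: "('i \<Rightarrow> 'b) \<Rightarrow> real"
  assumes "square_integrable (iid_measure N) f"
  shows "square_integrable (iid_measure N) (\<lambda>\<omega>. f (mix A \<omega>) - f (mix B \<omega>))"
  by (rule square_integrable_diff[OF square_integrable_mix[OF assms] square_integrable_mix[OF assms]])

text \<open>\<open>flip J\<close> preserves the law and acts on both sets by symmetric difference;
  this moves a pair of resampled sets to a convenient place.\<close>

lemma l2norm_mix_diff_flip:
  fixes f :: "('i \<Rightarrow> 'b) \<Rightarrow> real"
  assumes [measurable]: "f \<in> borel_measurable (iid_measure N)"
  shows "l2norm (iid_measure N) (\<lambda>\<omega>. f (mix (sym_diff A J) \<omega>) - f (mix (sym_diff B J) \<omega>))
       = l2norm (iid_measure N) (\<lambda>\<omega>. f (mix A \<omega>) - f (mix B \<omega>))"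
proof -
  have "(\<lambda>\<omega>. (f (mix A \<omega>) - f (mix B \<omega>))\<^sup>2) \<in> borel_measurable (iid_measure N)" by measurable
  from integral_flip[OF this, of J] show ?thesis by (simp only: l2norm_def mix_flip)
qed

subsection \<open>Approximation by finitely many coordinates\<close>

text \<open>Stated through resampling instead of conditional expectations: changing any set of
  coordinates off B, finite or not, moves f little in L2.\<close>

definition finitely_approximable :: "(('i \<Rightarrow> 'b) \<Rightarrow> real) \<Rightarrow> bool" where
  "finitely_approximable f \<longleftrightarrow>
    (\<forall>e>0. \<exists>B. finite B \<and> (\<forall>S. S \<inter> B = {} \<longrightarrow>
       (LINT \<omega>|iid_measure N. (f (mix {} \<omega>) - f (mix S \<omega>))\<^sup>2) < e))"

text \<open>Resampling preserves the law, so the error f - g has the same L2 size at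
  \<open>mix {} \<omega>\<close> and at \<open>mix S \<omega>\<close>; what remains is the increment
  of g.\<close>

lemma finitely_approximable_limit:
  fixes f :: "('i \<Rightarrow> 'b) \<Rightarrow> real"
  assumes f: "square_integrable (iid_measure N) f"
    and approx: "\<And>e. e > 0 \<Longrightarrow> \<exists>g. square_integrable (iid_measure N) g \<and> finitely_approximable g \<and>
       (LINT x|iid_measure N. (f x - g x)\<^sup>2) < e"
  shows "finitely_approximable f"
  unfolding finitely_approximable_def
proof (intro allI impI)
  fix e :: real assume "e > 0"
  \<comment> \<open>Three terms with the factor 3 of \<open>tri\<close>: 3 * (e/12 + e/12 + e/6) =
    e.\<close>
  from approx[of "e/12"] \<open>e > 0\<close> obtain g where g: "square_integrable (iid_measure N) g"
    "finitely_approximable g" and fg: "(LINT x|iid_measure N. (f x - g x)\<^sup>2) < e / 12" by auto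
  from g(2) \<open>e > 0\<close> obtain B where B: "finite B"
    "\<And>S. S \<inter> B = {} \<Longrightarrow> (LINT \<omega>|iid_measure N. (g (mix {} \<omega>) - g (mix S \<omega>))\<^sup>2) < e / 6"
    unfolding finitely_approximable_def by (meson divide_pos_pos zero_less_numeral)
  have "(LINT \<omega>|iid_measure N. (f (mix {} \<omega>) - f (mix S \<omega>))\<^sup>2) < e" if S: "S \<inter> B = {}" for S
  proof -
    note [measurable] = square_integrable_measurable[OF f] square_integrable_measurable[OF g(1)]
    have d: "square_integrable (iid_measure N) (\<lambda>x. f x - g x)"
      by (intro square_integrable_diff f g)
    note i1 = square_integrable_power2[OF square_integrable_mix[OF d]]
    note i2 = square_integrable_power2[OF square_integrable_mix_diff[OF g(1)]]
    have "(LINT \<omega>|iid_measure N. (f (mix {} \<omega>) - f (mix S \<omega>))\<^sup>2) \<le>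
      (LINT \<omega>|iid_measure N. 3 * ((f (mix {} \<omega>) - g (mix {} \<omega>))\<^sup>2 + (f (mix S \<omega>) - g (mix S \<omega>))\<^sup>2
         + (g (mix {} \<omega>) - g (mix S \<omega>))\<^sup>2))"
    proof (intro integral_mono)
      show "integrable (iid_measure N) (\<lambda>\<omega>. (f (mix {} \<omega>) - f (mix S \<omega>))\<^sup>2)"
        by (rule square_integrable_power2[OF square_integrable_mix_diff[OF f]])
      have tri: "(u - v)\<^sup>2 \<le> 3 * ((u - a)\<^sup>2 + (v - b)\<^sup>2 + (a - b)\<^sup>2)" for u v a b :: real
      proof -
        \<comment> \<open>The three squares add up to the difference of the two sides.\<close>
        have "0 \<le> ((u - a) + (v - b))\<^sup>2 + ((u - a) - (a - b))\<^sup>2 + ((v - b) + (a - b))\<^sup>2" by simp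
        then show ?thesis by (simp add: power2_eq_square algebra_simps)
      qed
      then show "(f (mix {} \<omega>) - f (mix S \<omega>))\<^sup>2 \<le> 3 * ((f (mix {} \<omega>) - g (mix {} \<omega>))\<^sup>2
         + (f (mix S \<omega>) - g (mix S \<omega>))\<^sup>2 + (g (mix {} \<omega>) - g (mix S \<omega>))\<^sup>2)" for \<omega> .
    qed (intro integrable_mult_right Bochner_Integration.integrable_add i1 i2)
    also have "\<dots> = 3 * ((LINT \<omega>|iid_measure N. (f (mix {} \<omega>) - g (mix {} \<omega>))\<^sup>2)
        + (LINT \<omega>|iid_measure N. (f (mix S \<omega>) - g (mix S \<omega>))\<^sup>2)
        + (LINT \<omega>|iid_measure N. (g (mix {} \<omega>) - g (mix S \<omega>))\<^sup>2))"
      using i1 i2 by simp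
    also have "\<dots> < 3 * (e / 12 + e / 12 + e / 6)"
      using fg B(2)[OF S] integral_mix[of "\<lambda>x. (f x - g x)\<^sup>2" "{}"] integral_mix[of "\<lambda>x. (f x - g x)\<^sup>2" S]
      by simp
    finally show ?thesis by simp
  qed
  with B(1) show "\<exists>B. finite B \<and> (\<forall>S. S \<inter> B = {} \<longrightarrow>
      (LINT \<omega>|iid_measure N. (f (mix {} \<omega>) - f (mix S \<omega>))\<^sup>2) < e)" by blast
qed

text \<open>Two dominating functions are what unions, sums and the recombination of positive and
  negative parts require; complements and multiples use f = g.\<close>

lemma finitely_approximable_dominated:
  fixes f g h :: "('i \<Rightarrow> 'b) \<Rightarrow> real"
  assumes f: "square_integrable (iid_measure N) f" "finitely_approximable f"
    and g: "square_integrable (iid_measure N) g" "finitely_approximable g"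
    and h: "h \<in> borel_measurable (iid_measure N)"
    and le: "\<And>x y. \<bar>h x - h y\<bar> \<le> c * \<bar>f x - f y\<bar> + c * \<bar>g x - g y\<bar>"
  shows "finitely_approximable h"
  unfolding finitely_approximable_def
proof (intro allI impI)
  fix e :: real assume "e > 0"
  \<comment> \<open>The bound obtained is 4 * c^2 * e'; the added 1 keeps the denominator positive
    when c = 0.\<close>
  define e' where "e' = e / (4 * (c\<^sup>2 + 1))"
  have c: "0 < 4 * (c\<^sup>2 + 1)" by (simp add: add_nonneg_pos)
  have "e' > 0" using \<open>e > 0\<close> c by (simp add: e'_def)
  obtain B where B: "finite B"
    "\<And>S. S \<inter> B = {} \<Longrightarrow> (LINT \<omega>|iid_measure N. (f (mix {} \<omega>) - f (mix S \<omega>))\<^sup>2) < e'"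
    using f(2) \<open>e' > 0\<close> unfolding finitely_approximable_def by blast
  obtain C where C: "finite C"
    "\<And>S. S \<inter> C = {} \<Longrightarrow> (LINT \<omega>|iid_measure N. (g (mix {} \<omega>) - g (mix S \<omega>))\<^sup>2) < e'"
    using g(2) \<open>e' > 0\<close> unfolding finitely_approximable_def by blast
  have "(LINT \<omega>|iid_measure N. (h (mix {} \<omega>) - h (mix S \<omega>))\<^sup>2) < e" if S: "S \<inter> (B \<union> C) = {}" for S
  proof -
    note [measurable] = h
    note i1 = square_integrable_power2[OF square_integrable_mix_diff[OF f(1)]]
    note i2 = square_integrable_power2[OF square_integrable_mix_diff[OF g(1)]]
    have "(LINT \<omega>|iid_measure N. (h (mix {} \<omega>) - h (mix S \<omega>))\<^sup>2) \<le>
      (LINT \<omega>|iid_measure N. 2 * c\<^sup>2 * ((f (mix {} \<omega>) - f (mix S \<omega>))\<^sup>2 + (g (mix {} \<omega>) - g (mix S \<omega>))\<^sup>2))"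
    proof (intro integral_mono_AE' AE_I2)
      show "integrable (iid_measure N)
        (\<lambda>\<omega>. 2 * c\<^sup>2 * ((f (mix {} \<omega>) - f (mix S \<omega>))\<^sup>2 + (g (mix {} \<omega>) - g (mix S \<omega>))\<^sup>2))"
        by (intro integrable_mult_right Bochner_Integration.integrable_add i1 i2)
      fix \<omega> :: "'i + 'i \<Rightarrow> 'b"
      let ?a = "f (mix {} \<omega>) - f (mix S \<omega>)" and ?b = "g (mix {} \<omega>) - g (mix S \<omega>)"
      have "(h (mix {} \<omega>) - h (mix S \<omega>))\<^sup>2 \<le> (c * \<bar>?a\<bar> + c * \<bar>?b\<bar>)\<^sup>2"
        using le[of "mix {} \<omega>" "mix S \<omega>"] by (subst abs_le_square_iff[symmetric]) simp
      also have "\<dots> \<le> 2 * ((c * \<bar>?a\<bar>)\<^sup>2 + (c * \<bar>?b\<bar>)\<^sup>2)" by (rule power2_add_le)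
      also have "\<dots> = 2 * c\<^sup>2 * (?a\<^sup>2 + ?b\<^sup>2)" by (simp add: power_mult_distrib algebra_simps)
      finally show "(h (mix {} \<omega>) - h (mix S \<omega>))\<^sup>2 \<le> 2 * c\<^sup>2 * (?a\<^sup>2 + ?b\<^sup>2)" .
    qed simp
    also have "\<dots> = 2 * c\<^sup>2 * ((LINT \<omega>|iid_measure N. (f (mix {} \<omega>) - f (mix S \<omega>))\<^sup>2)
        + (LINT \<omega>|iid_measure N. (g (mix {} \<omega>) - g (mix S \<omega>))\<^sup>2))"
      using i1 i2 by simp
    also have "\<dots> \<le> 2 * c\<^sup>2 * (e' + e')"
      using B(2)[of S] C(2)[of S] S by (intro mult_left_mono add_mono) (auto simp: Int_Un_distrib)
    also have "\<dots> < 4 * (c\<^sup>2 + 1) * e'" using \<open>e' > 0\<close> by (simp add: algebra_simps)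
    also have "\<dots> = e" using c by (simp add: e'_def)
    finally show ?thesis .
  qed
  with B(1) C(1) show "\<exists>B. finite B \<and> (\<forall>S. S \<inter> B = {} \<longrightarrow>
      (LINT \<omega>|iid_measure N. (h (mix {} \<omega>) - h (mix S \<omega>))\<^sup>2) < e)"
    by (intro exI[of _ "B \<union> C"]) auto
qed

lemma finitely_approximable_const: "finitely_approximable (\<lambda>_. c)"
  by (auto simp: finitely_approximable_def)

lemma square_integrable_indicator:
  "A \<in> sets (iid_measure N) \<Longrightarrow> square_integrable (iid_measure N) (indicator A :: ('i \<Rightarrow> 'b) \<Rightarrow> real)"
  by (rule prob_space.square_integrable_bounded[OF prob_space_iid_measure[OF N], of _ 1])
    (simp_all add: indicator_def)

text \<open>Induction over the sigma-algebra generated by one-coordinate cylinders, for which B =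
  {i} gives error 0. Complements and finite unions follow by domination, countable unions as L2
  limits of finite ones.\<close>

lemma finitely_approximable_indicator:
  fixes A :: "('i \<Rightarrow> 'b) set"
  assumes "A \<in> sets (iid_measure N)"
  shows "finitely_approximable (indicator A)"
proof -
  interpret P: prob_space "iid_measure N :: ('i \<Rightarrow> 'b) measure" by (rule prob_space_iid_measure[OF N])
  note sq = square_integrable_indicator
  let ?G = "{{x \<in> UNIV \<rightarrow>\<^sub>E space N. x i \<in> C} | i C. C \<in> sets N}"
  have sets: "sets (iid_measure N :: ('i \<Rightarrow> 'b) measure) = sigma_sets (UNIV \<rightarrow>\<^sub>E space N) ?G"
    by (simp add: iid_measure_def sets_PiM_single)
  have "A \<in> sigma_sets (UNIV \<rightarrow>\<^sub>E space N) ?G" using assms sets by simp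
  then show ?thesis
  proof induction
    case (Basic A)
    then obtain i C where A: "A = {x \<in> UNIV \<rightarrow>\<^sub>E space N. x i \<in> C}" "C \<in> sets N" by auto
    have "(LINT \<omega>|iid_measure N. (indicator A (mix {} \<omega>) - indicator A (mix S \<omega>))\<^sup>2) = (0::real)"
      if "S \<inter> {i} = {}" for S
    proof -
      have "mix {} \<omega> \<in> A \<longleftrightarrow> mix S \<omega> \<in> A" if "\<omega> \<in> space (iid_measure N)" for \<omega> :: "'i + 'i \<Rightarrow> 'b"
        using that \<open>S \<inter> {i} = {}\<close> by (auto simp: A mix_def iid_measure_def space_PiM PiE_iff)
      then show ?thesis
        by (subst Bochner_Integration.integral_cong[OF refl, of _ _ "\<lambda>_. 0"]) (auto simp: indicator_def)
    qed
    then show ?case unfolding finitely_approximable_def by (intro allI impI exI[of _ "{i}"]) simp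
  next
    case Empty
    then show ?case by (simp add: indicator_def[abs_def] finitely_approximable_const)
  next
    case (Compl A)
    then have A: "A \<in> sets (iid_measure N)" using sets by simp
    have sp: "space (iid_measure N) = (UNIV \<rightarrow>\<^sub>E space N)" by (simp add: iid_measure_def space_PiM)
    have "finitely_approximable (\<lambda>x. 1 - indicator A x)"
      using A by (intro finitely_approximable_dominated[OF sq[OF A] Compl.IH sq[OF A] Compl.IH, where c = 1])
        (simp_all add: abs_minus_commute)
    \<comment> \<open>The indicator of the complement equals \<open>1 - indicator A\<close> only on
      the space; \<open>mix\<close> takes its values there, which suffices under the
      integral.\<close>
    moreover have "(LINT \<omega>|iid_measure N. (indicator ((UNIV \<rightarrow>\<^sub>E space N) - A) (mix {} \<omega>) - indicator ((UNIV \<rightarrow>\<^sub>E space N) - A) (mix S \<omega>))\<^sup>2)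
      = (LINT \<omega>|iid_measure N. ((1 - indicator A (mix {} \<omega>)) - (1 - indicator A (mix S \<omega>) :: real))\<^sup>2)" for S
    proof (intro Bochner_Integration.integral_cong refl)
      fix \<omega> :: "'i + 'i \<Rightarrow> 'b" assume "\<omega> \<in> space (iid_measure N)"
      then have "mix S \<omega> \<in> (UNIV \<rightarrow>\<^sub>E space N)" for S
        using measurable_space[OF mix_measurable[of S N], of \<omega>] by (simp add: sp)
      then show "(indicator ((UNIV \<rightarrow>\<^sub>E space N) - A) (mix {} \<omega>) - indicator ((UNIV \<rightarrow>\<^sub>E space N) - A) (mix S \<omega>))\<^sup>2
        = ((1 - indicator A (mix {} \<omega>)) - (1 - indicator A (mix S \<omega>) :: real))\<^sup>2"
        by (auto simp: indicator_def)
    qed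
    ultimately show ?case unfolding finitely_approximable_def by simp
  next
    case (Union A)
    then have A: "\<And>n. A n \<in> sets (iid_measure N)" using sets by simp
    have fin: "finitely_approximable (indicator (\<Union>k<n. A k))" for n :: nat
    proof (induction n)
      case 0
      then show ?case by (simp add: indicator_def[abs_def] finitely_approximable_const)
    next
      case (Suc n)
      have "(\<Union>k<n. A k) \<in> sets (iid_measure N)" using A by auto
      then show ?case
      proof (rule finitely_approximable_dominated[OF sq Suc sq[OF A[of n]] Union.IH[of n], where c = 1])
        show "indicator (\<Union>k<Suc n. A k) \<in> borel_measurable (iid_measure N)"
          using A by (intro borel_measurable_indicator) auto
        show "\<bar>indicator (\<Union>k<Suc n. A k) x - indicator (\<Union>k<Suc n. A k) y\<bar> \<le>
          1 * \<bar>indicator (\<Union>k<n. A k) x - indicator (\<Union>k<n. A k) y\<bar>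
          + 1 * \<bar>indicator (A n) x - indicator (A n) y :: real\<bar>" for x y
          by (simp add: indicator_def lessThan_Suc)
      qed
    qed
    show ?case
    proof (rule finitely_approximable_limit)
      show "square_integrable (iid_measure N) (indicator (\<Union>i. A i) :: _ \<Rightarrow> real)"
        using A by (intro sq) auto
      fix e :: real assume "e > 0"
      have "(\<lambda>n. P.prob (\<Union>k<n. A k)) \<longlonglongrightarrow> P.prob (\<Union>n. \<Union>k<n. A k)"
      proof (intro P.finite_Lim_measure_incseq)
        show "incseq (\<lambda>n. \<Union>k<n. A k)" by (intro incseq_SucI) (simp add: lessThan_Suc)
      qed (use A in auto)
      moreover have "(\<Union>n. \<Union>k<n. A k) = (\<Union>n. A n)" by blast
      ultimately have "(\<lambda>n. P.prob (\<Union>k<n. A k)) \<longlonglongrightarrow> P.prob (\<Union>n. A n)" by simp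
      from order_tendstoD(1)[OF this, of "P.prob (\<Union>n. A n) - e"] \<open>e > 0\<close>
      obtain n where n: "P.prob (\<Union>n. A n) - P.prob (\<Union>k<n. A k) < e"
        by (auto simp: eventually_sequentially algebra_simps)
      have "(LINT x|iid_measure N. (indicator (\<Union>n. A n) x - indicator (\<Union>k<n. A k) x)\<^sup>2 :: real)
        = (LINT x|iid_measure N. indicator ((\<Union>n. A n) - (\<Union>k<n. A k)) x)"
        by (intro Bochner_Integration.integral_cong) (auto simp: indicator_def)
      also have "\<dots> = P.prob (\<Union>n. A n) - P.prob (\<Union>k<n. A k)"
        using A by (subst P.finite_measure_Diff[symmetric]) auto
      finally show "\<exists>g. square_integrable (iid_measure N) g \<and> finitely_approximable g \<and>
        (LINT x|iid_measure N. (indicator (\<Union>i. A i) x - g x)\<^sup>2) < e"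
        using n A fin[of n] by (intro exI[of _ "indicator (\<Union>k<n. A k)"]) (auto intro!: sq)
    qed
  qed
qed

text \<open>Integrability sits inside the conclusion so that the induction can push it down to the
  pieces: nonnegative summands are dominated by their sum, and an increasing sequence by its limit,
  which also gives L2 convergence.\<close>

lemma square_integrable_finitely_approximable_nonneg:
  fixes f :: "('i \<Rightarrow> 'b) \<Rightarrow> real"
  assumes "f \<in> borel_measurable (iid_measure N)" "\<And>x. 0 \<le> f x"
  shows "square_integrable (iid_measure N) f \<longrightarrow> finitely_approximable f"
  using assms
proof (induction rule: borel_measurable_induct_real)
  case (set A)
  then show ?case by (simp add: finitely_approximable_indicator)
next
  case (mult u c)
  show ?case
  proof (cases "c = 0")
    \<comment> \<open>For c = 0 integrability of c * u says nothing about u, but the function is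
      constant.\<close>
    case True
    then show ?thesis by (simp add: finitely_approximable_const)
  next
    case False
    show ?thesis
    proof
      assume "square_integrable (iid_measure N) (\<lambda>x. c * u x)"
      from square_integrable_cmult[OF this, of "1/c"] False
      have u: "square_integrable (iid_measure N) u" by simp
      with mult have fa: "finitely_approximable u" by simp
      show "finitely_approximable (\<lambda>x. c * u x)"
      proof (rule finitely_approximable_dominated[OF u fa u fa])
        show "\<bar>c * u x - c * u y\<bar> \<le> c * \<bar>u x - u y\<bar> + c * \<bar>u x - u y\<bar>" for x y
          using mult(1) by (simp add: abs_mult flip: right_diff_distrib)
      qed (use mult in measurable)
    qed
  qed
next
  case (add u v)
  show ?case
  proof
    assume uv: "square_integrable (iid_measure N) (\<lambda>x. v x + u x)"
    have u: "square_integrable (iid_measure N) u"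
      by (rule square_integrable_mono[OF uv]) (simp_all add: add.hyps)
    have v: "square_integrable (iid_measure N) v"
      by (rule square_integrable_mono[OF uv]) (simp_all add: add.hyps)
    show "finitely_approximable (\<lambda>x. v x + u x)"
    proof (rule finitely_approximable_dominated[OF u _ v, where c = 1])
      show "finitely_approximable u" "finitely_approximable v"
        using add.IH u v by simp_all
      show "(\<lambda>x. v x + u x) \<in> borel_measurable (iid_measure N)"
        by (rule square_integrable_measurable[OF uv])
      show "\<bar>v x + u x - (v y + u y)\<bar> \<le> 1 * \<bar>u x - u y\<bar> + 1 * \<bar>v x - v y\<bar>" for x y
        using abs_triangle_ineq[of "u x - u y" "v x - v y"] by (simp add: algebra_simps)
    qed
  qed
next
  case (seq U)
  show ?case
  proof
    assume f: "square_integrable (iid_measure N) f"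
    have sp: "x \<in> space (iid_measure N) \<Longrightarrow> U i x \<le> f x" for i x
      using seq.hyps by (intro incseq_le) (auto simp: incseq_def le_fun_def)
    note [measurable] = seq.hyps(1) square_integrable_measurable[OF f]
    have U: "square_integrable (iid_measure N) (U i)" for i
      unfolding square_integrable_def
    proof (intro conjI Bochner_Integration.integrable_bound[OF square_integrable_power2[OF f]])
      show "AE x in iid_measure N. norm ((U i x)\<^sup>2) \<le> norm ((f x)\<^sup>2)"
        using sp seq.hyps(2) by (intro AE_I2) (auto intro!: power_mono)
    qed measurable
    have "(\<lambda>i. LINT x|iid_measure N. (f x - U i x)\<^sup>2) \<longlonglongrightarrow> (LINT x|(iid_measure N :: ('i \<Rightarrow> 'b) measure). 0)"
    proof (rule integral_dominated_convergence)
      show "integrable (iid_measure N) (\<lambda>x. (f x)\<^sup>2)" by (rule square_integrable_power2[OF f])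
      show "AE x in iid_measure N. (\<lambda>i. (f x - U i x)\<^sup>2) \<longlonglongrightarrow> 0"
      proof (intro AE_I2)
        fix x :: "'i \<Rightarrow> 'b" assume "x \<in> space (iid_measure N)"
        from tendsto_power[OF tendsto_diff[OF tendsto_const seq.hyps(4)[OF this]], of "f x" 2]
        show "(\<lambda>i. (f x - U i x)\<^sup>2) \<longlonglongrightarrow> 0" by simp
      qed
      show "AE x in iid_measure N. norm ((f x - U i x)\<^sup>2) \<le> (f x)\<^sup>2" for i
        using sp seq.hyps(2) by (intro AE_I2) (auto intro!: power_mono)
    qed measurable
    then have lim: "(\<lambda>i. LINT x|iid_measure N. (f x - U i x)\<^sup>2) \<longlonglongrightarrow> 0" by simp
    show "finitely_approximable f"
    proof (rule finitely_approximable_limit[OF f])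
      fix e :: real assume "e > 0"
      from order_tendstoD(2)[OF lim this]
      obtain i where "(LINT x|iid_measure N. (f x - U i x)\<^sup>2) < e"
        by (auto simp: eventually_sequentially)
      then show "\<exists>g. square_integrable (iid_measure N) g \<and> finitely_approximable g \<and>
        (LINT x|iid_measure N. (f x - g x)\<^sup>2) < e" using U seq.IH by blast
    qed
  qed
qed

lemma square_integrable_finitely_approximable:
  fixes f :: "('i \<Rightarrow> 'b) \<Rightarrow> real"
  assumes f: "square_integrable (iid_measure N) f"
  shows "finitely_approximable f"
proof -
  note [measurable] = square_integrable_measurable[OF f]
  have pos: "square_integrable (iid_measure N) (\<lambda>x. max 0 (f x))"
    by (rule square_integrable_mono[OF f]) auto
  have neg: "square_integrable (iid_measure N) (\<lambda>x. max 0 (- f x))"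
    by (rule square_integrable_mono[OF f]) auto
  show ?thesis
    by (rule finitely_approximable_dominated[OF pos _ neg, where c = 1])
      (use pos neg square_integrable_finitely_approximable_nonneg[of "\<lambda>x. max 0 (f x)"]
         square_integrable_finitely_approximable_nonneg[of "\<lambda>x. max 0 (- f x)"] in \<open>auto simp: max_def\<close>)
qed

end

subsection \<open>The covariance inequality\<close>

context iid_factor
begin

lemma integral_case_sum:
  fixes f :: "('i + 'j \<Rightarrow> 'b) \<Rightarrow> real"
  assumes f: "f \<in> borel_measurable (iid_measure N)"
  shows "(LINT z|(iid_measure N \<Otimes>\<^sub>M iid_measure N). f (case_sum (fst z) (snd z))) = (LINT x|iid_measure N. f x)"
proof -
  have "(LINT x|distr (iid_measure N \<Otimes>\<^sub>M iid_measure N) (iid_measure N) (\<lambda>(x, y). case_sum x y). f x)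
      = (LINT z|(iid_measure N \<Otimes>\<^sub>M iid_measure N). f (case z of (x, y) \<Rightarrow> case_sum x y))"
    by (rule integral_distr[OF case_sum_measurable f])
  then show ?thesis by (simp only: distr_case_sum_iid_measure[OF N] case_prod_beta)
qed

lemma integrable_case_sum:
  fixes f :: "('i + 'j \<Rightarrow> 'b) \<Rightarrow> real"
  assumes f: "integrable (iid_measure N) f"
  shows "integrable (iid_measure N \<Otimes>\<^sub>M iid_measure N) (\<lambda>z. f (case_sum (fst z) (snd z)))"
proof -
  have "integrable (distr (iid_measure N \<Otimes>\<^sub>M iid_measure N) (iid_measure N) (\<lambda>(x, y). case_sum x y)) f"
    by (simp only: distr_case_sum_iid_measure[OF N] f)
  then have "integrable (iid_measure N \<Otimes>\<^sub>M iid_measure N) (\<lambda>z. f (case z of (x, y) \<Rightarrow> case_sum x y))"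
    by (rule integrable_distr[OF case_sum_measurable])
  then show ?thesis by (simp only: case_prod_beta)
qed

lemma case_sum_pair_measurable[measurable]:
  "(\<lambda>z. case_sum (fst z) (snd z)) \<in> measurable (iid_measure N \<Otimes>\<^sub>M iid_measure N) (iid_measure N)"
  using case_sum_measurable[of N] by (simp only: case_prod_beta')

text \<open>\<open>mix {}\<close> and \<open>mix UNIV\<close> read disjoint copies, so Fubini
  factorises the expectation.\<close>

lemma integral_mix_indep:
  fixes F H :: "('i \<Rightarrow> 'b) \<Rightarrow> real"
  assumes F: "square_integrable (iid_measure N) F" and H: "square_integrable (iid_measure N) H"
  shows "(LINT \<omega>|iid_measure N. F (mix {} \<omega>) * H (mix UNIV \<omega>)) =
    (LINT x|iid_measure N. F x) * (LINT x|iid_measure N. H x)"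
proof -
  let ?P = "iid_measure N :: ('i \<Rightarrow> 'b) measure"
  interpret P: prob_space ?P by (rule prob_space_iid_measure[OF N])
  interpret PP: pair_prob_space ?P ?P ..
  note [measurable] = square_integrable_measurable[OF F] square_integrable_measurable[OF H]
  have G: "(\<lambda>\<omega>. F (mix {} \<omega>) * H (mix UNIV \<omega>)) \<in> borel_measurable (iid_measure N)"
    by measurable
  have int: "integrable (iid_measure N) (\<lambda>\<omega>. F (mix {} \<omega>) * H (mix UNIV \<omega>))"
    by (rule square_integrable_mult[OF square_integrable_mix[OF F] square_integrable_mix[OF H]])
  have intP: "integrable (?P \<Otimes>\<^sub>M ?P) (\<lambda>(x, y). F x * H y)"
    using integrable_case_sum[OF int]
    by (simp add: case_prod_beta' mix_empty_case_sum mix_UNIV_case_sum)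
  have "(LINT \<omega>|iid_measure N. F (mix {} \<omega>) * H (mix UNIV \<omega>)) = (LINT (x, y)|(?P \<Otimes>\<^sub>M ?P). F x * H y)"
    using integral_case_sum[OF G]
    by (simp add: case_prod_beta' mix_empty_case_sum mix_UNIV_case_sum)
  also have "\<dots> = (LINT x|?P. LINT y|?P. F x * H y)"
    using PP.integral_fst[OF intP] by simp
  finally show ?thesis by simp
qed

text \<open>Toggling J turns {} and {j} into J and \<open>insert j J\<close>, so the cost of
  resampling j does not depend on what was resampled before. Hence the telescoping needs no ordering
  of the coordinates.\<close>

lemma influence_eq_l2norm_mix:
  fixes H :: "('i \<Rightarrow> 'b) \<Rightarrow> real"
  assumes [measurable]: "H \<in> borel_measurable (iid_measure N)" and j: "j \<notin> J"
  shows "l2norm (iid_measure N) (\<lambda>\<omega>. H (mix J \<omega>) - H (mix (insert j J) \<omega>)) = influence N H j"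
proof -
  have "insert j J = sym_diff {j} J" using j by auto
  then show ?thesis
    using l2norm_mix_diff_flip[OF assms(1), of "{}" J "{j}"] by (simp add: influence_def)
qed

text \<open>Exchanging the two copies of coordinate \<open>j\<close> swaps \<open>mix {}\<close> with \<open>mix {j}\<close>
  and reverses the sign of the second factor.\<close>

lemma integral_mix_step_le:
  fixes F H :: "('i \<Rightarrow> 'b) \<Rightarrow> real"
  assumes F: "square_integrable (iid_measure N) F" and H: "square_integrable (iid_measure N) H"
    and j: "j \<notin> J"
  shows "\<bar>LINT \<omega>|iid_measure N. F (mix {} \<omega>) * (H (mix J \<omega>) - H (mix (insert j J) \<omega>))\<bar>
    \<le> influence N F j * influence N H j"
proof -
  note [measurable] = square_integrable_measurable[OF F] square_integrable_measurable[OF H]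
  let ?D = "\<lambda>\<omega>. H (mix J \<omega>) - H (mix (insert j J) \<omega>)"
  let ?G = "\<lambda>\<omega>. F (mix {} \<omega>) * ?D \<omega>"
  have sets: "sym_diff J {j} = insert j J" "sym_diff (insert j J) {j} = J" "sym_diff {} {j} = {j}"
    using j by auto
  have D: "square_integrable (iid_measure N) ?D" by (rule square_integrable_mix_diff[OF H])
  have "?G \<in> borel_measurable (iid_measure N)" by measurable
  from integral_flip[OF this, of "{j}"]
  have flip: "(LINT \<omega>|iid_measure N. F (mix {j} \<omega>) * (H (mix (insert j J) \<omega>) - H (mix J \<omega>)))
    = (LINT \<omega>|iid_measure N. ?G \<omega>)" by (simp only: mix_flip sets)
  have int: "integrable (iid_measure N) (\<lambda>\<omega>. F (mix A \<omega>) * ?D \<omega>)" for A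
    by (rule square_integrable_mult[OF square_integrable_mix[OF F] D])
  have "(LINT \<omega>|iid_measure N. (F (mix {} \<omega>) - F (mix {j} \<omega>)) * ?D \<omega>)
    = (LINT \<omega>|iid_measure N. ?G \<omega>) - (LINT \<omega>|iid_measure N. F (mix {j} \<omega>) * ?D \<omega>)"
    unfolding left_diff_distrib by (rule Bochner_Integration.integral_diff[OF int int])
  also have "(LINT \<omega>|iid_measure N. F (mix {j} \<omega>) * ?D \<omega>)
    = - (LINT \<omega>|iid_measure N. F (mix {j} \<omega>) * (H (mix (insert j J) \<omega>) - H (mix J \<omega>)))"
    by (subst Bochner_Integration.integral_minus[symmetric])
      (auto intro!: Bochner_Integration.integral_cong simp: algebra_simps)
  \<comment> \<open>Antisymmetry under the exchange even yields a factor 1/2, which is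
    dropped.\<close>
  finally have "2 * (LINT \<omega>|iid_measure N. ?G \<omega>)
    = (LINT \<omega>|iid_measure N. (F (mix {} \<omega>) - F (mix {j} \<omega>)) * ?D \<omega>)"
    using flip by simp
  moreover have "\<bar>LINT \<omega>|iid_measure N. (F (mix {} \<omega>) - F (mix {j} \<omega>)) * ?D \<omega>\<bar>
    \<le> influence N F j * influence N H j"
    using Cauchy_Schwarz_l2norm[OF square_integrable_mix_diff[OF F, of "{}" "{j}"] D]
    by (simp add: influence_eq_l2norm_mix[OF _ j] influence_def[of N F])
  ultimately show ?thesis by simp
qed

lemma integral_mix_diff_le:
  fixes F H :: "('i \<Rightarrow> 'b) \<Rightarrow> real"
  assumes F: "square_integrable (iid_measure N) F" and H: "square_integrable (iid_measure N) H"
    and "finite J"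
  shows "\<bar>LINT \<omega>|iid_measure N. F (mix {} \<omega>) * (H (mix {} \<omega>) - H (mix J \<omega>))\<bar>
    \<le> (\<Sum>j\<in>J. influence N F j * influence N H j)"
  using \<open>finite J\<close>
proof (induction J)
  case (insert j J)
  have int: "integrable (iid_measure N) (\<lambda>\<omega>. F (mix {} \<omega>) * (H (mix A \<omega>) - H (mix B \<omega>)))" for A B
    by (rule square_integrable_mult[OF square_integrable_mix[OF F] square_integrable_mix_diff[OF H]])
  have "(LINT \<omega>|iid_measure N. F (mix {} \<omega>) * (H (mix {} \<omega>) - H (mix (insert j J) \<omega>)))
    = (LINT \<omega>|iid_measure N. F (mix {} \<omega>) * (H (mix {} \<omega>) - H (mix J \<omega>)))
      + (LINT \<omega>|iid_measure N. F (mix {} \<omega>) * (H (mix J \<omega>) - H (mix (insert j J) \<omega>)))"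
    by (subst Bochner_Integration.integral_add[OF int int, symmetric])
      (simp add: algebra_simps)
  with insert.IH integral_mix_step_le[OF F H insert.hyps(2)] insert.hyps show ?case
    by simp
qed simp

text \<open>Resampling a finite set J is controlled by influences, and passing from J to all
  coordinates costs an L2 tail absorbed in e. The form with a finite J and an e makes sense without
  any summability.\<close>

lemma covariance_le_sum_influence:
  fixes F H :: "('i \<Rightarrow> 'b) \<Rightarrow> real"
  assumes F: "square_integrable (iid_measure N) F" and H: "square_integrable (iid_measure N) H"
    and "e > 0"
  shows "\<exists>J. finite J \<and> \<bar>(LINT x|iid_measure N. F x * H x) -
      (LINT x|iid_measure N. F x) * (LINT x|iid_measure N. H x)\<bar>
    \<le> (\<Sum>j\<in>J. influence N F j * influence N H j) + e"
proof -
  note [measurable] = square_integrable_measurable[OF F] square_integrable_measurable[OF H]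
  \<comment> \<open>The added 1 covers F of norm 0: the tail is at most norm * e / (norm + 1), hence
    at most e.\<close>
  define e' where "e' = (e / (l2norm (iid_measure N) F + 1))\<^sup>2"
  have pos: "0 < l2norm (iid_measure N) F + 1" by (simp add: add_nonneg_pos)
  then have "e' > 0" using \<open>e > 0\<close> by (simp add: e'_def)
  with square_integrable_finitely_approximable[OF H] obtain J where "finite J" and
    J: "\<And>S. S \<inter> J = {} \<Longrightarrow> (LINT \<omega>|iid_measure N. (H (mix {} \<omega>) - H (mix S \<omega>))\<^sup>2) < e'"
    unfolding finitely_approximable_def by blast
  have "(l2norm (iid_measure N) (\<lambda>\<omega>. H (mix {} \<omega>) - H (mix (- J) \<omega>)))\<^sup>2 < e'"
    using J[of "- J"] by (simp add: l2norm_power2)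
  then have "l2norm (iid_measure N) (\<lambda>\<omega>. H (mix {} \<omega>) - H (mix (- J) \<omega>)) < e / (l2norm (iid_measure N) F + 1)"
    unfolding e'_def by (rule power2_less_imp_less) (use \<open>e > 0\<close> pos in simp)
  \<comment> \<open>Exchanging the copies on J carries the pair {}, -J to the pair J, UNIV.\<close>
  moreover have "l2norm (iid_measure N) (\<lambda>\<omega>. H (mix J \<omega>) - H (mix UNIV \<omega>))
    = l2norm (iid_measure N) (\<lambda>\<omega>. H (mix {} \<omega>) - H (mix (- J) \<omega>))"
    using l2norm_mix_diff_flip[of H "{}" J "- J"] by (simp add: Compl_Un)
  ultimately have small: "l2norm (iid_measure N) (\<lambda>\<omega>. H (mix J \<omega>) - H (mix UNIV \<omega>))
      < e / (l2norm (iid_measure N) F + 1)" by simp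
  have int: "integrable (iid_measure N) (\<lambda>\<omega>. F (mix {} \<omega>) * (H (mix A \<omega>) - H (mix B \<omega>)))" for A B
    by (rule square_integrable_mult[OF square_integrable_mix[OF F] square_integrable_mix_diff[OF H]])
  have int': "integrable (iid_measure N) (\<lambda>\<omega>. F (mix {} \<omega>) * H (mix A \<omega>))" for A
    by (rule square_integrable_mult[OF square_integrable_mix[OF F] square_integrable_mix[OF H]])
  have "\<bar>LINT \<omega>|iid_measure N. F (mix {} \<omega>) * (H (mix J \<omega>) - H (mix UNIV \<omega>))\<bar>
    \<le> l2norm (iid_measure N) F * l2norm (iid_measure N) (\<lambda>\<omega>. H (mix J \<omega>) - H (mix UNIV \<omega>))"
    using Cauchy_Schwarz_l2norm[OF square_integrable_mix[OF F, of "{}"] square_integrable_mix_diff[OF H, of J UNIV]]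
    by (simp add: l2norm_mix)
  also have "\<dots> \<le> l2norm (iid_measure N) F * (e / (l2norm (iid_measure N) F + 1))"
    using small by (intro mult_left_mono) auto
  also have "\<dots> \<le> e"
    using pos \<open>e > 0\<close> by (simp add: field_simps)
  finally have tail: "\<bar>LINT \<omega>|iid_measure N. F (mix {} \<omega>) * (H (mix J \<omega>) - H (mix UNIV \<omega>))\<bar> \<le> e" .
  have "(LINT x|iid_measure N. F x * H x) = (LINT \<omega>|iid_measure N. F (mix {} \<omega>) * H (mix {} \<omega>))"
    using integral_mix[of "\<lambda>x. F x * H x" "{}"] by simp
  then have "(LINT x|iid_measure N. F x * H x) - (LINT x|iid_measure N. F x) * (LINT x|iid_measure N. H x)
    = (LINT \<omega>|iid_measure N. F (mix {} \<omega>) * H (mix {} \<omega>))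
      - (LINT \<omega>|iid_measure N. F (mix {} \<omega>) * H (mix UNIV \<omega>))"
    by (simp add: integral_mix_indep[OF F H])
  also have "\<dots> = (LINT \<omega>|iid_measure N. F (mix {} \<omega>) * (H (mix {} \<omega>) - H (mix J \<omega>)))
      + (LINT \<omega>|iid_measure N. F (mix {} \<omega>) * (H (mix J \<omega>) - H (mix UNIV \<omega>)))"
    by (subst Bochner_Integration.integral_add[OF int int, symmetric],
        subst Bochner_Integration.integral_diff[OF int' int', symmetric])
      (simp add: algebra_simps)
  finally show ?thesis
    using integral_mix_diff_le[OF F H \<open>finite J\<close>] tail \<open>finite J\<close> by (intro exI[of _ J]) linarith
qed

lemma influence_eq_0:
  fixes F :: "('i \<Rightarrow> 'b) \<Rightarrow> real"
  assumes "\<And>x y. (\<And>i. i \<noteq> j \<Longrightarrow> x i = y i) \<Longrightarrow> F x = F y"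
  shows "influence N F j = 0"
proof -
  have "F (mix {} \<omega>) = F (mix {j} \<omega>)" for \<omega> :: "'i + 'i \<Rightarrow> 'b"
    by (rule assms) (simp add: mix_def)
  then show ?thesis by (simp add: influence_def l2norm_def)
qed

text \<open>Every coordinate has influence 0 on F or on H, so the covariance inequality leaves only
  an arbitrary e. Independence over disjoint coordinates is thus a by-product of that
  inequality.\<close>

lemma integral_mult_disjoint_support:
  fixes F H :: "('i \<Rightarrow> 'b) \<Rightarrow> real"
  assumes F: "square_integrable (iid_measure N) F" and H: "square_integrable (iid_measure N) H"
    and dF: "\<And>x y. (\<And>i. i \<in> A \<Longrightarrow> x i = y i) \<Longrightarrow> F x = F y"
    and dH: "\<And>x y. (\<And>i. i \<in> B \<Longrightarrow> x i = y i) \<Longrightarrow> H x = H y"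
    and "A \<inter> B = {}"
  shows "(LINT x|iid_measure N. F x * H x) = (LINT x|iid_measure N. F x) * (LINT x|iid_measure N. H x)"
proof -
  have "influence N F j * influence N H j = 0" for j
  proof (cases "j \<in> A")
    case True
    with \<open>A \<inter> B = {}\<close> have "i \<in> B \<Longrightarrow> i \<noteq> j" for i by auto
    then have "influence N H j = 0" by (intro influence_eq_0 dH) auto
    then show ?thesis by simp
  next
    case False
    then have "i \<in> A \<Longrightarrow> i \<noteq> j" for i by auto
    then have "influence N F j = 0" by (intro influence_eq_0 dF) auto
    then show ?thesis by simp
  qed
  with covariance_le_sum_influence[OF F H]
  have "\<bar>(LINT x|iid_measure N. F x * H x) - (LINT x|iid_measure N. F x) * (LINT x|iid_measure N. H x)\<bar> \<le> 0 + e"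
    if "e > 0" for e using that by auto
  from field_le_epsilon[OF this] show ?thesis by simp
qed

lemma influence_le_l2norm:
  fixes F :: "('i \<Rightarrow> 'b) \<Rightarrow> real"
  assumes F: "square_integrable (iid_measure N) F"
  shows "influence N F j \<le> 2 * l2norm (iid_measure N) F"
proof -
  note [measurable] = square_integrable_measurable[OF F]
  note i = square_integrable_power2[OF square_integrable_mix[OF F]]
  have "(influence N F j)\<^sup>2 \<le> (LINT \<omega>|iid_measure N. 2 * ((F (mix {} \<omega>))\<^sup>2 + (F (mix {j} \<omega>))\<^sup>2))"
    unfolding influence_def l2norm_power2
    by (intro integral_mono square_integrable_power2[OF square_integrable_mix_diff[OF F]] power2_diff_le
        integrable_mult_right Bochner_Integration.integrable_add i)
  also have "\<dots> = (2 * l2norm (iid_measure N) F)\<^sup>2"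
    using i integral_mix[of "\<lambda>x. (F x)\<^sup>2"] by (simp add: power_mult_distrib l2norm_power2)
  finally show ?thesis by (rule power2_le_imp_le) simp
qed

text \<open>Gives the approximation error h - h' the summable majorant 2 * influence h; the
  hypothesis \<open>le\<close> is met there because clamping and averaging do not increase
  influences.\<close>

lemma influence_diff_le:
  fixes F H :: "('i \<Rightarrow> 'b) \<Rightarrow> real"
  assumes F: "square_integrable (iid_measure N) F" and H: "square_integrable (iid_measure N) H"
    and le: "influence N H j \<le> influence N F j"
  shows "influence N (\<lambda>x. F x - H x) j \<le> 2 * influence N F j"
proof -
  note i1 = square_integrable_power2[OF square_integrable_mix_diff[OF F]]
    and i2 = square_integrable_power2[OF square_integrable_mix_diff[OF H]]
  have "(influence N (\<lambda>x. F x - H x) j)\<^sup>2 \<le> (LINT \<omega>|iid_measure N.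
      2 * ((F (mix {} \<omega>) - F (mix {j} \<omega>))\<^sup>2 + (H (mix {} \<omega>) - H (mix {j} \<omega>))\<^sup>2))"
    unfolding influence_def l2norm_power2
  proof (intro integral_mono integrable_mult_right Bochner_Integration.integrable_add i1 i2)
    show "integrable (iid_measure N) (\<lambda>\<omega>. (F (mix {} \<omega>) - H (mix {} \<omega>) - (F (mix {j} \<omega>) - H (mix {j} \<omega>)))\<^sup>2)"
      by (rule square_integrable_power2[OF square_integrable_mix_diff[OF square_integrable_diff[OF F H]]])
    show "(F (mix {} \<omega>) - H (mix {} \<omega>) - (F (mix {j} \<omega>) - H (mix {j} \<omega>)))\<^sup>2 \<le>
      2 * ((F (mix {} \<omega>) - F (mix {j} \<omega>))\<^sup>2 + (H (mix {} \<omega>) - H (mix {j} \<omega>))\<^sup>2)" for \<omega>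
      using power2_diff_le[of "F (mix {} \<omega>) - F (mix {j} \<omega>)" "H (mix {} \<omega>) - H (mix {j} \<omega>)"]
      by (simp add: algebra_simps)
  qed
  also have "\<dots> = 2 * ((influence N F j)\<^sup>2 + (influence N H j)\<^sup>2)"
    unfolding influence_def l2norm_power2 using i1 i2 by simp
  also have "\<dots> \<le> (2 * influence N F j)\<^sup>2"
    using power_mono[OF le, of 2] by (simp add: power_mult_distrib)
  finally show ?thesis by (rule power2_le_imp_le) simp
qed

end

subsection \<open>Sums over shifts\<close>

text \<open>\<open>V (shift i x)\<close> is the value at site i of the stationary field generated by
  V.\<close>

definition shift :: "'i :: ab_group_add \<Rightarrow> ('i \<Rightarrow> 'b) \<Rightarrow> 'i \<Rightarrow> 'b" where
  "shift i x = (\<lambda>s. x (s + i))"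

lemma shift_eq_reindex: "shift i = (\<lambda>x s. x (s + i))"
  by (simp add: shift_def fun_eq_iff)

lemma shift_measurable[measurable]: "shift i \<in> measurable (iid_measure N) (iid_measure N)"
  unfolding shift_eq_reindex by (rule reindex_measurable)

context iid_factor
begin

lemma integral_shift:
  fixes f :: "('i :: ab_group_add \<Rightarrow> 'b) \<Rightarrow> real"
  assumes "f \<in> borel_measurable (iid_measure N)"
  shows "(LINT x|iid_measure N. f (shift i x)) = (LINT x|iid_measure N. f x)"
  unfolding shift_eq_reindex
  by (rule integral_iid_measure_reindex[OF N _ assms]) (simp add: inj_def)

lemma square_integrable_shift:
  fixes f :: "('i :: ab_group_add \<Rightarrow> 'b) \<Rightarrow> real"
  assumes "square_integrable (iid_measure N) f"
  shows "square_integrable (iid_measure N) (\<lambda>x. f (shift i x))"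
  unfolding shift_eq_reindex
  by (rule square_integrable_reindex[OF N _ assms]) (simp add: inj_def)

text \<open>The family and its copy are translated simultaneously, an injective reindexing;
  coordinate j of x sits at position j - i of \<open>shift i x\<close>.\<close>

lemma influence_shift:
  fixes V :: "('i :: ab_group_add \<Rightarrow> 'b) \<Rightarrow> real"
  assumes [measurable]: "V \<in> borel_measurable (iid_measure N)"
  shows "influence N (\<lambda>x. V (shift i x)) j = influence N V (j - i)"
proof -
  define t :: "'i + 'i \<Rightarrow> 'i + 'i" where "t = map_sum (\<lambda>s. s + i) (\<lambda>s. s + i)"
  have "inj t" unfolding t_def by (rule sum.inj_map) (auto simp: inj_def)
  have "shift i (mix {} \<omega>) = mix {} (\<lambda>k. \<omega> (t k))" "shift i (mix {j} \<omega>) = mix {j - i} (\<lambda>k. \<omega> (t k))"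
    for \<omega> :: "'i + 'i \<Rightarrow> 'b"
    by (auto simp: shift_def mix_def t_def fun_eq_iff)
  moreover have "(\<lambda>\<omega>. (V (mix {} \<omega>) - V (mix {j - i} \<omega>))\<^sup>2) \<in> borel_measurable (iid_measure N)"
    by measurable
  from integral_iid_measure_reindex[OF N \<open>inj t\<close> this]
  have "(LINT \<omega>|iid_measure N. (V (mix {} (\<lambda>k. \<omega> (t k))) - V (mix {j - i} (\<lambda>k. \<omega> (t k))))\<^sup>2)
    = (LINT \<omega>|iid_measure N. (V (mix {} \<omega>) - V (mix {j - i} \<omega>))\<^sup>2)" .
  ultimately show ?thesis by (simp add: influence_def l2norm_def)
qed

lemma covariance_shift_le:
  fixes V :: "('i :: ab_group_add \<Rightarrow> 'b) \<Rightarrow> real"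
  assumes V: "square_integrable (iid_measure N) V" and "e > 0"
  shows "\<exists>J. finite J \<and> \<bar>(LINT x|iid_measure N. V (shift i x) * V (shift l x)) - (LINT x|iid_measure N. V x)\<^sup>2\<bar>
    \<le> (\<Sum>j\<in>J. influence N V (j - i) * influence N V (j - l)) + e"
  using covariance_le_sum_influence[OF square_integrable_shift[OF V, of i] square_integrable_shift[OF V, of l] \<open>e > 0\<close>]
    square_integrable_measurable[OF V]
  by (simp add: influence_shift integral_shift power2_eq_square)

text \<open>Covariances are bounded by sums of \<open>a (j - i) * a (j - l)\<close> over j. Summing
  over l, then j, then i gives D, D and card \<Gamma>; only injectivity of the index changes enters,
  never the geometry of \<Gamma>.\<close>

lemma variance_sum_shift_le:
  fixes V :: "('i :: ab_group_add \<Rightarrow> 'b) \<Rightarrow> real"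
  assumes V: "square_integrable (iid_measure N) V" and "finite \<Gamma>"
    and D: "\<And>J. finite J \<Longrightarrow> (\<Sum>j\<in>J. influence N V j) \<le> D"
  shows "(LINT x|iid_measure N. (\<Sum>i\<in>\<Gamma>. V (shift i x) - (LINT x|iid_measure N. V x))\<^sup>2) \<le> real (card \<Gamma>) * D\<^sup>2"
proof -
  interpret P: prob_space "iid_measure N :: ('i \<Rightarrow> 'b) measure" by (rule prob_space_iid_measure[OF N])
  note [measurable] = square_integrable_measurable[OF V]
  define m where "m = (LINT x|iid_measure N. V x)"
  define W where "W i x = V (shift i x) - m" for i x
  let ?a = "influence N V"
  have W: "square_integrable (iid_measure N) (W i)" for i
    unfolding W_def by (rule square_integrable_diff[OF square_integrable_shift[OF V] P.square_integrable_const])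
  have cov: "(LINT x|iid_measure N. W i x * W l x) = (LINT x|iid_measure N. V (shift i x) * V (shift l x)) - m\<^sup>2" for i l
  proof -
    note s = square_integrable_shift[OF V]
    note int = square_integrable_mult[OF s s] P.square_integrable_integrable[OF s]
    have "(LINT x|iid_measure N. W i x * W l x) =
      (LINT x|iid_measure N. V (shift i x) * V (shift l x) - m * V (shift l x) - m * V (shift i x) + m\<^sup>2)"
      by (intro Bochner_Integration.integral_cong) (auto simp: W_def algebra_simps power2_eq_square)
    also have "\<dots> = (LINT x|iid_measure N. V (shift i x) * V (shift l x)) - m * m - m * m + m\<^sup>2"
      using int by (simp add: integral_shift P.prob_space flip: m_def)
    finally show ?thesis by (simp add: power2_eq_square)
  qed
  have "0 \<le> D" using D[of "{}"] by simp
  have shiftsum: "(\<Sum>j\<in>J. ?a (j - l)) \<le> D" if "finite J" for J l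
    using D[of "(\<lambda>j. j - l) ` J"] that by (simp add: sum.reindex inj_on_def)
  have shiftsum': "(\<Sum>l\<in>\<Gamma>. ?a (j - l)) \<le> D" for j
    using D[of "(\<lambda>l. j - l) ` \<Gamma>"] \<open>finite \<Gamma>\<close> by (simp add: sum.reindex inj_on_def)
  have eps: "(LINT x|iid_measure N. (\<Sum>i\<in>\<Gamma>. W i x)\<^sup>2) \<le> real (card \<Gamma>) * D\<^sup>2 + (real (card \<Gamma>))\<^sup>2 * e" if "e > 0" for e
  proof -
    \<comment> \<open>Each pair (i, l) has its own finite set. Enlarging all of them to their union
      K is harmless because the summands are nonnegative; the errors total the square of card
      \<Gamma> times e.\<close>
    define J where "J i l = (SOME J. finite J \<and>
      \<bar>LINT x|iid_measure N. W i x * W l x\<bar> \<le> (\<Sum>j\<in>J. ?a (j - i) * ?a (j - l)) + e)" for i l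
    have "finite (J i l) \<and> \<bar>LINT x|iid_measure N. W i x * W l x\<bar> \<le> (\<Sum>j\<in>J i l. ?a (j - i) * ?a (j - l)) + e" for i l
      unfolding J_def
      by (rule someI_ex) (use covariance_shift_le[OF V that, of i l] in \<open>simp only: cov m_def\<close>)
    then have J: "finite (J i l)"
      "\<bar>LINT x|iid_measure N. W i x * W l x\<bar> \<le> (\<Sum>j\<in>J i l. ?a (j - i) * ?a (j - l)) + e" for i l by auto
    define K where "K = (\<Union>i\<in>\<Gamma>. \<Union>l\<in>\<Gamma>. J i l)"
    have "finite K" using J(1) \<open>finite \<Gamma>\<close> by (simp add: K_def)
    have "(LINT x|iid_measure N. (\<Sum>i\<in>\<Gamma>. W i x)\<^sup>2) = (LINT x|iid_measure N. (\<Sum>i\<in>\<Gamma>. \<Sum>l\<in>\<Gamma>. W i x * W l x))"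
      by (simp add: power2_eq_square sum_product)
    also have "\<dots> = (\<Sum>i\<in>\<Gamma>. \<Sum>l\<in>\<Gamma>. (LINT x|iid_measure N. W i x * W l x))"
      using square_integrable_mult[OF W W] by (simp add: Bochner_Integration.integral_sum)
    also have "\<dots> \<le> (\<Sum>i\<in>\<Gamma>. \<Sum>l\<in>\<Gamma>. (\<Sum>j\<in>K. ?a (j - i) * ?a (j - l)) + e)"
    proof (intro sum_mono)
      fix i l assume "i \<in> \<Gamma>" "l \<in> \<Gamma>"
      have "(LINT x|iid_measure N. W i x * W l x) \<le> (\<Sum>j\<in>J i l. ?a (j - i) * ?a (j - l)) + e"
        using J(2)[of i l] by simp
      also have "\<dots> \<le> (\<Sum>j\<in>K. ?a (j - i) * ?a (j - l)) + e"
        using \<open>i \<in> \<Gamma>\<close> \<open>l \<in> \<Gamma>\<close> \<open>finite K\<close> by (intro add_right_mono sum_mono2) (auto simp: K_def)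
      finally show "(LINT x|iid_measure N. W i x * W l x) \<le> (\<Sum>j\<in>K. ?a (j - i) * ?a (j - l)) + e" .
    qed
    also have "\<dots> = (\<Sum>i\<in>\<Gamma>. \<Sum>l\<in>\<Gamma>. \<Sum>j\<in>K. ?a (j - i) * ?a (j - l)) + (real (card \<Gamma>))\<^sup>2 * e"
      by (simp add: sum.distrib power2_eq_square)
    also have "(\<Sum>i\<in>\<Gamma>. \<Sum>l\<in>\<Gamma>. \<Sum>j\<in>K. ?a (j - i) * ?a (j - l)) = (\<Sum>i\<in>\<Gamma>. \<Sum>j\<in>K. ?a (j - i) * (\<Sum>l\<in>\<Gamma>. ?a (j - l)))"
      by (subst sum.swap[of _ K]) (simp add: sum_distrib_left)
    also have "\<dots> \<le> (\<Sum>i\<in>\<Gamma>. \<Sum>j\<in>K. ?a (j - i) * D)"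
      using shiftsum' by (intro sum_mono mult_left_mono) auto
    also have "\<dots> = (\<Sum>i\<in>\<Gamma>. (\<Sum>j\<in>K. ?a (j - i)) * D)" by (simp add: sum_distrib_right)
    also have "\<dots> \<le> (\<Sum>i\<in>\<Gamma>. D * D)"
      using shiftsum[OF \<open>finite K\<close>] \<open>0 \<le> D\<close> by (intro sum_mono mult_right_mono) auto
    finally show ?thesis by (simp add: power2_eq_square)
  qed
  have "(LINT x|iid_measure N. (\<Sum>i\<in>\<Gamma>. W i x)\<^sup>2) \<le> real (card \<Gamma>) * D\<^sup>2"
  proof (rule field_le_epsilon)
    fix e :: real assume "e > 0"
    have p: "0 < (real (card \<Gamma>))\<^sup>2 + 1" by (simp add: add_nonneg_pos)
    have "(real (card \<Gamma>))\<^sup>2 * (e / ((real (card \<Gamma>))\<^sup>2 + 1)) \<le> e"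
      using p \<open>e > 0\<close> by (simp add: field_simps)
    with eps[of "e / ((real (card \<Gamma>))\<^sup>2 + 1)"] p \<open>e > 0\<close>
    show "(LINT x|iid_measure N. (\<Sum>i\<in>\<Gamma>. W i x)\<^sup>2) \<le> real (card \<Gamma>) * D\<^sup>2 + e" by simp
  qed
  then show ?thesis by (simp add: W_def m_def)
qed

end

subsection \<open>Approximation by bounded functions of finitely many coordinates\<close>

definition clamp_at :: "real \<Rightarrow> real \<Rightarrow> real" where
  "clamp_at c t = max (- c) (min c t)"

lemma clamp_at_measurable[measurable]: "clamp_at c \<in> borel_measurable borel"
  unfolding clamp_at_def by measurable

lemma abs_clamp_at_le: "0 \<le> c \<Longrightarrow> \<bar>clamp_at c t\<bar> \<le> c"
  by (auto simp: clamp_at_def)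

lemma abs_clamp_at_le_abs: "0 \<le> c \<Longrightarrow> \<bar>clamp_at c t\<bar> \<le> \<bar>t\<bar>"
  by (auto simp: clamp_at_def)

lemma abs_diff_clamp_at_le_abs: "0 \<le> c \<Longrightarrow> \<bar>t - clamp_at c t\<bar> \<le> \<bar>t\<bar>"
  by (auto simp: clamp_at_def max_def min_def abs_if)

lemma abs_clamp_at_diff_le: "\<bar>clamp_at c s - clamp_at c t\<bar> \<le> \<bar>s - t\<bar>"
  by (auto simp: clamp_at_def max_def min_def abs_if)

lemma clamp_at_tendsto: "(\<lambda>n. clamp_at (real n) t) \<longlonglongrightarrow> t"
proof (rule tendsto_eventually)
  show "\<forall>\<^sub>F n in sequentially. clamp_at (real n) t = t"
    using eventually_ge_at_top[of "nat \<lceil>\<bar>t\<bar>\<rceil>"]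
    by eventually_elim (auto simp: clamp_at_def nat_le_iff ceiling_le_iff abs_le_iff)
qed

lemma square_integral_clamp_at_small:
  assumes f: "square_integrable M f" and "e > 0"
  shows "\<exists>c\<ge>0. (LINT x|M. (f x - clamp_at c (f x))\<^sup>2) < e"
proof -
  note [measurable] = square_integrable_measurable[OF f]
  have "(\<lambda>n. LINT x|M. (f x - clamp_at (real n) (f x))\<^sup>2) \<longlonglongrightarrow> (LINT x|M. 0)"
  proof (rule integral_dominated_convergence)
    show "integrable M (\<lambda>x. (f x)\<^sup>2)" by (rule square_integrable_power2[OF f])
    show "AE x in M. (\<lambda>n. (f x - clamp_at (real n) (f x))\<^sup>2) \<longlonglongrightarrow> 0"
    proof (intro AE_I2)
      fix x
      from tendsto_power[OF tendsto_diff[OF tendsto_const clamp_at_tendsto], of "f x" "f x" 2]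
      show "(\<lambda>n. (f x - clamp_at (real n) (f x))\<^sup>2) \<longlonglongrightarrow> 0" by simp
    qed
    show "AE x in M. norm ((f x - clamp_at (real n) (f x))\<^sup>2) \<le> (f x)\<^sup>2" for n
      using abs_diff_clamp_at_le_abs[of "real n"] by (intro AE_I2) (simp add: abs_le_square_iff)
  qed measurable
  then have "(\<lambda>n. LINT x|M. (f x - clamp_at (real n) (f x))\<^sup>2) \<longlonglongrightarrow> 0" by simp
  from order_tendstoD(2)[OF this \<open>e > 0\<close>] obtain n where "(LINT x|M. (f x - clamp_at (real n) (f x))\<^sup>2) < e"
    by (auto simp: eventually_sequentially)
  then show ?thesis by (intro exI[of _ "real n"]) simp
qed

text \<open>Conditional Jensen inequality. It serves for the approximation error and, with u = 0,
  for increments under resampling. The bound on w makes every section over the space integrable, not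
  just almost every one.\<close>

lemma integral_power2_diff_average_le:
  fixes u :: "'a \<Rightarrow> real" and w :: "'a \<times> 'c \<Rightarrow> real"
  assumes "prob_space A" "prob_space B"
    and u[measurable]: "u \<in> borel_measurable A"
    and w[measurable]: "w \<in> borel_measurable (A \<Otimes>\<^sub>M B)"
    and bound: "\<And>z. \<bar>w z\<bar> \<le> c"
    and int: "integrable (A \<Otimes>\<^sub>M B) (\<lambda>z. (u (fst z) - w z)\<^sup>2)"
  shows "(LINT x|A. (u x - (LINT y|B. w (x, y)))\<^sup>2) \<le> (LINT z|(A \<Otimes>\<^sub>M B). (u (fst z) - w z)\<^sup>2)"
proof -
  interpret A: prob_space A by fact
  interpret B: prob_space B by fact
  interpret AB: pair_prob_space A B ..
  have int': "integrable (A \<Otimes>\<^sub>M B) (\<lambda>(x, y). (u x - w (x, y))\<^sup>2)"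
    using int by (simp add: case_prod_beta')
  have jensen: "(u x - (LINT y|B. w (x, y)))\<^sup>2 \<le> (LINT y|B. (u x - w (x, y))\<^sup>2)" if "x \<in> space A" for x
  proof -
    have m: "(\<lambda>y. w (x, y)) \<in> borel_measurable B" using that by measurable
    then have "square_integrable B (\<lambda>y. w (x, y))"
      by (rule B.square_integrable_bounded) (rule bound)
    then have sq: "square_integrable B (\<lambda>y. u x - w (x, y))"
      by (rule square_integrable_diff[OF B.square_integrable_const])
    have "integrable B (\<lambda>y. w (x, y))"
      by (rule B.square_integrable_integrable) fact
    then have "(LINT y|B. u x - w (x, y)) = u x - (LINT y|B. w (x, y))"
      by (simp add: B.prob_space)
    with B.power2_expectation_le[OF sq] show ?thesis by simp
  qed
  have "(LINT x|A. (u x - (LINT y|B. w (x, y)))\<^sup>2) \<le> (LINT x|A. LINT y|B. (u x - w (x, y))\<^sup>2)"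
  proof (rule integral_mono_AE')
    show "integrable A (\<lambda>x. LINT y|B. (u x - w (x, y))\<^sup>2)"
      using AB.integrable_fst[OF int'] by simp
    show "AE x in A. (u x - (LINT y|B. w (x, y)))\<^sup>2 \<le> (LINT y|B. (u x - w (x, y))\<^sup>2)"
      using jensen by (intro AE_I2)
  qed simp
  also have "\<dots> = (LINT z|(A \<Otimes>\<^sub>M B). (u (fst z) - w z)\<^sup>2)"
    using AB.integral_fst[OF int'] by (simp add: case_prod_beta')
  finally show ?thesis .
qed

context iid_factor
begin

text \<open>The conditional expectation of the truncation of \<open>h\<close> given the coordinates in \<open>B\<close>.\<close>

definition truncated_average :: "real \<Rightarrow> 'i set \<Rightarrow> (('i \<Rightarrow> 'b) \<Rightarrow> real) \<Rightarrow> ('i \<Rightarrow> 'b) \<Rightarrow> real" where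
  "truncated_average c B h x = (LINT y|iid_measure N. clamp_at c (h (mix (- B) (case_sum x y))))"

lemma truncated_average_measurable:
  fixes h :: "('i \<Rightarrow> 'b) \<Rightarrow> real"
  assumes [measurable]: "h \<in> borel_measurable (iid_measure N)"
  shows "truncated_average c B h \<in> borel_measurable (iid_measure N)"
proof -
  interpret P: prob_space "iid_measure N :: ('i \<Rightarrow> 'b) measure" by (rule prob_space_iid_measure[OF N])
  have "(\<lambda>z. clamp_at c (h (mix (- B) (case_sum (fst z) (snd z))))) \<in>
      borel_measurable (iid_measure N \<Otimes>\<^sub>M iid_measure N)" by measurable
  then have "(\<lambda>x. LINT y|iid_measure N. clamp_at c (h (mix (- B) (case_sum x y)))) \<in> borel_measurable (iid_measure N)"
    by (intro P.borel_measurable_lebesgue_integral) (simp add: case_prod_beta')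
  then show ?thesis by (simp add: truncated_average_def[abs_def])
qed

lemma abs_truncated_average_le:
  fixes h :: "('i \<Rightarrow> 'b) \<Rightarrow> real"
  assumes "0 \<le> c"
  shows "\<bar>truncated_average c B h x\<bar> \<le> c"
proof -
  interpret P: prob_space "iid_measure N :: ('i \<Rightarrow> 'b) measure" by (rule prob_space_iid_measure[OF N])
  show ?thesis
  proof (cases "integrable (iid_measure N) (\<lambda>y. clamp_at c (h (mix (- B) (case_sum x y))))")
    case True
    have "\<bar>truncated_average c B h x\<bar> \<le> (LINT y|iid_measure N. \<bar>clamp_at c (h (mix (- B) (case_sum x y)))\<bar>)"
      unfolding truncated_average_def by (rule integral_abs_bound)
    also have "\<dots> \<le> (LINT y|(iid_measure N :: ('i \<Rightarrow> 'b) measure). c)"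
      using True by (intro integral_mono) (simp_all add: abs_clamp_at_le[OF assms])
    also have "\<dots> = c" by (simp add: P.prob_space)
    finally show ?thesis .
  \<comment> \<open>A non-integrable section has integral 0 by convention, so the bound holds at
    every x, also outside the space.\<close>
  qed (use assms in \<open>simp add: truncated_average_def not_integrable_integral_eq\<close>)
qed

lemma truncated_average_cong:
  assumes "\<And>i. i \<in> B \<Longrightarrow> x i = x' i"
  shows "truncated_average c B h x = truncated_average c B h x'"
proof -
  have "mix (- B) (case_sum x y) = mix (- B) (case_sum x' y)" for y
    using assms by (auto simp: mix_def fun_eq_iff)
  then show ?thesis by (simp add: truncated_average_def)
qed

text \<open>For j off B the average ignores coordinate j. For j in B the increment is an average of
  clamped increments; Jensen bounds it by a clamped increment of h with the coordinates off B drawn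
  afresh, which has the same law as without redrawing, and the clamp is 1-Lipschitz.\<close>

lemma influence_truncated_average_le:
  fixes h :: "('i \<Rightarrow> 'b) \<Rightarrow> real"
  assumes h: "square_integrable (iid_measure N) h" and "0 \<le> c"
  shows "influence N (truncated_average c B h) j \<le> influence N h j"
proof (cases "j \<in> B")
  case False
  have "influence N (truncated_average c B h) j = 0"
    using False by (intro influence_eq_0 truncated_average_cong) metis
  then show ?thesis by simp
next
  case True
  note [measurable] = square_integrable_measurable[OF h]
  let ?Q = "iid_measure N :: ('i + 'i \<Rightarrow> 'b) measure" and ?P = "iid_measure N :: ('i \<Rightarrow> 'b) measure"
  interpret P: prob_space ?P by (rule prob_space_iid_measure[OF N])
  interpret Q: prob_space ?Q by (rule prob_space_iid_measure[OF N])
  interpret QP: pair_prob_space ?Q ?P ..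
  let ?g = "\<lambda>S \<omega> y. clamp_at c (h (mix (- B) (case_sum (mix S \<omega>) y)))"
  let ?w = "\<lambda>z. ?g {} (fst z) (snd z) - ?g {j} (fst z) (snd z)"
  have gm: "(\<lambda>z. ?g S (fst z) (snd z)) \<in> borel_measurable (?Q \<Otimes>\<^sub>M ?P)" for S
  proof -
    have "(\<lambda>z. (mix S (fst z), snd z)) \<in> measurable (?Q \<Otimes>\<^sub>M ?P) (?P \<Otimes>\<^sub>M ?P)" by measurable
    from measurable_compose[OF this case_sum_pair_measurable]
    have [measurable]: "(\<lambda>z. case_sum (mix S (fst z)) (snd z)) \<in> measurable (?Q \<Otimes>\<^sub>M ?P) ?Q" by simp
    show ?thesis by measurable
  qed
  have wm: "?w \<in> borel_measurable (?Q \<Otimes>\<^sub>M ?P)" using gm[of "{}"] gm[of "{j}"] by measurable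
  have wb: "\<bar>?w z\<bar> \<le> 2 * c" for z
    using abs_clamp_at_le[OF \<open>0 \<le> c\<close>, of "h (mix (- B) (case_sum (mix {} (fst z)) (snd z)))"]
      abs_clamp_at_le[OF \<open>0 \<le> c\<close>, of "h (mix (- B) (case_sum (mix {j} (fst z)) (snd z)))"] by linarith
  have wi: "integrable (?Q \<Otimes>\<^sub>M ?P) (\<lambda>z. (0 - ?w z)\<^sup>2)"
    using square_integrable_power2[OF QP.square_integrable_bounded[OF wm wb]]
    by (simp only: diff_0 power2_minus)
  have gint: "integrable ?P (?g S \<omega>)" if "\<omega> \<in> space ?Q" for S \<omega>
    using measurable_Pair2[OF gm[of S] that] abs_clamp_at_le[OF \<open>0 \<le> c\<close>]
    by (intro P.integrable_const_bound[where B = c]) auto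
  have diff: "truncated_average c B h (mix {} \<omega>) - truncated_average c B h (mix {j} \<omega>) =
      (LINT y|?P. ?w (\<omega>, y))" if "\<omega> \<in> space ?Q" for \<omega>
    using gint[OF that] by (simp add: truncated_average_def)
  have "(influence N (truncated_average c B h) j)\<^sup>2 = (LINT \<omega>|?Q. (0 - (LINT y|?P. ?w (\<omega>, y)))\<^sup>2)"
    unfolding influence_def l2norm_power2 by (intro Bochner_Integration.integral_cong) (simp_all add: diff)
  also have "\<dots> \<le> (LINT z|(?Q \<Otimes>\<^sub>M ?P). (0 - ?w z)\<^sup>2)"
    by (rule integral_power2_diff_average_le[OF Q.prob_space_axioms P.prob_space_axioms _ wm wb wi]) simp
  also have "\<dots> = (LINT \<omega>|?Q. (clamp_at c (h (mix {} \<omega>)) - clamp_at c (h (mix {j} \<omega>)))\<^sup>2)"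
  proof -
    \<comment> \<open>Three independent families occur: the original, its copy and the averaged y.
      Off B, t reads y in place of the original; the copy is left alone, and
      \<open>S \<subseteq> B\<close> ensures that it is read only inside B.\<close>
    define t :: "'i + 'i \<Rightarrow> ('i + 'i) + 'i" where
      "t k = (case k of Inl i \<Rightarrow> if i \<in> B then Inl (Inl i) else Inr i | Inr i \<Rightarrow> Inl (Inr i))" for k
    have "inj t"
      by (rule injI) (auto simp: t_def split: sum.splits if_splits)
    have eq: "mix (- B) (case_sum (mix S \<omega>) y) = mix S (\<lambda>k. case_sum \<omega> y (t k))" if "S \<subseteq> B" for S \<omega> y
      using that by (auto simp: mix_def t_def fun_eq_iff)
    let ?v = "\<lambda>\<omega>. (clamp_at c (h (mix {} \<omega>)) - clamp_at c (h (mix {j} \<omega>)))\<^sup>2"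
    have v: "?v \<in> borel_measurable ?Q" by measurable
    have vt: "(\<lambda>W. ?v (\<lambda>k. W (t k))) \<in> borel_measurable (iid_measure N)"
      by (rule measurable_compose[OF reindex_measurable v])
    have "(LINT z|(?Q \<Otimes>\<^sub>M ?P). (0 - ?w z)\<^sup>2) = (LINT z|(?Q \<Otimes>\<^sub>M ?P). ?v (\<lambda>k. case_sum (fst z) (snd z) (t k)))"
      using True by (simp only: diff_0 power2_minus eq empty_subsetI insert_subset simp_thms)
    also have "\<dots> = (LINT W|iid_measure N. ?v (\<lambda>k. W (t k)))"
      by (rule integral_case_sum[OF vt])
    also have "\<dots> = (LINT \<omega>|?Q. ?v \<omega>)"
      by (rule integral_iid_measure_reindex[OF N \<open>inj t\<close> v])
    finally show ?thesis .
  qed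
  also have "\<dots> \<le> (influence N h j)\<^sup>2"
    unfolding influence_def l2norm_power2
  proof (rule integral_mono_AE')
    show "AE \<omega> in ?Q. (clamp_at c (h (mix {} \<omega>)) - clamp_at c (h (mix {j} \<omega>)))\<^sup>2 \<le> (h (mix {} \<omega>) - h (mix {j} \<omega>))\<^sup>2"
      by (intro AE_I2) (simp only: abs_le_square_iff[symmetric] abs_clamp_at_diff_le)
  qed (simp_all add: square_integrable_power2[OF square_integrable_mix_diff[OF h]])
  finally show ?thesis by (rule power2_le_imp_le) simp
qed

text \<open>By Jensen the average is no farther from h than the clamped function f with its
  coordinates off B resampled. Truncation makes f close to h, and f is nearly insensitive off B; the
  two errors e/4 enter with a factor 2.\<close>

lemma truncated_average_approximates:
  fixes h :: "('i \<Rightarrow> 'b) \<Rightarrow> real"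
  assumes h: "square_integrable (iid_measure N) h" and "e > 0"
  shows "\<exists>c B. 0 \<le> c \<and> finite B \<and> (LINT x|iid_measure N. (h x - truncated_average c B h x)\<^sup>2) < e"
proof -
  note [measurable] = square_integrable_measurable[OF h]
  let ?Q = "iid_measure N :: ('i + 'i \<Rightarrow> 'b) measure" and ?P = "iid_measure N :: ('i \<Rightarrow> 'b) measure"
  interpret P: prob_space ?P by (rule prob_space_iid_measure[OF N])
  obtain c where "0 \<le> c" and c: "(LINT x|?P. (h x - clamp_at c (h x))\<^sup>2) < e / 4"
    using square_integral_clamp_at_small[OF h, of "e / 4"] \<open>e > 0\<close> by auto
  define f where "f x = clamp_at c (h x)" for x
  have [measurable]: "f \<in> borel_measurable ?P" unfolding f_def[abs_def] by measurable
  have f: "square_integrable ?P f"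
    by (rule square_integrable_mono[OF h]) (simp_all add: f_def abs_clamp_at_le_abs[OF \<open>0 \<le> c\<close>])
  obtain B where "finite B" and
    B: "\<And>S. S \<inter> B = {} \<Longrightarrow> (LINT \<omega>|?Q. (f (mix {} \<omega>) - f (mix S \<omega>))\<^sup>2) < e / 4"
    using square_integrable_finitely_approximable[OF f] \<open>e > 0\<close>
    unfolding finitely_approximable_def by (meson divide_pos_pos zero_less_numeral)
  let ?d = "\<lambda>\<omega>. h (mix {} \<omega>) - f (mix (- B) \<omega>)"
  let ?w = "\<lambda>z. clamp_at c (h (mix (- B) (case_sum (fst z) (snd z))))"
  have d: "square_integrable ?Q ?d"
    by (rule square_integrable_diff[OF square_integrable_mix[OF h] square_integrable_mix[OF f]])
  have w: "?w \<in> borel_measurable (?P \<Otimes>\<^sub>M ?P)" by measurable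
  have int: "integrable (?P \<Otimes>\<^sub>M ?P) (\<lambda>z. (h (fst z) - ?w z)\<^sup>2)"
    using integrable_case_sum[OF square_integrable_power2[OF d]]
    by (simp add: mix_empty_case_sum f_def)
  have "(LINT x|?P. (h x - truncated_average c B h x)\<^sup>2) \<le> (LINT z|(?P \<Otimes>\<^sub>M ?P). (h (fst z) - ?w z)\<^sup>2)"
    using integral_power2_diff_average_le[OF P.prob_space_axioms P.prob_space_axioms _ w _ int, of c]
    by (simp add: abs_clamp_at_le[OF \<open>0 \<le> c\<close>] truncated_average_def)
  also have "\<dots> = (LINT \<omega>|?Q. (?d \<omega>)\<^sup>2)"
  proof -
    have "(\<lambda>\<omega>. (?d \<omega>)\<^sup>2) \<in> borel_measurable ?Q" by measurable
    from integral_case_sum[OF this] show ?thesis by (simp add: mix_empty_case_sum f_def)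
  qed
  also have "\<dots> \<le> (LINT \<omega>|?Q. 2 * ((h (mix {} \<omega>) - f (mix {} \<omega>))\<^sup>2 + (f (mix {} \<omega>) - f (mix (- B) \<omega>))\<^sup>2))"
  proof (intro integral_mono)
    show "integrable ?Q (\<lambda>\<omega>. (?d \<omega>)\<^sup>2)" by (rule square_integrable_power2[OF d])
    show "integrable ?Q (\<lambda>\<omega>. 2 * ((h (mix {} \<omega>) - f (mix {} \<omega>))\<^sup>2 + (f (mix {} \<omega>) - f (mix (- B) \<omega>))\<^sup>2))"
      by (intro integrable_mult_right Bochner_Integration.integrable_add
          square_integrable_power2[OF square_integrable_mix_diff[OF f]]
          square_integrable_power2[OF square_integrable_mix[OF square_integrable_diff[OF h f]]])
    show "(?d \<omega>)\<^sup>2 \<le> 2 * ((h (mix {} \<omega>) - f (mix {} \<omega>))\<^sup>2 + (f (mix {} \<omega>) - f (mix (- B) \<omega>))\<^sup>2)" for \<omega>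
      using power2_add_le[of "h (mix {} \<omega>) - f (mix {} \<omega>)" "f (mix {} \<omega>) - f (mix (- B) \<omega>)"] by simp
  qed
  also have "\<dots> = 2 * ((LINT \<omega>|?Q. (h (mix {} \<omega>) - f (mix {} \<omega>))\<^sup>2) + (LINT \<omega>|?Q. (f (mix {} \<omega>) - f (mix (- B) \<omega>))\<^sup>2))"
    using square_integrable_power2[OF square_integrable_mix_diff[OF f]]
      square_integrable_power2[OF square_integrable_mix[OF square_integrable_diff[OF h f]]] by simp
  also have "(LINT \<omega>|?Q. (h (mix {} \<omega>) - f (mix {} \<omega>))\<^sup>2) = (LINT x|?P. (h x - f x)\<^sup>2)"
    by (rule integral_mix) measurable
  finally have "(LINT x|?P. (h x - truncated_average c B h x)\<^sup>2) < e"
    using c B[of "- B"] by (simp add: f_def)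
  then show ?thesis using \<open>0 \<le> c\<close> \<open>finite B\<close> by blast
qed

text \<open>J0 nearly attains the supremum of the partial sums, so a disjoint finite set can add at
  most e.\<close>

lemma bounded_sums_small_tail:
  fixes a :: "'i \<Rightarrow> real"
  assumes D: "\<And>J. finite J \<Longrightarrow> (\<Sum>j\<in>J. a j) \<le> D" and "e > 0"
  shows "\<exists>J0. finite J0 \<and> (\<forall>J. finite J \<longrightarrow> J \<inter> J0 = {} \<longrightarrow> (\<Sum>j\<in>J. a j) \<le> e)"
proof -
  let ?S = "sum a ` {J. finite J}"
  have bdd: "bdd_above ?S" by (rule bdd_aboveI[of _ D]) (auto intro: D)
  have "Sup ?S - e < Sup ?S" using \<open>e > 0\<close> by simp
  moreover have "?S \<noteq> {}" by auto
  ultimately have "\<exists>y\<in>?S. Sup ?S - e < y"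
    using less_cSup_iff[OF _ bdd] by blast
  then obtain J0 where J0: "finite J0" "Sup ?S - e < sum a J0" by blast
  have "(\<Sum>j\<in>J. a j) \<le> e" if "finite J" "J \<inter> J0 = {}" for J
  proof -
    have "sum a (J \<union> J0) \<le> Sup ?S" using that J0 by (intro cSup_upper bdd) auto
    then show ?thesis using that J0 by (simp add: sum.union_disjoint)
  qed
  with J0(1) show ?thesis by blast
qed

text \<open>Dominated convergence for sums by hand: on the finite set J0 the influences of the error
  are small because its L2 norm is; off J0 they are at most twice those of h, whose tail is
  small.\<close>

lemma bounded_finite_range_approximation:
  fixes h :: "('i \<Rightarrow> 'b) \<Rightarrow> real"
  assumes h: "square_integrable (iid_measure N) h"
    and D: "\<And>J. finite J \<Longrightarrow> (\<Sum>j\<in>J. influence N h j) \<le> D" and "\<eta> > 0"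
  shows "\<exists>h' c B. 0 \<le> c \<and> finite B \<and> h' \<in> borel_measurable (iid_measure N) \<and> (\<forall>x. \<bar>h' x\<bar> \<le> c) \<and>
    (\<forall>x y. (\<forall>i\<in>B. x i = y i) \<longrightarrow> h' x = h' y) \<and>
    (\<forall>J. finite J \<longrightarrow> (\<Sum>j\<in>J. influence N (\<lambda>x. h x - h' x) j) \<le> \<eta>)"
proof -
  interpret P: prob_space "iid_measure N :: ('i \<Rightarrow> 'b) measure" by (rule prob_space_iid_measure[OF N])
  obtain J0 where "finite J0" and J0: "\<And>J. finite J \<Longrightarrow> J \<inter> J0 = {} \<Longrightarrow> (\<Sum>j\<in>J. influence N h j) \<le> \<eta> / 4"
    using bounded_sums_small_tail[OF D, of "\<eta> / 4"] \<open>\<eta> > 0\<close> by auto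
  \<comment> \<open>On J0 each influence is at most 2 * r, in total at most \<eta>/2; off J0 the sum
    is at most 2 * \<eta>/4.\<close>
  define r where "r = \<eta> / (4 * (real (card J0) + 1))"
  have "r > 0" using \<open>\<eta> > 0\<close> by (simp add: r_def add_nonneg_pos)
  obtain c B where "0 \<le> c" "finite B" and
    small: "(LINT x|iid_measure N. (h x - truncated_average c B h x)\<^sup>2) < r\<^sup>2"
    using truncated_average_approximates[OF h, of "r\<^sup>2"] \<open>r > 0\<close> by auto
  define h' where "h' = truncated_average c B h"
  have h'm: "h' \<in> borel_measurable (iid_measure N)"
    unfolding h'_def by (rule truncated_average_measurable[OF square_integrable_measurable[OF h]])
  have h'b: "\<bar>h' x\<bar> \<le> c" for x
    unfolding h'_def by (rule abs_truncated_average_le[OF \<open>0 \<le> c\<close>])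
  have h's: "square_integrable (iid_measure N) h'"
    by (rule P.square_integrable_bounded[OF h'm h'b])
  let ?V = "\<lambda>x. h x - h' x"
  have V: "square_integrable (iid_measure N) ?V" by (rule square_integrable_diff[OF h h's])
  have "(l2norm (iid_measure N) ?V)\<^sup>2 < r\<^sup>2" using small by (simp add: l2norm_power2 h'_def)
  then have "l2norm (iid_measure N) ?V < r" by (rule power2_less_imp_less) (use \<open>r > 0\<close> in simp)
  then have i1: "influence N ?V j \<le> 2 * r" for j
    using influence_le_l2norm[OF V, of j] by linarith
  have i2: "influence N ?V j \<le> 2 * influence N h j" for j
    by (rule influence_diff_le[OF h h's])
      (simp only: h'_def influence_truncated_average_le[OF h \<open>0 \<le> c\<close>])
  have "(\<Sum>j\<in>J. influence N ?V j) \<le> \<eta>" if "finite J" for J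
  proof -
    have "(\<Sum>j\<in>J. influence N ?V j) = (\<Sum>j\<in>J \<inter> J0. influence N ?V j) + (\<Sum>j\<in>J - J0. influence N ?V j)"
      using that by (rule sum.Int_Diff)
    also have "(\<Sum>j\<in>J \<inter> J0. influence N ?V j) \<le> real (card (J \<inter> J0)) * (2 * r)"
      using i1 by (intro sum_bounded_above)
    also have "\<dots> \<le> (real (card J0) + 1) * (2 * r)"
      using \<open>finite J0\<close> \<open>r > 0\<close> card_mono[of J0 "J \<inter> J0"] by (intro mult_right_mono) auto
    also have "\<dots> = \<eta> / 2" by (simp add: r_def field_simps)
    also have "(\<Sum>j\<in>J - J0. influence N ?V j) \<le> (\<Sum>j\<in>J - J0. 2 * influence N h j)"
      using i2 by (intro sum_mono)
    also have "\<dots> \<le> \<eta> / 2"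
      using J0[of "J - J0"] that by (simp add: sum_distrib_left[symmetric] Diff_Int_distrib2)
    finally show ?thesis by simp
  qed
  moreover have "\<forall>x y. (\<forall>i\<in>B. x i = y i) \<longrightarrow> h' x = h' y"
    unfolding h'_def by (auto intro: truncated_average_cong)
  ultimately show ?thesis using \<open>0 \<le> c\<close> \<open>finite B\<close> h'm h'b by blast
qed

end

subsection \<open>A differential inequality for characteristic functions\<close>

lemma norm_iexp_diff_1_le: "cmod (iexp x - 1) \<le> \<bar>x\<bar>"
  using iexp_approx1[of x 0] by simp

lemma norm_iexp_taylor_le: "cmod (iexp x - 1 - \<i> * x) \<le> x\<^sup>2 / 2"
  using iexp_approx1[of x 1] by (simp add: algebra_simps power2_eq_square)

lemma iexp_add: "iexp (x + y) = iexp x * iexp y"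
  by (simp add: exp_add algebra_simps)

context prob_space
begin

lemma integrable_bounded_complex:
  fixes f :: "'a \<Rightarrow> complex"
  assumes "f \<in> borel_measurable M" "\<And>x. cmod (f x) \<le> B"
  shows "integrable M f"
  using assms by (intro integrable_const_bound[where B = B]) auto

lemma norm_expectation_le_const:
  fixes f :: "'a \<Rightarrow> complex"
  assumes "integrable M f" "\<And>x. cmod (f x) \<le> B"
  shows "cmod (expectation f) \<le> B"
proof -
  have "cmod (expectation f) \<le> expectation (\<lambda>x. cmod (f x))" by (rule integral_norm_bound)
  also have "\<dots> \<le> expectation (\<lambda>_. B)"
    using assms by (intro integral_mono) auto
  finally show ?thesis by (simp add: prob_space)
qed

text \<open>S is bounded, so the second-order Taylor remainder is at most h^2 K^2 / 2 uniformly;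
  divided by |h| it still tends to 0.\<close>

lemma has_vector_derivative_expectation_iexp:
  assumes [measurable]: "S \<in> borel_measurable M" and K: "\<And>x. \<bar>S x\<bar> \<le> K"
  shows "((\<lambda>s. expectation (\<lambda>x. iexp (s * S x))) has_vector_derivative
    expectation (\<lambda>x. \<i> * S x * iexp (s * S x))) (at s)"
proof -
  let ?\<phi> = "\<lambda>s. expectation (\<lambda>x. iexp (s * S x))"
  let ?D = "expectation (\<lambda>x. \<i> * S x * iexp (s * S x))"
  have i1: "integrable M (\<lambda>x. iexp (s * S x))" for s
    by (rule integrable_bounded_complex[where B = 1]) simp_all
  have i2: "integrable M (\<lambda>x. \<i> * S x * iexp (s * S x))"
    by (rule integrable_bounded_complex[where B = K]) (simp_all add: norm_mult K)
  have bound: "cmod (?\<phi> (s + h) - ?\<phi> s - h *\<^sub>R ?D) \<le> h\<^sup>2 * K\<^sup>2 / 2" for h :: real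
  proof -
    have eq: "iexp ((s + h) * S x) - iexp (s * S x) - h *\<^sub>R (\<i> * S x * iexp (s * S x)) =
        iexp (s * S x) * (iexp (h * S x) - 1 - \<i> * (h * S x))" for x
    proof -
      have "iexp ((s + h) * S x) = iexp (s * S x) * iexp (h * S x)"
        by (simp only: distrib_right iexp_add)
      then show ?thesis by (simp add: scaleR_conv_of_real algebra_simps)
    qed
    have "?\<phi> (s + h) - ?\<phi> s - h *\<^sub>R ?D =
      expectation (\<lambda>x. iexp ((s + h) * S x) - iexp (s * S x) - h *\<^sub>R (\<i> * S x * iexp (s * S x)))"
      by (simp only: Bochner_Integration.integral_diff[OF Bochner_Integration.integrable_diff[OF i1 i1]
            integrable_scaleR_right[OF i2]] Bochner_Integration.integral_diff[OF i1 i1] integral_scaleR_right)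
    also have "\<dots> = expectation (\<lambda>x. iexp (s * S x) * (iexp (h * S x) - 1 - \<i> * (h * S x)))"
      by (simp only: eq)
    also have "cmod \<dots> \<le> h\<^sup>2 * K\<^sup>2 / 2"
    proof (rule norm_expectation_le_const)
      show "integrable M (\<lambda>x. iexp (s * S x) * (iexp (h * S x) - 1 - \<i> * (h * S x)))"
        unfolding eq[symmetric]
        by (intro Bochner_Integration.integrable_diff integrable_scaleR_right i1 i2)
      fix x
      have "cmod (iexp (s * S x) * (iexp (h * S x) - 1 - \<i> * (h * S x))) \<le> (h * S x)\<^sup>2 / 2"
        using norm_iexp_taylor_le[of "h * S x"] by (simp add: norm_mult)
      also have "\<dots> \<le> h\<^sup>2 * K\<^sup>2 / 2"
        using power_mono[OF K[of x], of 2] by (simp add: power_mult_distrib mult_left_mono)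
      finally show "cmod (iexp (s * S x) * (iexp (h * S x) - 1 - \<i> * (h * S x))) \<le> h\<^sup>2 * K\<^sup>2 / 2" .
    qed
    finally show ?thesis .
  qed
  have "((\<lambda>h. norm (?\<phi> (s + h) - ?\<phi> s - h *\<^sub>R ?D) / norm h) \<longlongrightarrow> 0) (at 0)"
  proof (rule tendsto_sandwich[where f = "\<lambda>_. 0" and h = "\<lambda>h. \<bar>h\<bar> * K\<^sup>2 / 2"])
    show "\<forall>\<^sub>F h in at 0. norm (?\<phi> (s + h) - ?\<phi> s - h *\<^sub>R ?D) / norm h \<le> \<bar>h\<bar> * K\<^sup>2 / 2"
    proof (intro always_eventually allI)
      fix h :: real
      show "norm (?\<phi> (s + h) - ?\<phi> s - h *\<^sub>R ?D) / norm h \<le> \<bar>h\<bar> * K\<^sup>2 / 2"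
      proof (cases "h = 0")
        case False
        have "h\<^sup>2 * K\<^sup>2 / 2 = (\<bar>h\<bar> * K\<^sup>2 / 2) * norm h" by (simp add: power2_eq_square)
        with bound[of h] False show ?thesis by (simp add: pos_divide_le_eq)
      qed simp
    qed
    have "((\<lambda>h. \<bar>h\<bar> * K\<^sup>2 / 2) \<longlongrightarrow> \<bar>0\<bar> * K\<^sup>2 / 2) (at (0::real))" by (intro tendsto_intros) simp
    then show "((\<lambda>h. \<bar>h\<bar> * K\<^sup>2 / 2) \<longlongrightarrow> 0) (at (0::real))" by simp
  qed (auto intro: tendsto_const)
  then show ?thesis
    unfolding has_vector_derivative_def has_derivative_at by (simp add: bounded_linear_scaleR_left)
qed

text \<open>The function \<open>\<phi>(s) exp(v s\<^sup>2/2)\<close> has derivative of size at most \<open>\<delta> exp(v s\<^sup>2/2)\<close>.\<close>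

lemma norm_expectation_iexp_diff_gaussian_le:
  fixes v t K \<delta> :: real
  assumes [measurable]: "S \<in> borel_measurable M" and K: "\<And>x. \<bar>S x\<bar> \<le> K" and "0 \<le> v"
    and \<delta>: "\<And>s. \<bar>s\<bar> \<le> \<bar>t\<bar> \<Longrightarrow> cmod (expectation (\<lambda>x. \<i> * S x * iexp (s * S x))
        + s * v * expectation (\<lambda>x. iexp (s * S x))) \<le> \<delta>"
  shows "cmod (expectation (\<lambda>x. iexp (t * S x)) - complex_of_real (exp (- (v * t\<^sup>2 / 2)))) \<le> \<bar>t\<bar> * \<delta>"
proof -
  define \<phi> where "\<phi> s = expectation (\<lambda>x. iexp (s * S x))" for s
  define \<phi>' where "\<phi>' s = expectation (\<lambda>x. \<i> * S x * iexp (s * S x))" for s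
  define E :: "real \<Rightarrow> real" where "E s = exp (v * s\<^sup>2 / 2)" for s :: real
  define A where "A s = E s *\<^sub>R \<phi> s" for s
  define A' where "A' s = E s *\<^sub>R (\<phi>' s + s * v * \<phi> s)" for s
  have "0 \<le> \<delta>" using \<delta>[of t] by (rule order.trans[OF norm_ge_zero]) simp
  have d\<phi>: "(\<phi> has_vector_derivative \<phi>' s) (at s)" for s
    unfolding \<phi>_def[abs_def] \<phi>'_def by (rule has_vector_derivative_expectation_iexp) (use K in auto)
  have dE: "(E has_real_derivative (v * s) * E s) (at s)" for s
    unfolding E_def[abs_def] by (auto intro!: derivative_eq_intros)
  have dA: "(A has_vector_derivative A' s) (at s)" for s
  proof -
    have "(A has_vector_derivative (E s *\<^sub>R \<phi>' s + ((v * s) * E s) *\<^sub>R \<phi> s)) (at s)"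
      unfolding A_def[abs_def] by (rule has_vector_derivative_scaleR[OF dE d\<phi>])
    moreover have "E s *\<^sub>R \<phi>' s + ((v * s) * E s) *\<^sub>R \<phi> s = A' s"
      by (simp add: A'_def scaleR_conv_of_real algebra_simps)
    ultimately show ?thesis by simp
  qed
  have "norm (A t - A 0) \<le> (\<delta> * E t) * norm (t - 0)"
  proof (rule differentiable_bound)
    show "convex {- \<bar>t\<bar>..\<bar>t\<bar>}" by simp
    show "(A has_derivative (\<lambda>h. h *\<^sub>R A' s)) (at s within {- \<bar>t\<bar>..\<bar>t\<bar>})" for s
      using dA[of s] unfolding has_vector_derivative_def by (rule has_derivative_at_withinI)
    fix s assume "s \<in> {- \<bar>t\<bar>..\<bar>t\<bar>}"
    then have s: "\<bar>s\<bar> \<le> \<bar>t\<bar>" by auto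
    \<comment> \<open>Here \<open>0 \<le> v\<close> enters: the largest weight on the interval is E
      t, and it cancels when \<phi> is recovered from A.\<close>
    have "E s \<le> E t"
      unfolding E_def using s \<open>0 \<le> v\<close> by (simp add: mult_left_mono abs_le_square_iff)
    have "norm (A' s) = E s * norm (\<phi>' s + s * v * \<phi> s)"
      by (simp add: A'_def E_def)
    also have "\<dots> \<le> E t * \<delta>"
      using \<delta>[OF s] \<open>E s \<le> E t\<close> by (intro mult_mono) (auto simp: \<phi>_def \<phi>'_def E_def)
    finally have "norm (A' s) \<le> \<delta> * E t" by (simp add: mult.commute)
    moreover have "onorm (\<lambda>h::real. h *\<^sub>R A' s) \<le> norm (A' s)"
      by (rule onorm_le) (simp add: mult.commute)
    ultimately show "onorm (\<lambda>h. h *\<^sub>R A' s) \<le> \<delta> * E t" by simp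
  qed auto
  moreover have "A 0 = 1" by (simp add: A_def E_def \<phi>_def prob_space)
  ultimately have "norm (A t - 1) \<le> \<bar>t\<bar> * \<delta> * E t" by (simp add: mult_ac)
  moreover have "A t - 1 = E t *\<^sub>R (\<phi> t - complex_of_real (exp (- (v * t\<^sup>2 / 2))))"
  proof -
    have "E t * exp (- (v * t\<^sup>2 / 2)) = 1" by (simp add: E_def exp_minus)
    then have "complex_of_real (E t) * complex_of_real (exp (- (v * t\<^sup>2 / 2))) = 1"
      by (simp only: of_real_mult[symmetric] of_real_1)
    then show ?thesis by (simp only: A_def scaleR_conv_of_real right_diff_distrib)
  qed
  moreover have "norm (E t *\<^sub>R (\<phi> t - complex_of_real (exp (- (v * t\<^sup>2 / 2))))) =
      E t * norm (\<phi> t - complex_of_real (exp (- (v * t\<^sup>2 / 2))))"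
    by (simp add: E_def)
  ultimately have "E t * norm (\<phi> t - complex_of_real (exp (- (v * t\<^sup>2 / 2)))) \<le> E t * (\<bar>t\<bar> * \<delta>)"
    by (simp only: mult_ac)
  moreover have "0 < E t" by (simp add: E_def)
  ultimately show ?thesis unfolding \<phi>_def by (rule mult_left_le_imp_le)
qed

text \<open>With \<open>s\<^sub>i\<close> the part of \<open>S\<close> correlated with \<open>z\<^sub>i\<close>, the term
  \<open>E[z\<^sub>i exp(\<i>u(S - s\<^sub>i))]\<close> vanishes, so a Taylor expansion of \<open>exp(-\<i>u s\<^sub>i)\<close> gives
  the approximate Gaussian differential equation.\<close>

lemma norm_stein_equation_le:
  fixes z s :: "'i \<Rightarrow> 'a \<Rightarrow> real" and u v w \<kappa> \<mu> :: real
  assumes "finite I"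
    and zm[measurable]: "\<And>i. i \<in> I \<Longrightarrow> z i \<in> borel_measurable M"
    and sm[measurable]: "\<And>i. i \<in> I \<Longrightarrow> s i \<in> borel_measurable M"
    and z: "\<And>i x. i \<in> I \<Longrightarrow> \<bar>z i x\<bar> \<le> \<kappa>"
    and s: "\<And>i x. i \<in> I \<Longrightarrow> \<bar>s i x\<bar> \<le> \<mu>"
    and S: "\<And>x. S x = (\<Sum>i\<in>I. z i x)"
    and zero: "\<And>i. i \<in> I \<Longrightarrow> expectation (\<lambda>x. z i x * iexp (u * (S x - s i x))) = 0"
    and var: "l2norm M (\<lambda>x. (\<Sum>i\<in>I. z i x * s i x) - v) \<le> w"
  shows "cmod (expectation (\<lambda>x. \<i> * S x * iexp (u * S x)) + u * v * expectation (\<lambda>x. iexp (u * S x)))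
    \<le> \<bar>u\<bar> * w + real (card I) * (\<kappa> * (u\<^sup>2 * \<mu>\<^sup>2 / 2))"
proof (cases "I = {}")
  \<comment> \<open>Without summands S and the sum of products vanish and the claim is |u * v| \<le>
    |u| * w; the bounds on z and s are vacuous and give no sign for \<kappa> and \<mu>.\<close>
  case True
  then have "l2norm M (\<lambda>_. - v) \<le> w" "S = (\<lambda>_. 0)" using var S by auto
  then show ?thesis using True by (simp add: l2norm_def prob_space abs_mult norm_mult mult_left_mono)
next
  case False
  then obtain i0 where "i0 \<in> I" by blast
  then have "0 \<le> \<kappa>" "0 \<le> \<mu>" using z[of i0] s[of i0] abs_ge_zero order.trans by blast+
  have [measurable]: "S \<in> borel_measurable M" unfolding S[abs_def] by measurable
  let ?U = "\<lambda>x. \<Sum>i\<in>I. z i x * s i x"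
  let ?e = "\<lambda>x. iexp (u * S x)"
  let ?r = "\<lambda>i x. 1 - \<i> * (u * s i x) - iexp (- (u * s i x))"
  \<comment> \<open>A collects the Taylor remainders, B the terms of expectation 0, and C the
    deviation of the random variance \<open>?U\<close> from v.\<close>
  let ?A = "\<lambda>x. \<Sum>i\<in>I. z i x * ?e x * ?r i x"
  let ?B = "\<lambda>x. \<Sum>i\<in>I. z i x * iexp (u * (S x - s i x))"
  let ?C = "\<lambda>x. complex_of_real (?U x - v) * ?e x"
  have Sb: "\<bar>S x\<bar> \<le> real (card I) * \<kappa>" for x
    unfolding S using z by (intro order.trans[OF sum_abs] sum_bounded_above) auto
  have Ub: "\<bar>?U x\<bar> \<le> real (card I) * (\<kappa> * \<mu>)" for x
    using z s \<open>0 \<le> \<kappa>\<close> by (intro order.trans[OF sum_abs] sum_bounded_above) (auto simp: abs_mult intro!: mult_mono)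
  have Ab: "cmod (?A x) \<le> real (card I) * (\<kappa> * (u\<^sup>2 * \<mu>\<^sup>2 / 2))" for x
  proof (intro order.trans[OF norm_sum] sum_bounded_above)
    fix i assume i: "i \<in> I"
    have "cmod (?r i x) = cmod (iexp (- (u * s i x)) - 1 - \<i> * (- (u * s i x)))"
      by (subst norm_minus_commute) (simp add: algebra_simps)
    also have "\<dots> \<le> (u * s i x)\<^sup>2 / 2"
      using norm_iexp_taylor_le[of "- (u * s i x)"] by simp
    also have "\<dots> \<le> u\<^sup>2 * \<mu>\<^sup>2 / 2"
      using power_mono[OF s[OF i, of x], of 2] by (simp add: power_mult_distrib mult_left_mono)
    finally have r: "cmod (?r i x) \<le> u\<^sup>2 * \<mu>\<^sup>2 / 2" .
    have "cmod (z i x * ?e x * ?r i x) = \<bar>z i x\<bar> * cmod (?r i x)"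
      by (simp only: norm_mult norm_exp_i_times norm_of_real mult_1_right)
    also have "\<dots> \<le> \<kappa> * (u\<^sup>2 * \<mu>\<^sup>2 / 2)"
      using z[OF i, of x] r \<open>0 \<le> \<kappa>\<close> by (intro mult_mono) auto
    finally show "cmod (z i x * ?e x * ?r i x) \<le> \<kappa> * (u\<^sup>2 * \<mu>\<^sup>2 / 2)" .
  qed
  have intA: "integrable M ?A" by (rule integrable_bounded_complex[OF _ Ab]) measurable
  have intB: "integrable M (\<lambda>x. z i x * iexp (u * (S x - s i x)))" if "i \<in> I" for i
    using that z by (intro integrable_bounded_complex[where B = \<kappa>]) (auto simp: norm_mult)
  have intC: "integrable M ?C"
  proof (rule integrable_bounded_complex)
    show "cmod (?C x) \<le> real (card I) * (\<kappa> * \<mu>) + \<bar>v\<bar>" for x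
      unfolding norm_mult norm_exp_i_times norm_of_real mult_1_right
      using Ub[of x] by linarith
  qed measurable
  have EB: "expectation ?B = 0"
    using intB zero by (simp add: Bochner_Integration.integral_sum)
  have int1: "integrable M (\<lambda>x. \<i> * S x * ?e x)"
    by (rule integrable_bounded_complex[where B = "real (card I) * \<kappa>"]) (use Sb in \<open>auto simp: norm_mult\<close>)
  have int2: "integrable M ?e"
    by (rule integrable_bounded_complex[where B = 1]) auto
  have pt: "\<i> * S x * ?e x + u * v * ?e x = \<i> * ?A x + \<i> * ?B x - u * ?C x" for x
  proof -
    have "?e x * iexp (- (u * s i x)) = iexp (u * (S x - s i x))" for i
      by (subst iexp_add[symmetric]) (simp add: algebra_simps)
    then have "z i x * ?e x * ?r i x + z i x * iexp (u * (S x - s i x)) = z i x * ?e x - \<i> * u * (z i x * s i x) * ?e x" for i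
      by (simp add: algebra_simps)
    then have "?A x + ?B x = (\<Sum>i\<in>I. z i x * ?e x - \<i> * u * (z i x * s i x) * ?e x)"
      by (simp add: sum.distrib[symmetric])
    also have "\<dots> = S x * ?e x - \<i> * u * ?U x * ?e x"
      by (simp add: S sum_subtractf sum_distrib_left sum_distrib_right)
    finally have "\<i> * (?A x + ?B x) = \<i> * (S x * ?e x - \<i> * u * ?U x * ?e x)" by simp
    then show ?thesis by (simp add: algebra_simps)
  qed
  have "expectation (\<lambda>x. \<i> * S x * ?e x) + u * v * expectation ?e = expectation (\<lambda>x. \<i> * S x * ?e x + u * v * ?e x)"
    using int1 int2 by simp
  also have "\<dots> = \<i> * expectation ?A + \<i> * expectation ?B - u * expectation ?C"
    unfolding pt using intA intB intC by simp
  finally have split: "cmod (expectation (\<lambda>x. \<i> * S x * ?e x) + u * v * expectation ?e) \<le>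
      \<bar>u\<bar> * cmod (expectation ?C) + cmod (expectation ?A)"
    unfolding EB using norm_triangle_ineq4[of "\<i> * expectation ?A" "u * expectation ?C"] by (simp add: norm_mult)
  have EC: "cmod (expectation ?C) \<le> w"
  proof -
    have "?U \<in> borel_measurable M" by measurable
    then have "square_integrable M ?U"
      by (rule square_integrable_bounded[where f = ?U and c = "real (card I) * (\<kappa> * \<mu>)"]) (rule Ub)
    then have sq: "square_integrable M (\<lambda>x. ?U x - v)"
      by (rule square_integrable_diff[where f = ?U, OF _ square_integrable_const])
    have n: "cmod (?C x) = \<bar>?U x - v\<bar>" for x
      by (simp only: norm_mult norm_exp_i_times norm_of_real mult_1_right)
    have "cmod (expectation ?C) \<le> expectation (\<lambda>x. cmod (?C x))"
      by (rule integral_norm_bound[where f = ?C])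
    then have le: "cmod (expectation ?C) \<le> expectation (\<lambda>x. \<bar>?U x - v\<bar>)" by (simp only: n)
    show ?thesis by (rule order.trans[OF le order.trans[OF expectation_abs_le_l2norm[OF sq] var]])
  qed
  have "cmod (expectation ?A) \<le> real (card I) * (\<kappa> * (u\<^sup>2 * \<mu>\<^sup>2 / 2))"
    by (rule norm_expectation_le_const[OF intA Ab])
  moreover have "\<bar>u\<bar> * cmod (expectation ?C) \<le> \<bar>u\<bar> * w"
    using EC by (rule mult_left_mono) simp
  ultimately show ?thesis using split by linarith
qed

end

subsection \<open>Central limit theorem for bounded functions of finitely many coordinates\<close>

text \<open>A pointwise notion in place of measurability for a sub-sigma-algebra;
  \<open>integral_mult_depends_on\<close> turns it into independence.\<close>

definition depends_on :: "'i set \<Rightarrow> (('i \<Rightarrow> 'b) \<Rightarrow> 'c) \<Rightarrow> bool" where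
  "depends_on A F \<longleftrightarrow> (\<forall>x y. (\<forall>i\<in>A. x i = y i) \<longrightarrow> F x = F y)"

lemma depends_onD: "depends_on A F \<Longrightarrow> (\<And>i. i \<in> A \<Longrightarrow> x i = y i) \<Longrightarrow> F x = F y"
  by (auto simp: depends_on_def)

lemma depends_on_mono: "depends_on A F \<Longrightarrow> A \<subseteq> B \<Longrightarrow> depends_on B F"
  unfolding depends_on_def by blast

lemma depends_on_compose: "depends_on A F \<Longrightarrow> depends_on A (\<lambda>x. \<phi> (F x))"
  unfolding depends_on_def by metis

lemma depends_on_sum:
  "(\<And>l. l \<in> L \<Longrightarrow> depends_on (A l) (F l)) \<Longrightarrow> depends_on (\<Union>l\<in>L. A l) (\<lambda>x. \<Sum>l\<in>L. F l x)"
  unfolding depends_on_def by (auto intro!: sum.cong)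

lemma depends_on_mult:
  fixes F G :: "('i \<Rightarrow> 'b) \<Rightarrow> real"
  shows "depends_on A F \<Longrightarrow> depends_on B G \<Longrightarrow> depends_on (A \<union> B) (\<lambda>x. F x * G x)"
  unfolding depends_on_def by (metis UnCI)

lemma depends_on_shift: "depends_on A F \<Longrightarrow> depends_on ((\<lambda>a. a + i) ` A) (\<lambda>x. F (shift i x))"
  unfolding depends_on_def by (auto simp: shift_def)

text \<open>The difference set A - A: the translates of A by i and by l are disjoint unless l - i
  lies in it. Its cardinality bounds the number of neighbours of a site in any \<Gamma>.\<close>

definition differences :: "'i :: ab_group_add set \<Rightarrow> 'i set" where
  "differences A = (\<lambda>(a, b). a - b) ` (A \<times> A)"

lemma finite_differences: "finite A \<Longrightarrow> finite (differences A)"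
  by (simp add: differences_def)

lemma translates_disjoint:
  assumes "l - i \<notin> differences A"
  shows "((\<lambda>a. a + i) ` A) \<inter> ((\<lambda>a. a + l) ` A) = {}"
proof (rule ccontr)
  assume "\<not> ?thesis"
  then obtain a b where "a \<in> A" "b \<in> A" "a + i = b + l" by auto
  then have "l - i = a - b" by (simp add: algebra_simps)
  with \<open>a \<in> A\<close> \<open>b \<in> A\<close> assms show False by (auto simp: differences_def)
qed

lemma card_translate_le:
  assumes "finite (D :: 'i :: ab_group_add set)"
  shows "card {l \<in> \<Gamma>. l - i \<in> D} \<le> card D"
proof -
  have "inj_on (\<lambda>l. l - i) {l \<in> \<Gamma>. l - i \<in> D}" by (simp add: inj_on_def)
  then show ?thesis using assms by (intro card_inj_on_le[where f = "\<lambda>l. l - i"]) auto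
qed

text \<open>Each site has at most card D correlated partners whatever \<Gamma> is, so all but card
  \<Gamma> * card D terms of the double sum vanish.\<close>

lemma (in prob_space) expectation_sum_power2_le:
  fixes Y :: "'i :: ab_group_add \<Rightarrow> 'a \<Rightarrow> real"
  assumes "finite \<Gamma>" "finite D"
    and [measurable]: "\<And>i. i \<in> \<Gamma> \<Longrightarrow> Y i \<in> borel_measurable M"
    and Y: "\<And>i x. i \<in> \<Gamma> \<Longrightarrow> \<bar>Y i x\<bar> \<le> K"
    and uncorrelated: "\<And>i l. i \<in> \<Gamma> \<Longrightarrow> l \<in> \<Gamma> \<Longrightarrow> l - i \<notin> D \<Longrightarrow> expectation (\<lambda>x. Y i x * Y l x) = 0"
  shows "expectation (\<lambda>x. (\<Sum>i\<in>\<Gamma>. Y i x)\<^sup>2) \<le> real (card \<Gamma>) * (real (card D) * K\<^sup>2)"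
proof -
  have sq: "square_integrable M (Y i)" if "i \<in> \<Gamma>" for i
    by (rule square_integrable_bounded[of "Y i" K]) (use that Y in auto)
  have int: "integrable M (\<lambda>x. Y i x * Y l x)" if "i \<in> \<Gamma>" "l \<in> \<Gamma>" for i l
    by (rule square_integrable_mult[OF sq sq]) (use that in auto)
  have le: "expectation (\<lambda>x. Y i x * Y l x) \<le> K\<^sup>2" if "i \<in> \<Gamma>" "l \<in> \<Gamma>" for i l
  proof -
    have "Y i x * Y l x \<le> K\<^sup>2" for x
    proof -
      have "Y i x * Y l x \<le> \<bar>Y i x\<bar> * \<bar>Y l x\<bar>" by (simp flip: abs_mult)
      also have "\<dots> \<le> K * K"
        using Y[OF that(1), of x] Y[OF that(2), of x] by (intro mult_mono) auto
      finally show ?thesis by (simp add: power2_eq_square)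
    qed
    then have "expectation (\<lambda>x. Y i x * Y l x) \<le> expectation (\<lambda>_. K\<^sup>2)"
      by (intro integral_mono int that) auto
    then show ?thesis by (simp add: prob_space)
  qed
  have "expectation (\<lambda>x. (\<Sum>i\<in>\<Gamma>. Y i x)\<^sup>2) = expectation (\<lambda>x. \<Sum>i\<in>\<Gamma>. \<Sum>l\<in>\<Gamma>. Y i x * Y l x)"
    by (simp add: power2_eq_square sum_product)
  also have "\<dots> = (\<Sum>i\<in>\<Gamma>. \<Sum>l\<in>\<Gamma>. expectation (\<lambda>x. Y i x * Y l x))"
    using int by (simp add: Bochner_Integration.integral_sum)
  also have "\<dots> = (\<Sum>i\<in>\<Gamma>. \<Sum>l\<in>{l \<in> \<Gamma>. l - i \<in> D}. expectation (\<lambda>x. Y i x * Y l x))"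
    using \<open>finite \<Gamma>\<close> uncorrelated by (intro sum.cong refl sum.mono_neutral_right) auto
  also have "\<dots> \<le> (\<Sum>i\<in>\<Gamma>. real (card D) * K\<^sup>2)"
  proof (intro sum_mono)
    fix i assume "i \<in> \<Gamma>"
    have "(\<Sum>l\<in>{l \<in> \<Gamma>. l - i \<in> D}. expectation (\<lambda>x. Y i x * Y l x)) \<le> real (card {l \<in> \<Gamma>. l - i \<in> D}) * K\<^sup>2"
      using le[OF \<open>i \<in> \<Gamma>\<close>] by (intro sum_bounded_above) auto
    also have "\<dots> \<le> real (card D) * K\<^sup>2"
      using card_translate_le[OF \<open>finite D\<close>] by (intro mult_right_mono) auto
    finally show "(\<Sum>l\<in>{l \<in> \<Gamma>. l - i \<in> D}. expectation (\<lambda>x. Y i x * Y l x)) \<le> real (card D) * K\<^sup>2" .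
  qed
  also have "\<dots> = real (card \<Gamma>) * (real (card D) * K\<^sup>2)" by simp
  finally show ?thesis .
qed

context iid_factor
begin

lemma integral_mult_depends_on:
  fixes F H :: "('i \<Rightarrow> 'b) \<Rightarrow> real"
  assumes "square_integrable (iid_measure N) F" "square_integrable (iid_measure N) H"
    and "depends_on A F" "depends_on B H" "A \<inter> B = {}"
  shows "(LINT x|iid_measure N. F x * H x) = (LINT x|iid_measure N. F x) * (LINT x|iid_measure N. H x)"
  by (rule integral_mult_disjoint_support[OF assms(1,2) depends_onD[OF assms(3)] depends_onD[OF assms(4)] assms(5)])

text \<open>With r the square root of card \<Gamma>, summands have size 1/r and boundedly many
  neighbours. The sum of \<open>z i * s i\<close> fluctuates by order 1/r since these products are
  again finitely dependent, and card \<Gamma> Taylor remainders of order 1/r^3 also total order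
  1/r.\<close>

lemma finite_range_char_estimate:
  fixes f :: "('i :: ab_group_add \<Rightarrow> 'b) \<Rightarrow> real" and t c :: real
  assumes fm[measurable]: "f \<in> borel_measurable (iid_measure N)" and fb: "\<And>x. \<bar>f x\<bar> \<le> c"
    and "finite B" and dep: "depends_on B f" and "finite \<Gamma>" "\<Gamma> \<noteq> {}"
  defines "m \<equiv> (LINT x|iid_measure N. f x)"
  defines "S \<equiv> \<lambda>x. (\<Sum>i\<in>\<Gamma>. f (shift i x) - m) / sqrt (card \<Gamma>)"
  defines "d \<equiv> card (differences B)"
    and "d' \<equiv> card (differences ((\<lambda>(b, a). b + a) ` (B \<times> insert 0 (differences B))))"
  shows "cmod ((LINT x|iid_measure N. iexp (t * S x)) -
      complex_of_real (exp (- ((LINT x|iid_measure N. (S x)\<^sup>2) * t\<^sup>2 / 2))))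
    \<le> \<bar>t\<bar> * (\<bar>t\<bar> * (8 * c\<^sup>2 * d * sqrt d') + 4 * c ^ 3 * (real d)\<^sup>2 * t\<^sup>2) / sqrt (card \<Gamma>)"
proof -
  interpret P: prob_space "iid_measure N :: ('i \<Rightarrow> 'b) measure" by (rule prob_space_iid_measure[OF N])
  define r where "r = sqrt (card \<Gamma>)"
  have n: "0 < card \<Gamma>" using assms by (simp add: card_gt_0_iff)
  then have r: "0 < r" and r2: "r\<^sup>2 = card \<Gamma>" by (auto simp: r_def)
  have "0 \<le> c" by (rule order.trans[OF abs_ge_zero fb])
  define z where "z i x = (f (shift i x) - m) / r" for i x
  define nb where "nb i = {l \<in> \<Gamma>. l - i \<in> differences B}" for i
  define s where "s i x = (\<Sum>l\<in>nb i. z l x)" for i x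
  define U where "U i x = z i x * s i x" for i x
  \<comment> \<open>\<open>U i\<close> reads B + i and the B + l with l - i in B - B, all inside B'
    + i; \<open>insert 0\<close> puts B itself into B'.\<close>
  define B' where "B' = (\<lambda>(b, a). b + a) ` (B \<times> insert 0 (differences B))"
  define v where "v = (LINT x|iid_measure N. (S x)\<^sup>2)"
  \<comment> \<open>|f - m| is at most 2 * c, and \<open>s i\<close> has at most d terms. The
    centred \<open>U i\<close> are at most 2 * (\<kappa> * \<mu>) and each is correlated with at
    most d' of them, which gives w.\<close>
  define \<kappa> where "\<kappa> = 2 * c / r"
  define \<mu> where "\<mu> = d * \<kappa>"
  define w where "w = sqrt (real (card \<Gamma>) * (real d' * (2 * (\<kappa> * \<mu>))\<^sup>2))"
  have "0 \<le> \<kappa>" using \<open>0 \<le> c\<close> r by (simp add: \<kappa>_def)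
  have "0 \<le> \<mu>" using \<open>0 \<le> \<kappa>\<close> by (simp add: \<mu>_def)
  have "finite (differences B)" by (rule finite_differences[OF \<open>finite B\<close>])
  have "finite B'" using \<open>finite B\<close> \<open>finite (differences B)\<close> by (simp add: B'_def)
  have "finite (nb i)" for i using \<open>finite \<Gamma>\<close> by (simp add: nb_def)
  have nb_sub: "nb i \<subseteq> \<Gamma>" for i by (auto simp: nb_def)
  have [measurable]: "z i \<in> borel_measurable (iid_measure N)" for i unfolding z_def[abs_def] by measurable
  have [measurable]: "s i \<in> borel_measurable (iid_measure N)" for i unfolding s_def[abs_def] by measurable
  have [measurable]: "U i \<in> borel_measurable (iid_measure N)" for i unfolding U_def[abs_def] by measurable
  have "\<bar>m\<bar> \<le> c"
  proof -
    have "\<bar>m\<bar> \<le> (LINT x|iid_measure N. \<bar>f x\<bar>)" unfolding m_def by (rule integral_abs_bound)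
    also have "\<dots> \<le> (LINT x|(iid_measure N :: ('i \<Rightarrow> 'b) measure). c)"
      using fb \<open>0 \<le> c\<close> by (intro integral_mono P.integrable_const_bound[where B = c]) auto
    finally show ?thesis by (simp add: P.prob_space)
  qed
  then have zb: "\<bar>z i x\<bar> \<le> \<kappa>" for i x
    using fb[of "shift i x"] r by (simp add: z_def \<kappa>_def divide_right_mono)
  have sb: "\<bar>s i x\<bar> \<le> \<mu>" for i x
  proof -
    have "\<bar>s i x\<bar> \<le> (\<Sum>l\<in>nb i. \<bar>z l x\<bar>)" unfolding s_def by (rule sum_abs)
    also have "\<dots> \<le> real (card (nb i)) * \<kappa>" using zb by (intro sum_bounded_above)
    also have "\<dots> \<le> \<mu>"
      unfolding \<mu>_def d_def nb_def using \<open>0 \<le> \<kappa>\<close> card_translate_le[OF \<open>finite (differences B)\<close>]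
      by (intro mult_right_mono) auto
    finally show ?thesis .
  qed
  have Ub: "\<bar>U i x\<bar> \<le> \<kappa> * \<mu>" for i x
    unfolding U_def abs_mult using zb sb \<open>0 \<le> \<kappa>\<close> by (intro mult_mono) auto
  have zsq: "square_integrable (iid_measure N) (z i)" for i
    by (rule P.square_integrable_bounded[of "z i" \<kappa>]) (use zb in auto)
  have ssq: "square_integrable (iid_measure N) (s i)" for i
    by (rule P.square_integrable_bounded[of "s i" \<mu>]) (use sb in auto)
  have Usq: "square_integrable (iid_measure N) (U i)" for i
    by (rule P.square_integrable_bounded[of "U i" "\<kappa> * \<mu>"]) (use Ub in auto)
  have zdep: "depends_on ((\<lambda>a. a + i) ` B) (z i)" for i
    unfolding z_def[abs_def] by (rule depends_on_compose[OF depends_on_shift[OF dep], where \<phi> = "\<lambda>y. (y - m) / r"])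
  have Ez: "(LINT x|iid_measure N. z i x) = 0" for i
  proof -
    have "square_integrable (iid_measure N) f" by (rule P.square_integrable_bounded[OF fm fb])
    note this[THEN square_integrable_shift, THEN P.square_integrable_integrable]
    then show ?thesis by (simp add: z_def integral_shift P.prob_space m_def)
  qed
  have S: "S x = (\<Sum>i\<in>\<Gamma>. z i x)" for x
    by (simp add: S_def z_def r_def sum_divide_distrib)
  have [measurable]: "S \<in> borel_measurable (iid_measure N)" unfolding S[abs_def] by measurable
  have Sb: "\<bar>S x\<bar> \<le> real (card \<Gamma>) * \<kappa>" for x
    unfolding S using zb by (intro order.trans[OF sum_abs] sum_bounded_above) auto
  have zero: "(LINT x|iid_measure N. z i x * iexp (u * (S x - s i x))) = 0" if "i \<in> \<Gamma>" for i u
  proof -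
    define R where "R x = (\<Sum>l\<in>\<Gamma> - nb i. z l x)" for x
    have R: "S x - s i x = R x" for x
      using sum.subset_diff[OF nb_sub[of i] \<open>finite \<Gamma>\<close>, of "\<lambda>l. z l x"] by (simp add: S s_def R_def)
    have [measurable]: "R \<in> borel_measurable (iid_measure N)" unfolding R_def[abs_def] by measurable
    have Rdep: "depends_on (\<Union>l\<in>\<Gamma> - nb i. (\<lambda>a. a + l) ` B) R"
      unfolding R_def[abs_def] by (rule depends_on_sum[OF zdep])
    have disj: "(\<lambda>a. a + i) ` B \<inter> (\<Union>l\<in>\<Gamma> - nb i. (\<lambda>a. a + l) ` B) = {}"
      using translates_disjoint[of _ i B] unfolding nb_def by blast
    \<comment> \<open>The factorisation concerns real functions, so it is proved for bounded \<phi>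
      and then used with cos and sin.\<close>
    have indep: "(LINT x|iid_measure N. z i x * \<phi> (u * R x)) = 0"
      if [measurable]: "\<phi> \<in> borel_measurable borel" and \<phi>: "\<And>y. \<bar>\<phi> y\<bar> \<le> 1" for \<phi> :: "real \<Rightarrow> real"
    proof -
      have sq: "square_integrable (iid_measure N) (\<lambda>x. \<phi> (u * R x))"
        by (rule P.square_integrable_bounded[where c = 1]) (use \<phi> in auto)
      show ?thesis
        by (subst integral_mult_depends_on[OF zsq sq zdep depends_on_compose[OF Rdep, where \<phi> = "\<lambda>y. \<phi> (u * y)"] disj])
          (simp add: Ez)
    qed
    have ii: "integrable (iid_measure N) (\<lambda>x. z i x * \<phi> (u * R x))"
      if [measurable]: "\<phi> \<in> borel_measurable borel" and \<phi>: "\<And>y. \<bar>\<phi> y\<bar> \<le> 1" for \<phi> :: "real \<Rightarrow> real"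
    proof -
      have sq: "square_integrable (iid_measure N) (\<lambda>x. \<phi> (u * R x))"
        by (rule P.square_integrable_bounded[where c = 1]) (use \<phi> in auto)
      show ?thesis by (rule square_integrable_mult[OF zsq sq])
    qed
    have "z i x * iexp (u * R x) = complex_of_real (z i x * cos (u * R x)) + \<i> * complex_of_real (z i x * sin (u * R x))" for x
    proof -
      have e: "iexp y = complex_of_real (cos y) + \<i> * complex_of_real (sin y)" for y
        by (simp add: cis_conv_exp[symmetric] complex_eq_iff)
      show ?thesis unfolding e[of "u * R x"] by (simp add: distrib_left mult.left_commute)
    qed
    then have "(LINT x|iid_measure N. z i x * iexp (u * R x)) =
      (LINT x|iid_measure N. complex_of_real (z i x * cos (u * R x)) + \<i> * complex_of_real (z i x * sin (u * R x)))"
      by (simp only:)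
    also have "\<dots> = complex_of_real (LINT x|iid_measure N. z i x * cos (u * R x))
        + \<i> * complex_of_real (LINT x|iid_measure N. z i x * sin (u * R x))"
      using ii[of cos] ii[of sin]
      by (subst Bochner_Integration.integral_add)
        (simp_all only: integral_mult_right_zero integral_complex_of_real complex_of_real_integrable_eq
          integrable_mult_right abs_cos_le_one abs_sin_le_one borel_measurable_cos borel_measurable_sin)
    also have "\<dots> = 0" using indep[of cos] indep[of sin] by simp
    finally show ?thesis by (simp only: R)
  qed
  have pair0: "(LINT x|iid_measure N. z i x * z l x) = 0" if "l - i \<notin> differences B" for i l
    by (subst integral_mult_depends_on[OF zsq zsq zdep zdep translates_disjoint[OF that]]) (simp add: Ez)
  \<comment> \<open>Pairs that are not neighbours are uncorrelated, so v is exactly the expectation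
    of the random variance.\<close>
  have v_eq: "v = (\<Sum>i\<in>\<Gamma>. LINT x|iid_measure N. U i x)"
  proof -
    note int = square_integrable_mult[OF zsq zsq]
    have "v = (LINT x|iid_measure N. (\<Sum>i\<in>\<Gamma>. \<Sum>l\<in>\<Gamma>. z i x * z l x))"
      by (simp add: v_def S power2_eq_square sum_product)
    also have "\<dots> = (\<Sum>i\<in>\<Gamma>. \<Sum>l\<in>\<Gamma>. LINT x|iid_measure N. z i x * z l x)"
      using int by (simp add: Bochner_Integration.integral_sum)
    also have "\<dots> = (\<Sum>i\<in>\<Gamma>. \<Sum>l\<in>nb i. LINT x|iid_measure N. z i x * z l x)"
      using \<open>finite \<Gamma>\<close> pair0 by (intro sum.cong refl sum.mono_neutral_right) (auto simp: nb_def)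
    also have "\<dots> = (\<Sum>i\<in>\<Gamma>. LINT x|iid_measure N. U i x)"
      using int by (simp add: U_def s_def sum_distrib_left Bochner_Integration.integral_sum)
    finally show ?thesis .
  qed
  have Udep: "depends_on ((\<lambda>a. a + i) ` B') (U i)" for i
  proof -
    have sdep: "depends_on (\<Union>l\<in>nb i. (\<lambda>a. a + l) ` B) (s i)"
      unfolding s_def[abs_def] by (rule depends_on_sum[OF zdep])
    have sub: "(\<lambda>a. a + i) ` B \<union> (\<Union>l\<in>nb i. (\<lambda>a. a + l) ` B) \<subseteq> (\<lambda>a. a + i) ` B'"
    proof -
      have "b + i \<in> (\<lambda>a. a + i) ` B'" if "b \<in> B" for b
        using that by (auto simp: B'_def intro!: imageI image_eqI[of b _ "(b, 0)"])
      moreover have "b + l \<in> (\<lambda>a. a + i) ` B'" if "b \<in> B" "l \<in> nb i" for b l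
      proof -
        have "b + (l - i) \<in> B'" using that by (auto simp: B'_def nb_def intro!: image_eqI[of _ _ "(b, l - i)"])
        then have "(b + (l - i)) + i \<in> (\<lambda>a. a + i) ` B'" by (rule imageI)
        then show ?thesis by simp
      qed
      ultimately show ?thesis by blast
    qed
    show ?thesis unfolding U_def[abs_def] by (rule depends_on_mono[OF depends_on_mult[OF zdep sdep] sub])
  qed
  define EU where "EU i = (LINT x|iid_measure N. U i x)" for i
  have EUb: "\<bar>EU i\<bar> \<le> \<kappa> * \<mu>" for i
  proof -
    have "\<bar>EU i\<bar> \<le> (LINT x|iid_measure N. \<bar>U i x\<bar>)" unfolding EU_def by (rule integral_abs_bound)
    also have "\<dots> \<le> (LINT x|(iid_measure N :: ('i \<Rightarrow> 'b) measure). \<kappa> * \<mu>)"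
      using Ub \<open>0 \<le> \<kappa>\<close> \<open>0 \<le> \<mu>\<close> by (intro integral_mono P.integrable_const_bound[where B = "\<kappa> * \<mu>"]) auto
    finally show ?thesis by (simp add: P.prob_space)
  qed
  have "(LINT x|iid_measure N. (\<Sum>i\<in>\<Gamma>. U i x - EU i)\<^sup>2) \<le>
      real (card \<Gamma>) * (real (card (differences B')) * (2 * (\<kappa> * \<mu>))\<^sup>2)"
  proof (rule P.expectation_sum_power2_le[OF \<open>finite \<Gamma>\<close> finite_differences[OF \<open>finite B'\<close>]])
    show "\<bar>U i x - EU i\<bar> \<le> 2 * (\<kappa> * \<mu>)" for i x using Ub[of i x] EUb[of i] by linarith
    fix i l assume "l - i \<notin> differences B'"
    then have disj: "(\<lambda>a. a + i) ` B' \<inter> (\<lambda>a. a + l) ` B' = {}" by (rule translates_disjoint)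
    have c: "square_integrable (iid_measure N) (\<lambda>x. U i x - EU i)"
      "depends_on ((\<lambda>a. a + i) ` B') (\<lambda>x. U i x - EU i)" for i
      using square_integrable_diff[OF Usq P.square_integrable_const] depends_on_compose[OF Udep, where \<phi> = "\<lambda>y. y - EU i"] by auto
    have "(LINT x|iid_measure N. U i x - EU i) = 0"
      using P.square_integrable_integrable[OF Usq[of i]] by (simp add: EU_def P.prob_space)
    then show "(LINT x|iid_measure N. (U i x - EU i) * (U l x - EU l)) = 0"
      by (subst integral_mult_depends_on[OF c(1) c(1) c(2) c(2) disj]) simp
  qed measurable
  then have "(LINT x|iid_measure N. ((\<Sum>i\<in>\<Gamma>. z i x * s i x) - v)\<^sup>2) \<le> real (card \<Gamma>) * (real d' * (2 * (\<kappa> * \<mu>))\<^sup>2)"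
    by (simp add: sum_subtractf v_eq EU_def U_def d'_def B'_def)
  then have var: "l2norm (iid_measure N) (\<lambda>x. (\<Sum>i\<in>\<Gamma>. z i x * s i x) - v) \<le> w"
    unfolding l2norm_def w_def by (rule real_sqrt_le_mono)
  have "cmod ((LINT x|iid_measure N. iexp (t * S x)) - complex_of_real (exp (- (v * t\<^sup>2 / 2))))
      \<le> \<bar>t\<bar> * (\<bar>t\<bar> * w + real (card \<Gamma>) * (\<kappa> * (t\<^sup>2 * \<mu>\<^sup>2 / 2)))"
  proof (rule P.norm_expectation_iexp_diff_gaussian_le[OF _ Sb])
    show "0 \<le> v" by (simp add: v_def)
    fix u :: real assume u: "\<bar>u\<bar> \<le> \<bar>t\<bar>"
    have "cmod ((LINT x|iid_measure N. \<i> * S x * iexp (u * S x)) + u * v * (LINT x|iid_measure N. iexp (u * S x)))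
      \<le> \<bar>u\<bar> * w + real (card \<Gamma>) * (\<kappa> * (u\<^sup>2 * \<mu>\<^sup>2 / 2))"
      by (rule P.norm_stein_equation_le[OF \<open>finite \<Gamma>\<close> _ _ zb sb S zero var]) measurable
    also have "\<dots> \<le> \<bar>t\<bar> * w + real (card \<Gamma>) * (\<kappa> * (t\<^sup>2 * \<mu>\<^sup>2 / 2))"
    proof -
      have "u\<^sup>2 \<le> t\<^sup>2" using u by (simp add: abs_le_square_iff)
      moreover have "0 \<le> w" by (simp add: w_def)
      ultimately show ?thesis
        using u \<open>0 \<le> \<kappa>\<close> by (intro add_mono mult_right_mono mult_left_mono divide_right_mono) auto
    qed
    finally show "cmod ((LINT x|iid_measure N. \<i> * S x * iexp (u * S x)) + u * v * (LINT x|iid_measure N. iexp (u * S x)))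
      \<le> \<bar>t\<bar> * w + real (card \<Gamma>) * (\<kappa> * (t\<^sup>2 * \<mu>\<^sup>2 / 2))" .
  qed measurable
  also have "w = 8 * c\<^sup>2 * d * sqrt d' / r"
  proof -
    have "w = r * sqrt d' * (2 * (\<kappa> * \<mu>))"
      using \<open>0 \<le> \<kappa>\<close> \<open>0 \<le> \<mu>\<close> by (simp add: w_def real_sqrt_mult r_def real_sqrt_abs abs_mult)
    also have "\<dots> = 8 * c\<^sup>2 * d * sqrt d' / r"
      using r by (simp add: \<kappa>_def \<mu>_def power2_eq_square field_simps)
    finally show ?thesis .
  qed
  also have "real (card \<Gamma>) * (\<kappa> * (t\<^sup>2 * \<mu>\<^sup>2 / 2)) = 4 * c ^ 3 * (real d)\<^sup>2 * t\<^sup>2 / r"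
    unfolding r2[symmetric] using r by (simp add: \<kappa>_def \<mu>_def power2_eq_square power3_eq_cube field_simps)
  finally show ?thesis
    by (simp add: v_def r_def add_divide_distrib distrib_left)
qed

end

subsection \<open>Levy distance\<close>

text \<open>One admissible r yields nonnegativity as well: the infimum is then taken over a nonempty
  set of positive numbers.\<close>

lemma levy_dist_le:
  assumes "0 < r" and "\<And>x. cdf \<mu> (x - r) - r \<le> cdf \<nu> x" "\<And>x. cdf \<nu> x \<le> cdf \<mu> (x + r) + r"
  shows "0 \<le> levy_dist \<mu> \<nu>" "levy_dist \<mu> \<nu> \<le> r"
proof -
  let ?R = "{r. r > 0 \<and> (\<forall>x. cdf \<mu> (x - r) - r \<le> cdf \<nu> x \<and> cdf \<nu> x \<le> cdf \<mu> (x + r) + r)}"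
  have r: "r \<in> ?R" using assms by simp
  show "0 \<le> levy_dist \<mu> \<nu>"
    unfolding levy_dist_def by (rule cInf_greatest) (use r in auto)
  show "levy_dist \<mu> \<nu> \<le> r"
    unfolding levy_dist_def by (rule cInf_lower[OF r]) (auto intro!: bdd_belowI[of _ 0])
qed

text \<open>On the grid both distribution functions are within r/2 of F, and the last grid point g j
  below x satisfies x - r \<le> g j \<le> x, so monotonicity carries over the comparison at g j.
  Left of the grid the first function is below r, right of it the second exceeds 1 - r.\<close>

lemma cdf_shift_le_on_grid:
  fixes g :: "nat \<Rightarrow> real" and F :: "real \<Rightarrow> real"
  assumes "real_distribution \<mu>" "real_distribution \<nu>" and r: "0 < r"
    and g: "\<And>j. g j = a + real j * (r / 2)"
    and low: "F (g 0) < r / 2" and high: "1 - r / 2 < F (g m)"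
    and \<mu>: "\<And>j. j \<le> m \<Longrightarrow> \<bar>cdf \<mu> (g j) - F (g j)\<bar> < r / 2"
    and \<nu>: "\<And>j. j \<le> m \<Longrightarrow> \<bar>cdf \<nu> (g j) - F (g j)\<bar> < r / 2"
  shows "cdf \<mu> (x - r) - r \<le> cdf \<nu> x"
proof -
  interpret \<mu>: real_distribution \<mu> by fact
  interpret \<nu>: real_distribution \<nu> by fact
  consider "x < g 0" | "g m \<le> x" | "g 0 \<le> x" "x < g m" by linarith
  then show ?thesis
  proof cases
    case 1
    then have "cdf \<mu> (x - r) \<le> cdf \<mu> (g 0)" using r by (intro \<mu>.cdf_nondecreasing) simp
    then show ?thesis using \<mu>[of 0] low \<nu>.cdf_nonneg[of x] by linarith
  next
    case 2
    then have "cdf \<nu> (g m) \<le> cdf \<nu> x" by (rule \<nu>.cdf_nondecreasing)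
    then show ?thesis using \<nu>[of m] high \<mu>.cdf_bounded_prob[of "x - r"] by linarith
  next
    case 3
    define j where "j = nat \<lfloor>(x - g 0) / (r / 2)\<rfloor>"
    have q: "0 \<le> (x - g 0) / (r / 2)" using 3 r by simp
    have "real j \<le> (x - g 0) / (r / 2)" "(x - g 0) / (r / 2) < real j + 1"
      unfolding j_def using q by (simp_all add: le_floor_iff)
    then have j: "g j \<le> x" "x < g j + r / 2"
      using r by (simp_all add: g field_simps)
    have "g j < g m" using j(1) 3 by linarith
    then have "j \<le> m" using r by (simp add: g)
    have "cdf \<mu> (x - r) \<le> cdf \<mu> (g j)" using j(2) r by (intro \<mu>.cdf_nondecreasing) simp
    moreover have "cdf \<nu> (g j) \<le> cdf \<nu> x" using j(1) by (rule \<nu>.cdf_nondecreasing)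
    ultimately show ?thesis using \<mu>[OF \<open>j \<le> m\<close>] \<nu>[OF \<open>j \<le> m\<close>] by linarith
  qed
qed

text \<open>Each discontinuity excludes one offset h per grid index, countably many in all, while
  the interval of offsets is uncountable.\<close>

lemma (in real_distribution) continuity_grid_exists:
  assumes "0 < \<delta>"
  shows "\<exists>h. 0 < h \<and> h < \<delta> \<and> (\<forall>j::nat. isCont (cdf M) (a + h + real j * \<delta>))"
proof -
  let ?D = "{x. \<not> isCont (cdf M) x}"
  have "countable ?D" using cdf_nondecreasing by (intro mono_ctble_discont) (auto simp: mono_def)
  then have "countable (\<Union>j::nat. (\<lambda>d. d - a - real j * \<delta>) ` ?D)" by auto
  moreover have "uncountable {0<..<\<delta>}" using assms by (simp add: uncountable_open_interval)
  ultimately obtain h where h: "h \<in> {0<..<\<delta>}" "h \<notin> (\<Union>j::nat. (\<lambda>d. d - a - real j * \<delta>) ` ?D)"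
    by (meson countable_subset subsetI)
  have "isCont (cdf M) (a + h + real j * \<delta>)" for j :: nat
  proof (rule ccontr)
    assume "\<not> ?thesis"
    then have "(a + h + real j * \<delta>) - a - real j * \<delta> \<in> (\<lambda>d. d - a - real j * \<delta>) ` ?D" by blast
    then have "h \<in> (\<lambda>d. d - a - real j * \<delta>) ` ?D" by simp
    with h(2) show False by blast
  qed
  with h(1) show ?thesis by auto
qed

lemma levy_dist_tendsto_0_of_weak_conv:
  assumes \<mu>: "\<And>n. real_distribution (\<mu> n)" and \<nu>: "\<And>n. real_distribution (\<nu> n)"
    and \<rho>: "real_distribution \<rho>" and "weak_conv_m \<mu> \<rho>" "weak_conv_m \<nu> \<rho>"
  shows "(\<lambda>n. levy_dist (\<mu> n) (\<nu> n)) \<longlonglongrightarrow> 0"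
proof (rule LIMSEQ_I)
  interpret \<rho>: real_distribution \<rho> by fact
  fix e :: real assume "0 < e"
  define r where "r = e / 2"
  have "0 < r" using \<open>0 < e\<close> by (simp add: r_def)
  have "\<forall>\<^sub>F x in at_bot. cdf \<rho> x < r / 2"
    using order_tendstoD(2)[OF \<rho>.cdf_lim_at_bot, of "r / 2"] \<open>0 < r\<close> by simp
  then obtain A where A: "\<And>x. x \<le> A \<Longrightarrow> cdf \<rho> x < r / 2"
    by (auto simp: eventually_at_bot_linorder)
  have "\<forall>\<^sub>F x in at_top. 1 - r / 2 < cdf \<rho> x"
    using order_tendstoD(1)[OF \<rho>.cdf_lim_at_top_prob, of "1 - r / 2"] \<open>0 < r\<close> by simp
  then obtain Z where Z: "\<And>x. Z \<le> x \<Longrightarrow> 1 - r / 2 < cdf \<rho> x"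
    by (auto simp: eventually_at_top_linorder)
  \<comment> \<open>Weak convergence is available at continuity points of the limit. Since h < r/2,
    the first grid point stays below A.\<close>
  obtain h where h: "0 < h" "h < r / 2" "\<And>j::nat. isCont (cdf \<rho>) (A - r / 2 + h + real j * (r / 2))"
    using \<rho>.continuity_grid_exists[of "r / 2" "A - r / 2"] \<open>0 < r\<close> by auto
  define g where "g j = (A - r / 2 + h) + real j * (r / 2)" for j :: nat
  obtain m :: nat where "(Z - (A - r / 2 + h)) / (r / 2) \<le> real m" using real_arch_simple by blast
  then have "Z \<le> g m" using \<open>0 < r\<close> by (simp add: g_def field_simps)
  have low: "cdf \<rho> (g 0) < r / 2" using h by (intro A) (simp add: g_def)
  have high: "1 - r / 2 < cdf \<rho> (g m)" using \<open>Z \<le> g m\<close> by (rule Z)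
  have conv: "(\<lambda>n. cdf (\<mu> n) (g j)) \<longlonglongrightarrow> cdf \<rho> (g j)" "(\<lambda>n. cdf (\<nu> n) (g j)) \<longlonglongrightarrow> cdf \<rho> (g j)" for j
    using assms(4,5) h(3)[of j] by (auto simp: weak_conv_m_def weak_conv_def g_def)
  have "\<forall>\<^sub>F n in sequentially. \<bar>cdf (\<mu> n) (g j) - cdf \<rho> (g j)\<bar> < r / 2 \<and> \<bar>cdf (\<nu> n) (g j) - cdf \<rho> (g j)\<bar> < r / 2" for j
    using tendstoD[OF conv(1)[of j], of "r / 2"] tendstoD[OF conv(2)[of j], of "r / 2"] \<open>0 < r\<close>
    by (simp add: dist_real_def eventually_conj_iff)
  then have "\<forall>\<^sub>F n in sequentially. \<forall>j\<in>{..m}.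
      \<bar>cdf (\<mu> n) (g j) - cdf \<rho> (g j)\<bar> < r / 2 \<and> \<bar>cdf (\<nu> n) (g j) - cdf \<rho> (g j)\<bar> < r / 2"
    by (intro eventually_ball_finite) auto
  then obtain n0 where n0: "\<And>n j. n0 \<le> n \<Longrightarrow> j \<le> m \<Longrightarrow>
      \<bar>cdf (\<mu> n) (g j) - cdf \<rho> (g j)\<bar> < r / 2 \<and> \<bar>cdf (\<nu> n) (g j) - cdf \<rho> (g j)\<bar> < r / 2"
    by (auto simp: eventually_sequentially)
  have "norm (levy_dist (\<mu> n) (\<nu> n) - 0) < e" if "n0 \<le> n" for n
  proof -
    have near_\<mu>: "\<bar>cdf (\<mu> n) (g j) - cdf \<rho> (g j)\<bar> < r / 2" and near_\<nu>: "\<bar>cdf (\<nu> n) (g j) - cdf \<rho> (g j)\<bar> < r / 2"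
      if "j \<le> m" for j using n0[OF \<open>n0 \<le> n\<close> that] by auto
    note grid = \<open>0 < r\<close> g_def low high
    have 1: "cdf (\<mu> n) (x - r) - r \<le> cdf (\<nu> n) x" for x
      by (rule cdf_shift_le_on_grid[OF \<mu> \<nu> grid near_\<mu> near_\<nu>])
    \<comment> \<open>The second inequality is the grid estimate with the laws exchanged, read at x
      + r.\<close>
    have "cdf (\<nu> n) (x + r - r) - r \<le> cdf (\<mu> n) (x + r)" for x
      by (rule cdf_shift_le_on_grid[OF \<nu> \<mu> grid near_\<nu> near_\<mu>])
    then have 2: "cdf (\<nu> n) x \<le> cdf (\<mu> n) (x + r) + r" for x
      using add_diff_cancel[of x r] by (metis diff_le_eq)
    from levy_dist_le[OF \<open>0 < r\<close> 1 2] show ?thesis using \<open>0 < e\<close> by (simp add: r_def)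
  qed
  then show "\<exists>n0. \<forall>n\<ge>n0. norm (levy_dist (\<mu> n) (\<nu> n) - 0) < e" by blast
qed

section \<open>Centered Gaussian laws, possibly degenerate, as moving targets for the Levy
  distance\<close>

lemma centered_gaussian_eq_distr:
  assumes "0 < v"
  shows "centered_gaussian v = distr std_normal_distribution borel (\<lambda>x. sqrt v * x)"
proof -
  interpret std: real_distribution std_normal_distribution by (rule real_dist_normal_dist)
  have "distributed std_normal_distribution lborel (\<lambda>x. x) (normal_density 0 1)"
    unfolding distributed_def by (auto simp: distr_id2)
  from std.normal_density_affine[OF this, of "sqrt v" 0] assms
  have "distr std_normal_distribution lborel (\<lambda>x. sqrt v * x) = density lborel (normal_density 0 (sqrt v))"
    by (simp add: distributed_def)
  moreover have "distr std_normal_distribution lborel (\<lambda>x. sqrt v * x) = distr std_normal_distribution borel (\<lambda>x. sqrt v * x)"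
    by (rule distr_cong) auto
  ultimately show ?thesis using assms by (simp add: centered_gaussian_def)
qed

lemma centered_gaussian_char:
  assumes "0 \<le> v"
  shows "real_distribution (centered_gaussian v)"
    "char (centered_gaussian v) t = complex_of_real (exp (- (v * t\<^sup>2 / 2)))"
proof -
  interpret std: real_distribution std_normal_distribution by (rule real_dist_normal_dist)
  have "real_distribution (centered_gaussian v) \<and>
    char (centered_gaussian v) t = complex_of_real (exp (- (v * t\<^sup>2 / 2)))"
  proof (cases "v = 0")
    case True
    then show ?thesis
      by (auto simp: centered_gaussian_def real_distribution_def real_distribution_axioms_def
          prob_space_return char_def integral_return)
  next
    case False
    then have v: "0 < v" using assms by simp
    have rd: "real_distribution (distr std_normal_distribution borel (\<lambda>x. sqrt v * x))"
      by (rule std.real_distribution_distr) simp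
    have "char (distr std_normal_distribution borel (\<lambda>x. sqrt v * x)) t = char std_normal_distribution (sqrt v * t)"
      unfolding char_def by (subst integral_distr) (simp_all add: mult_ac)
    also have "\<dots> = complex_of_real (exp (- ((sqrt v * t)\<^sup>2 / 2)))"
      by (simp add: char_std_normal_distribution)
    also have "(sqrt v * t)\<^sup>2 = v * t\<^sup>2" using v by (simp add: power_mult_distrib)
    finally show ?thesis using rd centered_gaussian_eq_distr[OF v] by simp
  qed
  then show "real_distribution (centered_gaussian v)"
    "char (centered_gaussian v) t = complex_of_real (exp (- (v * t\<^sup>2 / 2)))" by auto
qed

text \<open>Neither sequence of laws need converge. Among indices that keep the distance above e,
  boundedness gives a subsequence with v tending to some l; both sequences then share the weak limit
  N(0, l), where l = 0 is allowed.\<close>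

lemma levy_dist_centered_gaussian_tendsto_0:
  fixes v :: "nat \<Rightarrow> real"
  assumes \<mu>: "\<And>n. real_distribution (\<mu> n)" and v: "\<And>n. 0 \<le> v n" "\<And>n. v n \<le> C"
    and char: "\<And>t. (\<lambda>n. char (\<mu> n) t - complex_of_real (exp (- (v n * t\<^sup>2 / 2)))) \<longlonglongrightarrow> 0"
  shows "(\<lambda>n. levy_dist (\<mu> n) (centered_gaussian (v n))) \<longlonglongrightarrow> 0"
proof (rule ccontr)
  let ?L = "\<lambda>n. levy_dist (\<mu> n) (centered_gaussian (v n))"
  assume "\<not> ?L \<longlonglongrightarrow> 0"
  then obtain e where "0 < e" and "\<not> (\<exists>N. \<forall>n\<ge>N. norm (?L n - 0) < e)"
    by (auto simp: LIMSEQ_iff)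
  then have "infinite {n. e \<le> norm (?L n)}"
    unfolding infinite_nat_iff_unbounded_le by (auto simp: not_less)
  then obtain s :: "nat \<Rightarrow> nat" where s: "strict_mono s" "\<And>k. e \<le> norm (?L (s k))"
    using infinite_enumerate by (metis (mono_tags, lifting) mem_Collect_eq)
  have "seq_compact {0..C}" by (intro compact_imp_seq_compact) simp
  moreover have "\<forall>k. v (s k) \<in> {0..C}" using v by simp
  ultimately obtain l q where l: "l \<in> {0..C}" and q: "strict_mono q" "((\<lambda>k. v (s k)) \<circ> q) \<longlonglongrightarrow> l"
    by (rule seq_compactE)
  define u where "u = s \<circ> q"
  have u: "strict_mono u" unfolding u_def using s(1) q(1) by (rule strict_mono_o)
  have vl: "(\<lambda>k. v (u k)) \<longlonglongrightarrow> l" using q(2) by (simp add: u_def o_def)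
  have gauss: "(\<lambda>k. complex_of_real (exp (- (v (u k) * t\<^sup>2 / 2)))) \<longlonglongrightarrow> char (centered_gaussian l) t" for t
    using l by (simp only: centered_gaussian_char atLeastAtMost_iff) (intro tendsto_intros vl, simp)
  have "(\<lambda>k. char (\<mu> (u k)) t) \<longlonglongrightarrow> char (centered_gaussian l) t" for t
  proof -
    have "(\<lambda>k. char (\<mu> (u k)) t - complex_of_real (exp (- (v (u k) * t\<^sup>2 / 2)))) \<longlonglongrightarrow> 0"
      using LIMSEQ_subseq_LIMSEQ[OF char[of t] u] by (simp add: o_def)
    from tendsto_add[OF this gauss[of t]] show ?thesis by simp
  qed
  moreover have "(\<lambda>k. char (centered_gaussian (v (u k))) t) \<longlonglongrightarrow> char (centered_gaussian l) t" for t
    using gauss[of t] by (simp only: centered_gaussian_char(2)[OF v(1)])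
  moreover have G: "real_distribution (centered_gaussian l)"
    using l by (intro centered_gaussian_char) simp
  ultimately have "weak_conv_m (\<lambda>k. \<mu> (u k)) (centered_gaussian l)"
    "weak_conv_m (\<lambda>k. centered_gaussian (v (u k))) (centered_gaussian l)"
    by (auto intro!: levy_continuity \<mu> centered_gaussian_char v)
  then have "(\<lambda>k. ?L (u k)) \<longlonglongrightarrow> 0"
    by (rule levy_dist_tendsto_0_of_weak_conv[OF \<mu> centered_gaussian_char(1)[OF v(1)] G])
  from tendstoD[OF this \<open>0 < e\<close>] have "\<forall>\<^sub>F k in sequentially. norm (?L (u k)) < e"
    by (simp add: dist_real_def)
  then obtain k where "norm (?L (u k)) < e" by (auto simp: eventually_sequentially)
  with s(2)[of "q k"] show False by (simp add: u_def)
qed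

subsection \<open>Characteristic functions of sums over arbitrary finite sets\<close>

lemma norm_iexp_diff_le: "cmod (iexp a - iexp b) \<le> \<bar>a - b\<bar>"
proof -
  have "iexp a = iexp b * iexp (a - b)" by (subst iexp_add[symmetric]) simp
  then have "iexp a - iexp b = iexp b * (iexp (a - b) - 1)" by (simp only: right_diff_distrib mult_1_right)
  then have "cmod (iexp a - iexp b) = cmod (iexp (a - b) - 1)"
    by (simp only: norm_mult norm_exp_i_times mult_1_left)
  then show ?thesis using norm_iexp_diff_1_le[of "a - b"] by simp
qed

lemma abs_exp_minus_diff_le:
  fixes a b :: real
  assumes "0 \<le> a" "0 \<le> b"
  shows "\<bar>exp (- a) - exp (- b)\<bar> \<le> \<bar>a - b\<bar>"
proof -
  have *: "exp (- x) - exp (- y) \<le> y - x" if "0 \<le> x" "x \<le> y" for x y :: real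
  proof -
    have "1 - exp (x - y) \<le> y - x" using exp_ge_add_one_self[of "x - y"] by linarith
    moreover have "0 \<le> 1 - exp (x - y)" using that by simp
    moreover have "exp (- x) - exp (- y) = exp (- x) * (1 - exp (x - y))"
      by (simp add: right_diff_distrib flip: exp_add)
    moreover have "exp (- x) \<le> 1" using that by simp
    ultimately show ?thesis by (smt (verit) mult_left_le_one_le exp_ge_zero)
  qed
  show ?thesis
  proof (cases "a \<le> b")
    case True
    then show ?thesis using *[of a b] assms by simp
  next
    case False
    then show ?thesis using *[of b a] assms by simp
  qed
qed

text \<open>Both terms are L2-stable: \<open>iexp\<close> is 1-Lipschitz, and the variances differ
  by at most 2 * D * \<eta> + \<eta>^2, which passes to the Gaussian factor since exp(-x) is
  1-Lipschitz for x \<ge> 0.\<close>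

lemma (in prob_space) char_minus_gaussian_perturbation:
  fixes S S' :: "'a \<Rightarrow> real" and t D \<eta> :: real
  assumes S: "square_integrable M S" and S': "square_integrable M S'"
    and D: "l2norm M S \<le> D" and \<eta>: "l2norm M (\<lambda>x. S x - S' x) \<le> \<eta>"
  shows "cmod (expectation (\<lambda>x. iexp (t * S x)) - complex_of_real (exp (- (expectation (\<lambda>x. (S x)\<^sup>2) * t\<^sup>2 / 2))))
    \<le> cmod (expectation (\<lambda>x. iexp (t * S' x)) - complex_of_real (exp (- (expectation (\<lambda>x. (S' x)\<^sup>2) * t\<^sup>2 / 2))))
      + (\<bar>t\<bar> * \<eta> + (2 * D * \<eta> + \<eta>\<^sup>2) * t\<^sup>2 / 2)"
proof -
  note [measurable] = square_integrable_measurable[OF S] square_integrable_measurable[OF S']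
  let ?d = "\<lambda>x. S x - S' x"
  have d: "square_integrable M ?d" by (rule square_integrable_diff[OF S S'])
  have "0 \<le> \<eta>" "0 \<le> D" using D \<eta> l2norm_nonneg order.trans by blast+
  let ?v = "expectation (\<lambda>x. (S x)\<^sup>2)" and ?v' = "expectation (\<lambda>x. (S' x)\<^sup>2)"
  have i: "integrable M (\<lambda>x. iexp (t * S x))" "integrable M (\<lambda>x. iexp (t * S' x))"
    by (rule integrable_bounded_complex[where B = 1]; simp)+
  have eq: "expectation (\<lambda>x. iexp (t * S x)) - expectation (\<lambda>x. iexp (t * S' x))
      = expectation (\<lambda>x. iexp (t * S x) - iexp (t * S' x))"
    by (rule Bochner_Integration.integral_diff[OF i, symmetric])
  have "cmod (expectation (\<lambda>x. iexp (t * S x) - iexp (t * S' x))) \<le>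
      expectation (\<lambda>x. cmod (iexp (t * S x) - iexp (t * S' x)))"
    by (rule integral_norm_bound)
  moreover have "expectation (\<lambda>x. cmod (iexp (t * S x) - iexp (t * S' x))) \<le> expectation (\<lambda>x. \<bar>t\<bar> * \<bar>?d x\<bar>)"
  proof (rule integral_mono)
    show "integrable M (\<lambda>x. cmod (iexp (t * S x) - iexp (t * S' x)))"
      by (intro integrable_norm Bochner_Integration.integrable_diff i)
    show "integrable M (\<lambda>x. \<bar>t\<bar> * \<bar>?d x\<bar>)"
      by (intro integrable_mult_right integrable_abs square_integrable_integrable[OF d])
    show "cmod (iexp (t * S x) - iexp (t * S' x)) \<le> \<bar>t\<bar> * \<bar>?d x\<bar>" for x
      using norm_iexp_diff_le[of "t * S x" "t * S' x"] by (simp only: abs_mult[symmetric] right_diff_distrib)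
  qed
  moreover have "expectation (\<lambda>x. \<bar>t\<bar> * \<bar>?d x\<bar>) \<le> \<bar>t\<bar> * \<eta>"
    using expectation_abs_le_l2norm[OF d] \<eta> by (simp add: mult_left_mono)
  ultimately have 1: "cmod (expectation (\<lambda>x. iexp (t * S x)) - expectation (\<lambda>x. iexp (t * S' x))) \<le> \<bar>t\<bar> * \<eta>"
    unfolding eq by linarith
  \<comment> \<open>Expanding around S requires the bound D on S only.\<close>
  have "(S' x)\<^sup>2 = (S x)\<^sup>2 - 2 * (S x * ?d x) + (?d x)\<^sup>2" for x
    by (simp add: power2_eq_square algebra_simps)
  then have "?v' = expectation (\<lambda>x. (S x)\<^sup>2 - 2 * (S x * ?d x) + (?d x)\<^sup>2)" by simp
  also have "\<dots> = ?v - 2 * expectation (\<lambda>x. S x * ?d x) + (l2norm M ?d)\<^sup>2"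
    unfolding l2norm_power2
    using square_integrable_power2[OF S] square_integrable_power2[OF d] square_integrable_mult[OF S d]
    by (subst Bochner_Integration.integral_add; (subst Bochner_Integration.integral_diff)?) auto
  finally have "\<bar>?v - ?v'\<bar> \<le> 2 * \<bar>expectation (\<lambda>x. S x * ?d x)\<bar> + (l2norm M ?d)\<^sup>2"
    by (smt (verit) zero_le_power2)
  also have "\<bar>expectation (\<lambda>x. S x * ?d x)\<bar> \<le> D * \<eta>"
    using Cauchy_Schwarz_l2norm[OF S d] mult_mono[OF D \<eta> \<open>0 \<le> D\<close> l2norm_nonneg] by linarith
  also have "(l2norm M ?d)\<^sup>2 \<le> \<eta>\<^sup>2" using \<eta> by (intro power_mono) auto
  finally have v: "\<bar>?v - ?v'\<bar> \<le> 2 * D * \<eta> + \<eta>\<^sup>2" by simp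
  have "\<bar>exp (- (?v * t\<^sup>2 / 2)) - exp (- (?v' * t\<^sup>2 / 2))\<bar> \<le> \<bar>?v * t\<^sup>2 / 2 - ?v' * t\<^sup>2 / 2\<bar>"
    by (rule abs_exp_minus_diff_le) simp_all
  also have "\<dots> = \<bar>?v - ?v'\<bar> * t\<^sup>2 / 2"
    by (simp add: abs_mult left_diff_distrib[symmetric] diff_divide_distrib[symmetric])
  also have "\<dots> \<le> (2 * D * \<eta> + \<eta>\<^sup>2) * t\<^sup>2 / 2"
    using v by (intro divide_right_mono mult_right_mono) auto
  finally have 2: "cmod (complex_of_real (exp (- (?v * t\<^sup>2 / 2))) - complex_of_real (exp (- (?v' * t\<^sup>2 / 2))))
      \<le> (2 * D * \<eta> + \<eta>\<^sup>2) * t\<^sup>2 / 2"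
    by (simp only: of_real_diff[symmetric] norm_of_real)
  have tri: "cmod (a - b) \<le> cmod (a' - b') + (p + q)" if "cmod (a - a') \<le> p" "cmod (b - b') \<le> q" for a a' b b' p q
  proof -
    have "a - b = (a' - b') + ((a - a') - (b - b'))" by simp
    then have "cmod (a - b) \<le> cmod (a' - b') + cmod ((a - a') - (b - b'))" by (metis norm_triangle_ineq)
    moreover have "cmod ((a - a') - (b - b')) \<le> cmod (a - a') + cmod (b - b')" by (rule norm_triangle_ineq4)
    ultimately show ?thesis using that by linarith
  qed
  show ?thesis by (rule tri[OF 1 2])
qed

context iid_factor
begin

text \<open>For \<Gamma> of cardinality 0, thus also for infinite \<Gamma>, division by 0 makes the
  value 0.\<close>

definition normalized_sum :: "(('i :: ab_group_add \<Rightarrow> 'b) \<Rightarrow> real) \<Rightarrow> 'i set \<Rightarrow> ('i \<Rightarrow> 'b) \<Rightarrow> real" where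
  "normalized_sum V \<Gamma> x = (\<Sum>i\<in>\<Gamma>. V (shift i x) - (LINT x|iid_measure N. V x)) / sqrt (card \<Gamma>)"

lemma normalized_sum_measurable:
  fixes V :: "('i :: ab_group_add \<Rightarrow> 'b) \<Rightarrow> real"
  assumes [measurable]: "V \<in> borel_measurable (iid_measure N)"
  shows "normalized_sum V \<Gamma> \<in> borel_measurable (iid_measure N)"
  unfolding normalized_sum_def[abs_def] by measurable

lemma square_integrable_normalized_sum:
  fixes V :: "('i :: ab_group_add \<Rightarrow> 'b) \<Rightarrow> real"
  assumes V: "square_integrable (iid_measure N) V"
  shows "square_integrable (iid_measure N) (normalized_sum V \<Gamma>)"
proof -
  interpret P: prob_space "iid_measure N :: ('i \<Rightarrow> 'b) measure" by (rule prob_space_iid_measure[OF N])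
  have "square_integrable (iid_measure N) (\<lambda>x. \<Sum>i\<in>\<Gamma>. V (shift i x) - (LINT x|iid_measure N. V x))"
    by (rule square_integrable_sum) (rule square_integrable_diff[OF square_integrable_shift[OF V] P.square_integrable_const])
  from square_integrable_cmult[OF this, of "1 / sqrt (card \<Gamma>)"]
  show ?thesis by (simp add: normalized_sum_def[abs_def])
qed

lemma normalized_sum_diff:
  fixes V W :: "('i :: ab_group_add \<Rightarrow> 'b) \<Rightarrow> real"
  assumes V: "square_integrable (iid_measure N) V" and W: "square_integrable (iid_measure N) W"
  shows "normalized_sum V \<Gamma> x - normalized_sum W \<Gamma> x = normalized_sum (\<lambda>x. V x - W x) \<Gamma> x"
proof -
  interpret P: prob_space "iid_measure N :: ('i \<Rightarrow> 'b) measure" by (rule prob_space_iid_measure[OF N])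
  have "(LINT x|iid_measure N. V x - W x) = (LINT x|iid_measure N. V x) - (LINT x|iid_measure N. W x)"
    by (rule Bochner_Integration.integral_diff[OF P.square_integrable_integrable[OF V] P.square_integrable_integrable[OF W]])
  then show ?thesis
    by (simp only: normalized_sum_def diff_divide_distrib[symmetric] sum_subtractf[symmetric])
      (simp add: algebra_simps)
qed

lemma l2norm_normalized_sum_le:
  fixes V :: "('i :: ab_group_add \<Rightarrow> 'b) \<Rightarrow> real"
  assumes V: "square_integrable (iid_measure N) V"
    and D: "\<And>J. finite J \<Longrightarrow> (\<Sum>j\<in>J. influence N V j) \<le> D"
  shows "l2norm (iid_measure N) (normalized_sum V \<Gamma>) \<le> D"
proof -
  have "0 \<le> D" using D[of "{}"] by simp
  show ?thesis
  proof (cases "card \<Gamma> = 0")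
    case True
    then show ?thesis using \<open>0 \<le> D\<close> by (simp add: l2norm_def normalized_sum_def)
  next
    case False
    then have fin: "finite \<Gamma>" and pos: "0 < real (card \<Gamma>)" using card.infinite by fastforce+
    have "(l2norm (iid_measure N) (normalized_sum V \<Gamma>))\<^sup>2 =
      (LINT x|iid_measure N. (\<Sum>i\<in>\<Gamma>. V (shift i x) - (LINT x|iid_measure N. V x))\<^sup>2) / real (card \<Gamma>)"
      by (simp add: l2norm_power2 normalized_sum_def power_divide)
    also have "\<dots> \<le> (real (card \<Gamma>) * D\<^sup>2) / real (card \<Gamma>)"
      by (intro divide_right_mono variance_sum_shift_le[OF V fin D]) auto
    also have "\<dots> = D\<^sup>2" using pos by simp
    finally show ?thesis by (rule power2_le_imp_le) fact
  qed
qed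

text \<open>V is approximated once at level \<eta>, so K depends on V, t and \<eta> but not on
  \<Gamma>. The other term is the cost of the replacement, uniform in \<Gamma> by the variance
  bound.\<close>

lemma normalized_sum_char_estimate:
  fixes V :: "('i :: ab_group_add \<Rightarrow> 'b) \<Rightarrow> real" and t :: real
  assumes V: "square_integrable (iid_measure N) V"
    and D: "\<And>J. finite J \<Longrightarrow> (\<Sum>j\<in>J. influence N V j) \<le> D" and "0 < \<eta>"
  shows "\<exists>K. \<forall>\<Gamma>. 0 < card \<Gamma> \<longrightarrow>
    cmod ((LINT x|iid_measure N. iexp (t * normalized_sum V \<Gamma> x)) -
      complex_of_real (exp (- ((LINT x|iid_measure N. (normalized_sum V \<Gamma> x)\<^sup>2) * t\<^sup>2 / 2))))
    \<le> K / sqrt (card \<Gamma>) + (\<bar>t\<bar> * \<eta> + (2 * D * \<eta> + \<eta>\<^sup>2) * t\<^sup>2 / 2)"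
proof -
  interpret P: prob_space "iid_measure N :: ('i \<Rightarrow> 'b) measure" by (rule prob_space_iid_measure[OF N])
  from bounded_finite_range_approximation[OF V D \<open>0 < \<eta>\<close>] obtain h c B where
    "0 \<le> c" "finite B" and hm: "h \<in> borel_measurable (iid_measure N)" and hb: "\<And>x. \<bar>h x\<bar> \<le> c" and
    dep: "\<forall>x y. (\<forall>i\<in>B. x i = y i) \<longrightarrow> h x = h y" and
    small: "\<And>J. finite J \<Longrightarrow> (\<Sum>j\<in>J. influence N (\<lambda>x. V x - h x) j) \<le> \<eta>" by blast
  have dep': "depends_on B h" using dep by (simp add: depends_on_def)
  have h: "square_integrable (iid_measure N) h" by (rule P.square_integrable_bounded[OF hm hb])
  define d d' where "d = card (differences B)"
    and "d' = card (differences ((\<lambda>(b, a). b + a) ` (B \<times> insert 0 (differences B))))"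
  define K where "K = \<bar>t\<bar> * (\<bar>t\<bar> * (8 * c\<^sup>2 * d * sqrt d') + 4 * c ^ 3 * (real d)\<^sup>2 * t\<^sup>2)"
  show ?thesis
  proof (intro exI[of _ K] allI impI)
    fix \<Gamma> :: "'i set" assume "0 < card \<Gamma>"
    then have \<Gamma>: "finite \<Gamma>" "\<Gamma> \<noteq> {}" using card_gt_0_iff by blast+
    have "cmod ((LINT x|iid_measure N. iexp (t * normalized_sum h \<Gamma> x)) -
      complex_of_real (exp (- ((LINT x|iid_measure N. (normalized_sum h \<Gamma> x)\<^sup>2) * t\<^sup>2 / 2)))) \<le> K / sqrt (card \<Gamma>)"
      using finite_range_char_estimate[OF hm hb \<open>finite B\<close> dep' \<Gamma>, of t]
      by (simp only: normalized_sum_def K_def d_def d'_def)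
    moreover have "l2norm (iid_measure N) (\<lambda>x. normalized_sum V \<Gamma> x - normalized_sum h \<Gamma> x) \<le> \<eta>"
      unfolding normalized_sum_diff[OF V h]
      by (rule l2norm_normalized_sum_le[OF square_integrable_diff[OF V h] small])
    note P.char_minus_gaussian_perturbation[OF square_integrable_normalized_sum[OF V]
        square_integrable_normalized_sum[OF h] l2norm_normalized_sum_le[OF V D] this, of t]
    ultimately show "cmod ((LINT x|iid_measure N. iexp (t * normalized_sum V \<Gamma> x)) -
        complex_of_real (exp (- ((LINT x|iid_measure N. (normalized_sum V \<Gamma> x)\<^sup>2) * t\<^sup>2 / 2))))
      \<le> K / sqrt (card \<Gamma>) + (\<bar>t\<bar> * \<eta> + (2 * D * \<eta> + \<eta>\<^sup>2) * t\<^sup>2 / 2)"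
      by linarith
  qed
qed

lemma normalized_sum_char_tendsto:
  fixes V :: "('i :: ab_group_add \<Rightarrow> 'b) \<Rightarrow> real" and t :: real
  assumes V: "square_integrable (iid_measure N) V"
    and D: "\<And>J. finite J \<Longrightarrow> (\<Sum>j\<in>J. influence N V j) \<le> D"
    and card: "filterlim (\<lambda>n. card (\<Gamma> n)) at_top sequentially"
  shows "(\<lambda>n. (LINT x|iid_measure N. iexp (t * normalized_sum V (\<Gamma> n) x)) -
      complex_of_real (exp (- ((LINT x|iid_measure N. (normalized_sum V (\<Gamma> n) x)\<^sup>2) * t\<^sup>2 / 2)))) \<longlonglongrightarrow> 0"
proof (rule tendstoI)
  fix e :: real assume "0 < e"
  have "0 \<le> D" using D[of "{}"] by simp
  \<comment> \<open>For \<eta> \<le> 1 the replacement cost is at most \<eta> * p; the final 1 keeps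
    p positive.\<close>
  define p where "p = \<bar>t\<bar> + (D + 1) * t\<^sup>2 + 1"
  have "0 < p" using \<open>0 \<le> D\<close> by (simp add: p_def add_nonneg_pos)
  define \<eta> where "\<eta> = min 1 (e / (2 * p))"
  have "0 < \<eta>" "\<eta> \<le> 1" "\<eta> \<le> e / (2 * p)" using \<open>0 < e\<close> \<open>0 < p\<close> by (auto simp: \<eta>_def)
  have "\<bar>t\<bar> * \<eta> + (2 * D * \<eta> + \<eta>\<^sup>2) * t\<^sup>2 / 2 \<le> \<eta> * p"
  proof -
    have "\<eta>\<^sup>2 \<le> \<eta>" using \<open>0 < \<eta>\<close> \<open>\<eta> \<le> 1\<close> by (simp add: power2_eq_square mult_left_le)
    then have "(2 * D * \<eta> + \<eta>\<^sup>2) * t\<^sup>2 \<le> (2 * D * \<eta> + \<eta>) * t\<^sup>2" by (intro mult_right_mono) auto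
    moreover have "(2 * D * \<eta> + \<eta>) * t\<^sup>2 / 2 + \<eta> * t\<^sup>2 / 2 = \<eta> * ((D + 1) * t\<^sup>2)" by (simp add: field_simps)
    moreover have "0 \<le> \<eta> * t\<^sup>2 / 2" using \<open>0 < \<eta>\<close> by simp
    moreover have "\<eta> * p = \<bar>t\<bar> * \<eta> + \<eta> * ((D + 1) * t\<^sup>2) + \<eta>" by (simp add: p_def algebra_simps)
    ultimately show ?thesis using \<open>0 < \<eta>\<close> by linarith
  qed
  also have "\<dots> \<le> e / 2"
    using mult_right_mono[OF \<open>\<eta> \<le> e / (2 * p)\<close>, of p] \<open>0 < p\<close> by simp
  finally have le: "\<bar>t\<bar> * \<eta> + (2 * D * \<eta> + \<eta>\<^sup>2) * t\<^sup>2 / 2 \<le> e / 2" .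
  obtain K where K: "\<And>\<Gamma>. 0 < card \<Gamma> \<Longrightarrow>
    cmod ((LINT x|iid_measure N. iexp (t * normalized_sum V \<Gamma> x)) -
      complex_of_real (exp (- ((LINT x|iid_measure N. (normalized_sum V \<Gamma> x)\<^sup>2) * t\<^sup>2 / 2))))
    \<le> K / sqrt (card \<Gamma>) + (\<bar>t\<bar> * \<eta> + (2 * D * \<eta> + \<eta>\<^sup>2) * t\<^sup>2 / 2)"
    using normalized_sum_char_estimate[OF V D \<open>0 < \<eta>\<close>, of t] by blast
  have "filterlim (\<lambda>n. sqrt (real (card (\<Gamma> n)))) at_top sequentially"
    by (rule filterlim_compose[OF sqrt_at_top filterlim_compose[OF filterlim_real_sequentially card]])
  then have "(\<lambda>n. K / sqrt (card (\<Gamma> n))) \<longlonglongrightarrow> 0"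
    by (rule tendsto_divide_0[OF tendsto_const filterlim_at_top_imp_at_infinity])
  from order_tendstoD(2)[OF this, of "e / 2"] \<open>0 < e\<close>
  have "\<forall>\<^sub>F n in sequentially. K / sqrt (card (\<Gamma> n)) < e / 2" by simp
  moreover have "\<forall>\<^sub>F n in sequentially. 0 < card (\<Gamma> n)"
    by (rule eventually_compose_filterlim[OF eventually_gt_at_top card])
  ultimately show "\<forall>\<^sub>F n in sequentially. dist ((LINT x|iid_measure N. iexp (t * normalized_sum V (\<Gamma> n) x)) -
      complex_of_real (exp (- ((LINT x|iid_measure N. (normalized_sum V (\<Gamma> n) x)\<^sup>2) * t\<^sup>2 / 2)))) 0 < e"
  proof eventually_elim
    case (elim n)
    then show ?case unfolding dist_norm diff_zero using K[of "\<Gamma> n"] le by linarith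
  qed
qed

theorem normalized_sum_clt:
  fixes V :: "('i :: ab_group_add \<Rightarrow> 'b) \<Rightarrow> real"
  assumes V: "square_integrable (iid_measure N) V"
    and D: "\<And>J. finite J \<Longrightarrow> (\<Sum>j\<in>J. influence N V j) \<le> D"
    and card: "filterlim (\<lambda>n. card (\<Gamma> n)) at_top sequentially"
  shows "(\<lambda>n. levy_dist (distr (iid_measure N) borel (normalized_sum V (\<Gamma> n)))
      (centered_gaussian (LINT x|iid_measure N. (normalized_sum V (\<Gamma> n) x)\<^sup>2))) \<longlonglongrightarrow> 0"
proof (rule levy_dist_centered_gaussian_tendsto_0)
  interpret P: prob_space "iid_measure N :: ('i \<Rightarrow> 'b) measure" by (rule prob_space_iid_measure[OF N])
  have m: "normalized_sum V (\<Gamma> n) \<in> borel_measurable (iid_measure N)" for n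
    by (rule normalized_sum_measurable[OF square_integrable_measurable[OF V]])
  show "real_distribution (distr (iid_measure N) borel (normalized_sum V (\<Gamma> n)))" for n
    by (rule P.real_distribution_distr[OF m])
  show "0 \<le> (LINT x|iid_measure N. (normalized_sum V (\<Gamma> n) x)\<^sup>2)" for n by simp
  \<comment> \<open>This bound, uniform in n, is the compactness needed to extract convergent
    variances.\<close>
  show "(LINT x|iid_measure N. (normalized_sum V (\<Gamma> n) x)\<^sup>2) \<le> D\<^sup>2" for n
    using power_mono[OF l2norm_normalized_sum_le[OF V D, of "\<Gamma> n"], of 2] by (simp add: l2norm_power2)
  have "char (distr (iid_measure N) borel (normalized_sum V (\<Gamma> n))) t =
      (LINT x|iid_measure N. iexp (t * normalized_sum V (\<Gamma> n) x))" for n t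
    unfolding char_def by (rule integral_distr[OF m]) measurable
  then show "(\<lambda>n. char (distr (iid_measure N) borel (normalized_sum V (\<Gamma> n))) t -
      complex_of_real (exp (- ((LINT x|iid_measure N. (normalized_sum V (\<Gamma> n) x)\<^sup>2) * t\<^sup>2 / 2)))) \<longlonglongrightarrow> 0" for t
    using normalized_sum_char_tendsto[OF V D card, of t] by simp
qed

end

subsection \<open>\<open>L\<^sup>4\<close> norms and products\<close>

text \<open>The fourth root of the fourth moment, written so that L4 estimates reduce to
  Cauchy-Schwarz for squares.\<close>

definition l4norm :: "'a measure \<Rightarrow> ('a \<Rightarrow> real) \<Rightarrow> real" where
  "l4norm M f = sqrt (l2norm M (\<lambda>x. (f x)\<^sup>2))"

lemma l4norm_nonneg[simp]: "0 \<le> l4norm M f"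
  by (simp add: l4norm_def)

lemma abs_powr_4: "\<bar>x\<bar> powr 4 = ((x::real)\<^sup>2)\<^sup>2"
  by (cases "x = 0") (simp_all add: powr_numeral flip: power_mult)

lemma abs_powr_2: "\<bar>x\<bar> powr 2 = (x::real)\<^sup>2"
  by (cases "x = 0") (simp_all add: powr_numeral)

lemma Lp_norm_2:
  assumes "square_integrable M f"
  shows "Lp_norm M 2 f = ennreal (l2norm M f)"
proof -
  have "(\<integral>\<^sup>+ \<omega>. ennreal (\<bar>f \<omega>\<bar> powr 2) \<partial>M) = ennreal (LINT x|M. (f x)\<^sup>2)"
    unfolding abs_powr_2 using square_integrable_power2[OF assms] by (intro nn_integral_eq_integral) auto
  then show ?thesis by (simp add: Lp_norm_def l2norm_def powr_half_sqrt)
qed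

text \<open>Finiteness of the extended norm yields genuine integrability of the fourth power, so the
  Bochner integral is not a default value from here on.\<close>

lemma Lp_norm_4_finite:
  assumes [measurable]: "f \<in> borel_measurable M" and "Lp_norm M 4 f < \<infinity>"
  shows "square_integrable M (\<lambda>x. (f x)\<^sup>2)" "Lp_norm M 4 f = ennreal (l4norm M f)"
proof -
  let ?I = "\<integral>\<^sup>+ \<omega>. ennreal (\<bar>f \<omega>\<bar> powr 4) \<partial>M"
  have "?I < \<infinity>" using assms(2) by (auto simp: Lp_norm_def Let_def less_top split: if_splits)
  then have "integrable M (\<lambda>x. ((f x)\<^sup>2)\<^sup>2)"
    by (intro integrableI_nonneg) (simp_all add: abs_powr_4)
  then show sq: "square_integrable M (\<lambda>x. (f x)\<^sup>2)" by (simp add: square_integrable_def)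
  have I: "?I = ennreal (LINT x|M. ((f x)\<^sup>2)\<^sup>2)"
    unfolding abs_powr_4 using square_integrable_power2[OF sq] by (intro nn_integral_eq_integral) auto
  have "0 \<le> (LINT x|M. ((f x)\<^sup>2)\<^sup>2)" by simp
  then have "(LINT x|M. ((f x)\<^sup>2)\<^sup>2) powr (1 / 4) = sqrt (sqrt (LINT x|M. ((f x)\<^sup>2)\<^sup>2))"
    by (simp add: powr_half_sqrt[symmetric] powr_powr)
  then show "Lp_norm M 4 f = ennreal (l4norm M f)"
    unfolding Lp_norm_def I l4norm_def l2norm_def Let_def by simp
qed

lemma l2norm_mult_le_l4norm:
  assumes f: "square_integrable M (\<lambda>x. (f x)\<^sup>2)" and g: "square_integrable M (\<lambda>x. (g x)\<^sup>2)"
    and [measurable]: "f \<in> borel_measurable M" "g \<in> borel_measurable M"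
  shows "square_integrable M (\<lambda>x. f x * g x)" "l2norm M (\<lambda>x. f x * g x) \<le> l4norm M f * l4norm M g"
proof -
  show sq: "square_integrable M (\<lambda>x. f x * g x)"
    using square_integrable_mult[OF f g] by (simp add: square_integrable_def power_mult_distrib)
  have "(l2norm M (\<lambda>x. f x * g x))\<^sup>2 = (LINT x|M. (f x)\<^sup>2 * (g x)\<^sup>2)"
    by (simp add: l2norm_power2 power_mult_distrib)
  also have "\<dots> \<le> l2norm M (\<lambda>x. (f x)\<^sup>2) * l2norm M (\<lambda>x. (g x)\<^sup>2)"
    using Cauchy_Schwarz_l2norm[OF f g] by simp
  also have "\<dots> = (l4norm M f * l4norm M g)\<^sup>2"
    by (simp add: l4norm_def power_mult_distrib)
  finally show "l2norm M (\<lambda>x. f x * g x) \<le> l4norm M f * l4norm M g"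
    by (rule power2_le_imp_le) simp
qed

text \<open>U V - U' V' = U (V - V') + V' (U - U'), and each product is handled by Cauchy-Schwarz.
  The factor 2 comes from 2 (a^2 + b^2) \<le> (2 (a + b))^2 for nonnegative a and b, used in place
  of Minkowski's inequality.\<close>

lemma l2norm_product_difference_le:
  fixes U V U' V' :: "'a \<Rightarrow> real"
  assumes [measurable]: "U \<in> borel_measurable M" "V \<in> borel_measurable M" "U' \<in> borel_measurable M" "V' \<in> borel_measurable M"
    and sq: "square_integrable M (\<lambda>x. (U x)\<^sup>2)" "square_integrable M (\<lambda>x. (V' x)\<^sup>2)"
      "square_integrable M (\<lambda>x. (U x - U' x)\<^sup>2)" "square_integrable M (\<lambda>x. (V x - V' x)\<^sup>2)"
  shows "square_integrable M (\<lambda>x. U x * V x - U' x * V' x)"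
    and "l2norm M (\<lambda>x. U x * V x - U' x * V' x) \<le>
      2 * (l4norm M U * l4norm M (\<lambda>x. V x - V' x) + l4norm M V' * l4norm M (\<lambda>x. U x - U' x))"
proof -
  let ?a = "\<lambda>x. U x * (V x - V' x)" and ?b = "\<lambda>x. V' x * (U x - U' x)"
  have a: "square_integrable M ?a" "l2norm M ?a \<le> l4norm M U * l4norm M (\<lambda>x. V x - V' x)"
    by (rule l2norm_mult_le_l4norm[OF sq(1) sq(4)]; measurable)+
  have b: "square_integrable M ?b" "l2norm M ?b \<le> l4norm M V' * l4norm M (\<lambda>x. U x - U' x)"
    by (rule l2norm_mult_le_l4norm[OF sq(2) sq(3)]; measurable)+
  have eq: "U x * V x - U' x * V' x = ?a x + ?b x" for x by (simp add: algebra_simps)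
  show "square_integrable M (\<lambda>x. U x * V x - U' x * V' x)"
    unfolding eq by (rule square_integrable_add[OF a(1) b(1)])
  have "(l2norm M (\<lambda>x. U x * V x - U' x * V' x))\<^sup>2 \<le> (LINT x|M. 2 * ((?a x)\<^sup>2 + (?b x)\<^sup>2))"
    unfolding l2norm_power2 eq
    by (intro integral_mono power2_add_le integrable_mult_right Bochner_Integration.integrable_add
        square_integrable_power2[OF square_integrable_add[OF a(1) b(1)]]
        square_integrable_power2[OF a(1)] square_integrable_power2[OF b(1)])
  also have "\<dots> = 2 * ((l2norm M ?a)\<^sup>2 + (l2norm M ?b)\<^sup>2)"
    using square_integrable_power2[OF a(1)] square_integrable_power2[OF b(1)] by (simp add: l2norm_power2)
  also have "\<dots> \<le> (2 * (l2norm M ?a + l2norm M ?b))\<^sup>2"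
    by (simp add: power2_eq_square algebra_simps)
  finally have "l2norm M (\<lambda>x. U x * V x - U' x * V' x) \<le> 2 * (l2norm M ?a + l2norm M ?b)"
    by (rule power2_le_imp_le) simp
  also have "\<dots> \<le> 2 * (l4norm M U * l4norm M (\<lambda>x. V x - V' x) + l4norm M V' * l4norm M (\<lambda>x. U x - U' x))"
    by (rule mult_left_mono[OF add_mono[OF a(2) b(2)]]) simp
  finally show "l2norm M (\<lambda>x. U x * V x - U' x * V' x) \<le>
      2 * (l4norm M U * l4norm M (\<lambda>x. V x - V' x) + l4norm M V' * l4norm M (\<lambda>x. U x - U' x))" .
qed

subsection \<open>Transfer from the sample space\<close>

definition has_law :: "'a measure \<Rightarrow> 'c measure \<Rightarrow> ('a \<Rightarrow> 'c) \<Rightarrow> bool" where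
  "has_law M P T \<longleftrightarrow> T \<in> measurable M P \<and> distr M P T = P"

lemma has_law_measurable: "has_law M P T \<Longrightarrow> T \<in> measurable M P"
  by (simp add: has_law_def)

lemma has_law_compose:
  assumes "has_law M Q T" "has_law Q P S"
  shows "has_law M P (\<lambda>\<omega>. S (T \<omega>))"
  using assms distr_distr[of S Q P T M] measurable_compose[of T M Q S P]
  by (simp add: has_law_def o_def)

lemma square_integrable_has_law:
  assumes "has_law M P T" and [measurable]: "F \<in> borel_measurable P"
  shows "square_integrable M (\<lambda>\<omega>. F (T \<omega>)) \<longleftrightarrow> square_integrable P F"
proof -
  have [measurable]: "T \<in> measurable M P" and d: "distr M P T = P" using assms by (auto simp: has_law_def)
  have "integrable (distr M P T) (\<lambda>x. (F x)\<^sup>2) \<longleftrightarrow> integrable M (\<lambda>\<omega>. (F (T \<omega>))\<^sup>2)"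
    by (rule integrable_distr_eq) measurable
  then show ?thesis by (simp add: square_integrable_def d)
qed

lemma integral_has_law:
  fixes F :: "'c \<Rightarrow> real"
  assumes "has_law M P T" and "F \<in> borel_measurable P"
  shows "(LINT \<omega>|M. F (T \<omega>)) = (LINT x|P. F x)"
  using integral_distr[of T M P F] assms by (simp add: has_law_def)

lemma l2norm_has_law:
  assumes "has_law M P T" and [measurable]: "F \<in> borel_measurable P"
  shows "l2norm M (\<lambda>\<omega>. F (T \<omega>)) = l2norm P F"
  using integral_has_law[OF assms(1), of "\<lambda>x. (F x)\<^sup>2"] by (simp add: l2norm_def)

context iid_factor
begin

lemma has_law_mix: "has_law (iid_measure N) (iid_measure N) (mix S)"
  unfolding has_law_def using distr_iid_measure_reindex[OF N inj_mix_index[of S]]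
  by (simp add: mix_eq_reindex[symmetric])

lemma has_law_shift: "has_law (iid_measure N) (iid_measure N) (shift i)"
  unfolding has_law_def using distr_iid_measure_reindex[OF N, of "\<lambda>s. s + i"]
  by (simp add: shift_eq_reindex[symmetric] inj_def)

end

lemma iid_measure_distr_cong:
  "sets (iid_measure (distr M N X)) = sets (Pi\<^sub>M UNIV (\<lambda>_. N))"
  unfolding iid_measure_def by (rule sets_PiM_cong) auto

lemma iid_family_law:
  fixes \<epsilon> :: "'i \<Rightarrow> 'a \<Rightarrow> 'b"
  assumes "prob_space M" "iid_family M N \<epsilon>"
  shows "distr M (Pi\<^sub>M UNIV (\<lambda>_. N)) (\<lambda>\<omega> i. \<epsilon> i \<omega>) = iid_measure (distr M N (\<epsilon> i0))"
proof -
  interpret prob_space M by fact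
  have ind: "indep_vars (\<lambda>_. N) \<epsilon> UNIV" and id: "\<And>i j. distr M N (\<epsilon> i) = distr M N (\<epsilon> j)"
    using assms(2) by (auto simp: iid_family_def)
  have rv: "random_variable N (\<epsilon> i)" for i using ind by (simp add: indep_vars_def2)
  have "distr M (Pi\<^sub>M UNIV (\<lambda>_. N)) (\<lambda>x. \<lambda>i\<in>UNIV. \<epsilon> i x) = Pi\<^sub>M UNIV (\<lambda>i. distr M N (\<epsilon> i))"
    using indep_vars_iff_distr_eq_PiM[where I = UNIV and M' = "\<lambda>_. N" and X = \<epsilon>] rv ind by simp
  also have "(\<lambda>i. distr M N (\<epsilon> i)) = (\<lambda>_. distr M N (\<epsilon> i0))" using id by blast
  finally show ?thesis by (simp add: iid_measure_def restrict_def)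
qed

text \<open>N supplies the sigma-algebra, while the factor measure is the common law of the
  innovations. Independence gives the pair of families the product law, and \<open>case_sum\<close>
  turns it into one i.i.d. family.\<close>

lemma has_law_coupled_family:
  fixes \<epsilon> \<epsilon>' :: "'i \<Rightarrow> 'a \<Rightarrow> 'b"
  assumes M: "prob_space M" and \<epsilon>: "iid_family M N \<epsilon>" and \<epsilon>': "indep_iid_copy M N \<epsilon> \<epsilon>'"
  shows "has_law M (iid_measure (distr M N (\<epsilon> i0))) (\<lambda>\<omega>. case_sum (\<lambda>j. \<epsilon> j \<omega>) (\<lambda>j. \<epsilon>' j \<omega>))"
proof -
  interpret prob_space M by (rule M)
  let ?N0 = "distr M N (\<epsilon> i0)"
  let ?\<Pi> = "Pi\<^sub>M UNIV (\<lambda>_. N) :: ('i \<Rightarrow> 'b) measure"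
  let ?x = "\<lambda>\<omega> j. \<epsilon> j \<omega>" and ?y = "\<lambda>\<omega> j. \<epsilon>' j \<omega>"
  have rv: "random_variable N (\<epsilon> i0)"
    using \<epsilon> by (simp add: iid_family_def indep_vars_def2)
  have N0: "prob_space ?N0" by (rule prob_space_distr[OF rv])
  have law_x: "distr M ?\<Pi> ?x = iid_measure ?N0" by (rule iid_family_law[OF M \<epsilon>])
  have law_y: "distr M ?\<Pi> ?y = iid_measure ?N0"
  proof -
    have "distr M ?\<Pi> ?y = iid_measure (distr M N (\<epsilon>' i0))"
      using \<epsilon>' by (intro iid_family_law[OF M]) (simp add: indep_iid_copy_def)
    also have "distr M N (\<epsilon>' i0) = ?N0" using \<epsilon>' by (simp add: indep_iid_copy_def)
    finally show ?thesis .
  qed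
  have "indep_var ?\<Pi> ?x ?\<Pi> ?y" using \<epsilon>' by (simp add: indep_iid_copy_def)
  then have m: "random_variable ?\<Pi> ?x" "random_variable ?\<Pi> ?y"
    and joint: "distr M ?\<Pi> ?x \<Otimes>\<^sub>M distr M ?\<Pi> ?y = distr M (?\<Pi> \<Otimes>\<^sub>M ?\<Pi>) (\<lambda>\<omega>. (?x \<omega>, ?y \<omega>))"
    unfolding indep_var_distribution_eq by auto
  let ?P = "iid_measure ?N0 :: ('i \<Rightarrow> 'b) measure"
  \<comment> \<open>\<open>?N0\<close> and N have the same measurable sets, so the joint law can be
    read on either product space.\<close>
  have sets: "sets ?P = sets ?\<Pi>" by (rule iid_measure_distr_cong)
  have pm: "(\<lambda>\<omega>. (?x \<omega>, ?y \<omega>)) \<in> measurable M (?P \<Otimes>\<^sub>M ?P)"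
    using measurable_Pair[OF m]
    by (simp add: measurable_cong_sets[OF refl sets_pair_measure_cong[OF sets sets]])
  have "distr M (?P \<Otimes>\<^sub>M ?P) (\<lambda>\<omega>. (?x \<omega>, ?y \<omega>)) = distr M (?\<Pi> \<Otimes>\<^sub>M ?\<Pi>) (\<lambda>\<omega>. (?x \<omega>, ?y \<omega>))"
    by (rule distr_cong) (simp_all add: sets_pair_measure_cong[OF sets sets])
  also have "\<dots> = ?P \<Otimes>\<^sub>M ?P" using joint law_x law_y by simp
  finally have pair: "has_law M (?P \<Otimes>\<^sub>M ?P) (\<lambda>\<omega>. (?x \<omega>, ?y \<omega>))"
    using pm by (simp add: has_law_def)
  have "has_law (?P \<Otimes>\<^sub>M ?P) (iid_measure ?N0) (\<lambda>(x, y). case_sum x y)"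
    unfolding has_law_def by (rule conjI[OF case_sum_measurable distr_case_sum_iid_measure[OF N0]])
  from has_law_compose[OF pair this] show ?thesis by simp
qed

section \<open>Extended-valued sums versus bounds on finite partial sums\<close>

lemma sum_le_infsum_ennreal:
  fixes f :: "'i \<Rightarrow> ennreal"
  assumes "finite J"
  shows "(\<Sum>i\<in>J. f i) \<le> (\<Sum>\<^sub>\<infinity>i\<in>UNIV. f i)"
  using assms by (subst nonneg_infsum_complete) (auto intro!: SUP_upper)

lemma sum_le_enn2real_infsum:
  fixes r :: "'i \<Rightarrow> real"
  assumes r: "\<And>i. 0 \<le> r i" and fin: "(\<Sum>\<^sub>\<infinity>i\<in>UNIV. ennreal (r i)) < \<infinity>" and "finite J"
  shows "(\<Sum>i\<in>J. r i) \<le> enn2real (\<Sum>\<^sub>\<infinity>i\<in>UNIV. ennreal (r i))"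
proof -
  have "ennreal (\<Sum>i\<in>J. r i) = (\<Sum>i\<in>J. ennreal (r i))" using r by (simp add: sum_ennreal)
  also have "\<dots> \<le> (\<Sum>\<^sub>\<infinity>i\<in>UNIV. ennreal (r i))"
    by (rule sum_le_infsum_ennreal[OF \<open>finite J\<close>])
  finally have "ennreal (\<Sum>i\<in>J. r i) \<le> ennreal (enn2real (\<Sum>\<^sub>\<infinity>i\<in>UNIV. ennreal (r i)))"
    using fin by simp
  then show ?thesis by (simp add: ennreal_le_iff)
qed

lemma infsum_ennreal_less_top:
  fixes r :: "'i \<Rightarrow> real"
  assumes r: "\<And>i. 0 \<le> r i" and D: "\<And>J. finite J \<Longrightarrow> (\<Sum>i\<in>J. r i) \<le> D"
  shows "(\<Sum>\<^sub>\<infinity>i\<in>UNIV. ennreal (r i)) < \<infinity>"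
proof -
  have "(\<Sum>\<^sub>\<infinity>i\<in>UNIV. ennreal (r i)) \<le> ennreal D"
    using D r by (intro infsum_le_finite_sums nonneg_summable_on_complete) (auto simp: sum_ennreal intro!: ennreal_leI)
  then show ?thesis using ennreal_less_top order.strict_trans1 by (metis infinity_ennreal_def)
qed

text \<open>What is specific to products is confined to the function q below: L4 bounds make it
  square integrable with summable influences, and the limit theorem for general V applies to
  it.\<close>

theorem mainTheorem3:
  fixes M :: "'a measure"
    and N :: "'b measure"
    and \<epsilon> \<epsilon>' :: "int ^ 'd \<Rightarrow> 'a \<Rightarrow> 'b"
    and g :: "(int ^ 'd \<Rightarrow> 'b) \<Rightarrow> real"
    and X X' Y Y' :: "int ^ 'd \<Rightarrow> 'a \<Rightarrow> real"
    and k :: "int ^ 'd"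
  assumes "prob_space M"
    and "iid_family M N \<epsilon>"
    and "indep_iid_copy M N \<epsilon> \<epsilon>'"
    and "g \<in> borel_measurable (Pi\<^sub>M UNIV (\<lambda>_. N))"
    and "X = bernoulli_field g \<epsilon>"
    and "X' = bernoulli_field g (couple_at_0 \<epsilon> \<epsilon>')"
    and "Lp_norm M 4 (X 0) < \<infinity>"
    and "(\<Sum>\<^sub>\<infinity>i\<in>UNIV. Lp_norm M 4 (\<lambda>\<omega>. X i \<omega> - X' i \<omega>)) < \<infinity>"
    and "Y = (\<lambda>i \<omega>. X i \<omega> * X (i + k) \<omega>)"
    and "Y' = (\<lambda>i \<omega>. X' i \<omega> * X' (i + k) \<omega>)"
  shows "(\<Sum>\<^sub>\<infinity>i\<in>UNIV. Lp_norm M 2 (\<lambda>\<omega>. Y i \<omega> - Y' i \<omega>)) < \<infinity> \<and>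
    (\<forall>(\<Gamma> :: nat \<Rightarrow> (int ^ 'd) set) (\<Xi> :: nat \<Rightarrow> (int ^ 'd) set) (T :: nat \<Rightarrow> 'a \<Rightarrow> real).
       (\<forall>n\<ge>1. finite (\<Gamma> n)) \<longrightarrow>
       (\<forall>n. \<Xi> n = {i \<in> \<Gamma> n. i + k \<in> \<Gamma> n}) \<longrightarrow>
       (\<forall>n \<omega>. T n \<omega> =
          (\<Sum>i\<in>\<Xi> n. X i \<omega> * X (i + k) \<omega> - (LINT \<omega>'|M. X 0 \<omega>' * X k \<omega>'))) \<longrightarrow>
       filterlim (\<lambda>n. card (\<Xi> n)) at_top sequentially \<longrightarrow>
       (\<lambda>n. levy_dist
              (distr M borel (\<lambda>\<omega>. T n \<omega> / sqrt (real (card (\<Xi> n)))))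
              (centered_gaussian ((LINT \<omega>|M. (T n \<omega>)\<^sup>2) / real (card (\<Xi> n)))))
         \<longlonglongrightarrow> 0)"
proof -
  define N0 where "N0 = distr M N (\<epsilon> 0)"
  interpret M: prob_space M by fact
  have "M.random_variable N (\<epsilon> 0)"
    using assms(2) by (simp add: iid_family_def M.indep_vars_def2)
  then interpret iid_factor N0 unfolding iid_factor_def N0_def by (rule M.prob_space_distr)
  let ?P = "iid_measure N0 :: (int ^ 'd \<Rightarrow> 'b) measure"
  define E where "E \<omega> = case_sum (\<lambda>j. \<epsilon> j \<omega>) (\<lambda>j. \<epsilon>' j \<omega>)" for \<omega>
  have law_E: "has_law M (iid_measure N0) E"
    unfolding E_def[abs_def] N0_def by (rule has_law_coupled_family[OF assms(1-3)])
  \<comment> \<open>The field reads the innovations at i - s, \<open>shift i\<close> reads them at s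
    + i; reflecting s reconciles the two.\<close>
  define f where "f z = g (\<lambda>s. z (- s))" for z
  have "g \<in> borel_measurable ?P"
    using assms(4) measurable_cong_sets[OF iid_measure_distr_cong[of M N "\<epsilon> 0"] refl] by (simp add: N0_def)
  then have fm[measurable]: "f \<in> borel_measurable ?P"
    unfolding f_def[abs_def] by (rule measurable_compose[OF reindex_measurable])
  define e where "e i \<omega> = shift i (mix {} (E \<omega>))" for i \<omega>
  \<comment> \<open>Coordinate 0 is resampled before shifting, as in the coupling: the site moves,
    the resampled coordinate stays.\<close>
  define e' where "e' i \<omega> = shift i (mix {0} (E \<omega>))" for i \<omega>
  have law_e: "has_law M ?P (e i)" for i
    unfolding e_def[abs_def] by (rule has_law_compose[OF has_law_compose[OF law_E has_law_mix] has_law_shift])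
  have law_e': "has_law M ?P (e' i)" for i
    unfolding e'_def[abs_def] by (rule has_law_compose[OF has_law_compose[OF law_E has_law_mix] has_law_shift])
  note [measurable] = has_law_measurable[OF law_e] has_law_measurable[OF law_e']
  have X: "X i = (\<lambda>\<omega>. f (e i \<omega>))" for i
    by (simp add: fun_eq_iff assms(5) bernoulli_field_def f_def e_def shift_def mix_def E_def)
  have X': "X' i = (\<lambda>\<omega>. f (e' i \<omega>))" for i
    unfolding fun_eq_iff assms(6) bernoulli_field_def f_def e'_def shift_def mix_def E_def couple_at_0_def
    by (auto intro!: arg_cong[where f = g])
  have Xm[measurable]: "X i \<in> borel_measurable M" "X' i \<in> borel_measurable M" for i
    unfolding X X' by measurable
  have "square_integrable M (\<lambda>\<omega>. (X 0 \<omega>)\<^sup>2)" by (rule Lp_norm_4_finite[OF Xm(1) assms(7)])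
  then have f4: "square_integrable ?P (\<lambda>z. (f z)\<^sup>2)"
    unfolding X by (subst (asm) square_integrable_has_law[OF law_e, of "\<lambda>z. (f z)\<^sup>2"]) measurable
  have X4: "square_integrable M (\<lambda>\<omega>. (X i \<omega>)\<^sup>2)" "square_integrable M (\<lambda>\<omega>. (X' i \<omega>)\<^sup>2)" for i
    unfolding X X' using f4
    by (simp_all add: square_integrable_has_law[OF law_e, of "\<lambda>z. (f z)\<^sup>2"] square_integrable_has_law[OF law_e', of "\<lambda>z. (f z)\<^sup>2"])
  define \<alpha> where "\<alpha> = l4norm ?P f"
  have X\<alpha>: "l4norm M (X i) = \<alpha>" "l4norm M (X' i) = \<alpha>" for i
    unfolding X X' l4norm_def \<alpha>_def
    by (simp_all add: l2norm_has_law[OF law_e, of "\<lambda>z. (f z)\<^sup>2"] l2norm_has_law[OF law_e', of "\<lambda>z. (f z)\<^sup>2"])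
  have "0 \<le> \<alpha>" by (simp add: \<alpha>_def)
  define r where "r i = l4norm M (\<lambda>\<omega>. X i \<omega> - X' i \<omega>)" for i
  \<comment> \<open>A single term is bounded by the finite total, which makes each difference
    integrable to the fourth power.\<close>
  have "Lp_norm M 4 (\<lambda>\<omega>. X i \<omega> - X' i \<omega>) < \<infinity>" for i
  proof -
    have "Lp_norm M 4 (\<lambda>\<omega>. X i \<omega> - X' i \<omega>) = (\<Sum>j\<in>{i}. Lp_norm M 4 (\<lambda>\<omega>. X j \<omega> - X' j \<omega>))" by simp
    also have "\<dots> \<le> (\<Sum>\<^sub>\<infinity>j\<in>UNIV. Lp_norm M 4 (\<lambda>\<omega>. X j \<omega> - X' j \<omega>))"
      by (rule sum_le_infsum_ennreal) simp
    finally show ?thesis using assms(8) by (rule order.strict_trans1)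
  qed
  note diff4 = Lp_norm_4_finite[OF _ this]
  have D4: "square_integrable M (\<lambda>\<omega>. (X i \<omega> - X' i \<omega>)\<^sup>2)" for i by (rule diff4) measurable
  have L4: "Lp_norm M 4 (\<lambda>\<omega>. X i \<omega> - X' i \<omega>) = ennreal (r i)" for i
    unfolding r_def by (rule diff4) measurable
  define A where "A = enn2real (\<Sum>\<^sub>\<infinity>i\<in>UNIV. ennreal (r i))"
  have A: "(\<Sum>i\<in>J. r i) \<le> A" if "finite J" for J
    unfolding A_def using assms(8) that
    by (intro sum_le_enn2real_infsum) (simp_all add: r_def L4[unfolded r_def])
  define b where "b i = l2norm M (\<lambda>\<omega>. Y i \<omega> - Y' i \<omega>)" for i
  have Ysq: "square_integrable M (\<lambda>\<omega>. Y i \<omega> - Y' i \<omega>)" and b_le: "b i \<le> 2 * (\<alpha> * r (i + k) + \<alpha> * r i)" for i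
    using l2norm_product_difference_le[OF Xm(1)[of i] Xm(1)[of "i + k"] Xm(2)[of i] Xm(2)[of "i + k"]
        X4(1) X4(2) D4 D4]
    by (simp_all add: assms(9,10) b_def X\<alpha> r_def)
  \<comment> \<open>The sums of r over i and over i + k are each at most A and carry a factor 2 *
    \<alpha>.\<close>
  have b_sum: "(\<Sum>i\<in>J. b i) \<le> 4 * \<alpha> * A" if "finite J" for J
  proof -
    have "(\<Sum>i\<in>J. b i) \<le> (\<Sum>i\<in>J. 2 * \<alpha> * r (i + k) + 2 * \<alpha> * r i)"
      using b_le by (intro sum_mono) (simp add: algebra_simps)
    also have "\<dots> = 2 * \<alpha> * (\<Sum>i\<in>(\<lambda>i. i + k) ` J. r i) + 2 * \<alpha> * (\<Sum>i\<in>J. r i)"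
      by (simp add: sum.distrib sum_distrib_left sum.reindex inj_on_def)
    also have "\<dots> \<le> 2 * \<alpha> * A + 2 * \<alpha> * A"
      using A that \<open>0 \<le> \<alpha>\<close> by (intro add_mono mult_left_mono) auto
    finally show ?thesis by (simp add: mult_ac)
  qed
  have part1: "(\<Sum>\<^sub>\<infinity>i\<in>UNIV. Lp_norm M 2 (\<lambda>\<omega>. Y i \<omega> - Y' i \<omega>)) < \<infinity>"
    unfolding Lp_norm_2[OF Ysq] b_def[symmetric]
    by (rule infsum_ennreal_less_top[OF _ b_sum]) (simp_all add: b_def)
  \<comment> \<open>The product at site 0 as a function of the innovations;
    \<open>q (e i \<omega>)\<close> is then \<open>Y i \<omega>\<close>.\<close>
  define q where "q z = f z * f (shift k z)" for z
  have qm[measurable]: "q \<in> borel_measurable ?P" unfolding q_def[abs_def] by measurable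
  have shift_shift: "shift k (shift i z) = shift (i + k) z" for i and z :: "int ^ 'd \<Rightarrow> 'b"
    by (simp add: shift_def fun_eq_iff ac_simps)
  have qe: "q (e i \<omega>) = X i \<omega> * X (i + k) \<omega>" and qe': "q (e' i \<omega>) = X' i \<omega> * X' (i + k) \<omega>" for i \<omega>
    by (simp_all add: q_def X X' e_def e'_def shift_shift)
  have q: "square_integrable ?P q"
  proof -
    have "square_integrable M (\<lambda>\<omega>. X 0 \<omega> * X (0 + k) \<omega>)"
      by (rule l2norm_mult_le_l4norm[OF X4(1) X4(1) Xm(1) Xm(1)])
    then show ?thesis unfolding qe[symmetric] by (subst (asm) square_integrable_has_law[OF law_e qm])
  qed
  \<comment> \<open>By stationarity, resampling coordinate j in Y at site 0 amounts to resampling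
    coordinate 0 in Y at site -j.\<close>
  have infl: "influence N0 q j = b (- j)" for j
  proof -
    have m: "(\<lambda>W. q (shift (- j) (mix {} W)) - q (shift (- j) (mix {0} W))) \<in> borel_measurable (iid_measure N0)"
      by measurable
    have "influence N0 q j = influence N0 (\<lambda>x. q (shift (- j) x)) 0" by (simp add: influence_shift)
    also have "\<dots> = l2norm M (\<lambda>\<omega>. q (e (- j) \<omega>) - q (e' (- j) \<omega>))"
      unfolding influence_def e_def e'_def by (rule l2norm_has_law[OF law_E m, symmetric])
    finally show ?thesis by (simp add: b_def qe qe' assms(9,10))
  qed
  have D: "(\<Sum>j\<in>J. influence N0 q j) \<le> 4 * \<alpha> * A" if "finite J" for J
  proof -
    have "(\<Sum>j\<in>J. influence N0 q j) = (\<Sum>j\<in>uminus ` J. b j)" by (simp add: infl sum.reindex)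
    then show ?thesis using b_sum[of "uminus ` J"] that by simp
  qed
  have mean: "(LINT \<omega>'|M. X 0 \<omega>' * X k \<omega>') = (LINT x|?P. q x)"
    using integral_has_law[OF law_e[of 0] qm] by (simp add: qe)
  have part2: "(\<lambda>n. levy_dist
              (distr M borel (\<lambda>\<omega>. T n \<omega> / sqrt (real (card (\<Xi> n)))))
              (centered_gaussian ((LINT \<omega>|M. (T n \<omega>)\<^sup>2) / real (card (\<Xi> n)))))
         \<longlonglongrightarrow> 0"
    if T: "\<forall>n \<omega>. T n \<omega> = (\<Sum>i\<in>\<Xi> n. X i \<omega> * X (i + k) \<omega> - (LINT \<omega>'|M. X 0 \<omega>' * X k \<omega>'))"
      and card: "filterlim (\<lambda>n. card (\<Xi> n)) at_top sequentially"
    for \<Xi> :: "nat \<Rightarrow> (int ^ 'd) set" and T :: "nat \<Rightarrow> 'a \<Rightarrow> real"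
  proof -
    let ?S = "\<lambda>n. normalized_sum q (\<Xi> n)"
    have Sm: "?S n \<in> borel_measurable ?P" for n by (rule normalized_sum_measurable[OF qm])
    \<comment> \<open>All sites are shifts of the single point \<open>e 0 \<omega>\<close>, so T n
      is a function of one random element whose law is the product measure.\<close>
    have "shift i (e 0 \<omega>) = e i \<omega>" for i \<omega> by (simp add: e_def shift_def)
    then have TS: "T n \<omega> / sqrt (real (card (\<Xi> n))) = ?S n (e 0 \<omega>)" for n \<omega>
      by (simp add: T mean normalized_sum_def qe)
    have d: "distr M borel (\<lambda>\<omega>. T n \<omega> / sqrt (real (card (\<Xi> n)))) = distr ?P borel (?S n)" for n
      using distr_distr[OF Sm[of n] has_law_measurable[OF law_e[of 0]]] law_e[of 0]
      by (simp add: TS o_def has_law_def)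
    have v: "(LINT \<omega>|M. (T n \<omega>)\<^sup>2) / real (card (\<Xi> n)) = (LINT x|?P. (?S n x)\<^sup>2)" for n
    proof -
      have "(LINT \<omega>|M. (T n \<omega>)\<^sup>2) / real (card (\<Xi> n)) = (LINT \<omega>|M. (T n \<omega> / sqrt (real (card (\<Xi> n))))\<^sup>2)"
        by (simp add: power_divide)
      also have "\<dots> = (LINT x|?P. (?S n x)\<^sup>2)"
        unfolding TS by (rule integral_has_law[OF law_e borel_measurable_power[OF Sm]])
      finally show ?thesis .
    qed
    show ?thesis unfolding d v by (rule normalized_sum_clt[OF q D card])
  qed
  show ?thesis using part1 part2 by blast
qed

end
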